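(* Let $(A,\bar{\mathfrak m})$ be a noetherian local DG-ring, let $M\in\mathrm{D}^{+}_{\mathrm f}(A)$, let $\bar{\mathfrak p}\in\operatorname{Ass}_A(M)$, and suppose that $\bar{\mathfrak p}\in\operatorname{Supp}(\mathrm{H}^{\inf(M)}(M))$. Then $$\operatorname{seq.depth}_A(M)\le\dim(\mathrm{H}^0(A)/\bar{\mathfrak p}).$$
   Context: "DG-ring" means commutative non-positive DG-ring: a graded ring $A=\bigoplus_{n\le 0}A^n$ with a differential $d$ of degree $+1$, satisfying $d(ab)=d(a)b+(-1)^{\deg a}a\,d(b)$, $ba=(-1)^{\deg a\deg b}ab$, and $a^2=0$ for $\deg a$ odd. $\mathrm{D}(A)$ is the derived category of DG-modules over $A$. $\pi_A:A\to\mathrm{H}^0(A)$ is the natural map, with surjective degree-zero part $\pi^0_A:A^0\to\mathrm{H}^0(A)$. $A$ is noetherian if $\mathrm{H}^0(A)$ is noetherian and each $\mathrm{H}^n(A)$ is a finitely generated $\mathrm{H}^0(A)$-module; $(A,\bar{\mathfrak m})$ is noetherian local if moreover $\mathrm{H}^0(A)$ is local with maximal ideal $\bar{\mathfrak m}$. $\mathrm{D}^{+}_{\mathrm f}(A)\subseteq\mathrm{D}(A)$ consists of the $M$ with $\mathrm{H}^n(M)=0$ for $n\ll0$ and every $\mathrm{H}^n(M)$ finitely generated over $\mathrm{H}^0(A)$. $\inf(M)=\inf\{n:\mathrm{H}^n(M)\ne0\}$. $\dim$ is Krull dimension. Localization: for $\bar{\mathfrak p}\in\operatorname{Spec}(\mathrm{H}^0(A))$,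 $A_{\bar{\mathfrak p}}=A\otimes_{A^0}A^0_{\mathfrak p}$ with $\mathfrak p=(\pi_A^0)^{-1}(\bar{\mathfrak p})$, and $M_{\bar{\mathfrak p}}=M\otimes^{\mathrm L}_AA_{\bar{\mathfrak p}}$. For $(A,\bar{\mathfrak m})$ noetherian local and $M\in\mathrm{D}(A)$ with cohomology bounded below: $\bar x\in\bar{\mathfrak m}$ is $M$-regular if multiplication by $\bar x$ on $\mathrm{H}^{\inf(M)}(M)$ is injective; a sequence $\bar a_1,\dots,\bar a_n\in\bar{\mathfrak m}$ is $M$-regular if $\bar a_1$ is $M$-regular and $\bar a_2,\dots,\bar a_n$ is $K(M;\bar a_1)$-regular, where $K(M;\bar a_1)$ is the cone of $\bar a_1:M\to M$ in $\mathrm{D}(A)$. $\operatorname{seq.depth}_A(M)$ is the maximal length of an $M$-regular sequence in $\bar{\mathfrak m}$. $\operatorname{depth}_A(M)=\inf(\mathrm{R}\operatorname{Hom}_A(\mathrm{H}^0(A)/\bar{\mathfrak m},M))$. $\operatorname{Ass}_A(M)$ is the set of $\bar{\mathfrak p}\in\operatorname{Spec}(\mathrm{H}^0(A))$ with $M_{\bar{\mathfrak p}}\not\cong0$ and $\operatorname{depth}_{A_{\bar{\mathfrak p}}}(M_{\bar{\mathfrak p}})=\inf(M_{\bar{\mathfrak p}})$. *)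

theory Defs
  imports
    "HOL-Algebra.QuotRing"
    "HOL-Algebra.Module"
    "HOL-Algebra.Ring_Divisibility"
    "HOL-Library.Extended_Nat"
    "HOL-Library.Extended_Real"
begin

section \<open>Commutative algebra missing from HOL-Algebra\<close>

definition fin_gen :: "('a, 'z) ring_scheme \<Rightarrow> ('a, 'm, 'y) module_scheme \<Rightarrow> bool" where
  "fin_gen R N \<longleftrightarrow> (\<exists>S. finite S \<and> S \<subseteq> carrier N \<and>
     (\<forall>x \<in> carrier N. \<exists>c \<in> S \<rightarrow> carrier R. x = (\<Oplus>\<^bsub>N\<^esub>s \<in> S. c s \<odot>\<^bsub>N\<^esub> s)))"

text \<open>The supremum of the lengths of chains of primes; the zero ring gets dimension 0, which is
  irrelevant for the domains \<open>R Quot p\<close> with \<open>p\<close> prime.\<close>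

definition krull_dim :: "('a, 'z) ring_scheme \<Rightarrow> enat" where
  "krull_dim R = (SUP n \<in> {n. \<exists>P :: nat \<Rightarrow> 'a set.
     (\<forall>i \<le> n. primeideal (P i) R) \<and> (\<forall>i < n. P i \<subset> P (Suc i))}. enat n)"

text \<open>Fractions \<open>m/s\<close> with numerators in \<open>C\<close> and denominators in \<open>S\<close>, where \<open>act\<close> is the
  multiplication of numerators by denominators: \<open>m/s = n/t\<close> iff \<open>u t m = u s n\<close> for some \<open>u\<close> in \<open>S\<close>.\<close>

definition frac_rel :: "'a set \<Rightarrow> 'm set \<Rightarrow> ('a \<Rightarrow> 'm \<Rightarrow> 'm) \<Rightarrow> (('m \<times> 'a) \<times> ('m \<times> 'a)) set" where
  "frac_rel S C act = {((m, s), (n, t)). m \<in> C \<and> n \<in> C \<and> s \<in> S \<and> t \<in> S \<and>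
     (\<exists>u \<in> S. act u (act t m) = act u (act s n))}"

definition frac :: "'a set \<Rightarrow> 'm set \<Rightarrow> ('a \<Rightarrow> 'm \<Rightarrow> 'm) \<Rightarrow> 'm \<Rightarrow> 'a \<Rightarrow> ('m \<times> 'a) set" where
  "frac S C act m s = frac_rel S C act `` {(m, s)}"

definition Supp :: "('a, 'z) ring_scheme \<Rightarrow> ('a, 'm, 'y) module_scheme \<Rightarrow> 'a set set" where
  "Supp R N = {p. primeideal p R \<and>
     (\<exists>x \<in> carrier N. \<exists>s \<in> carrier R - p.
        frac (carrier R - p) (carrier N) (smult N) x s
          \<noteq> frac (carrier R - p) (carrier N) (smult N) \<zero>\<^bsub>N\<^esub> \<one>\<^bsub>R\<^esub>)}"


section \<open>DG-rings and DG-modules\<close>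

text \<open>A graded object is an abelian group that is the internal direct sum of subgroups \<open>gr M n\<close>.\<close>

record 'm dg = "'m ring" +
  gr :: "int \<Rightarrow> 'm set"
  dif :: "'m \<Rightarrow> 'm"

record ('a, 'm) dg_module = "'m dg" +
  act :: "'a \<Rightarrow> 'm \<Rightarrow> 'm"

definition is_decomp :: "('m, 'z) dg_scheme \<Rightarrow> 'm \<Rightarrow> (int \<Rightarrow> 'm) \<Rightarrow> bool" where
  "is_decomp M x f \<longleftrightarrow> (\<forall>n. f n \<in> gr M n) \<and> finite {n. f n \<noteq> \<zero>\<^bsub>M\<^esub>} \<and>
     x = (\<Oplus>\<^bsub>M\<^esub>n \<in> {n. f n \<noteq> \<zero>\<^bsub>M\<^esub>}. f n)"

definition hpart :: "('m, 'z) dg_scheme \<Rightarrow> int \<Rightarrow> 'm \<Rightarrow> 'm" where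
  "hpart M n x = (THE f. is_decomp M x f) n"

text \<open>\<open>signed M i x\<close> is $(-1)^i x$.\<close>

definition signed :: "('m, 'z) ring_scheme \<Rightarrow> int \<Rightarrow> 'm \<Rightarrow> 'm" where
  "signed M i x = (if even i then x else \<ominus>\<^bsub>M\<^esub> x)"

locale dg_complex = abelian_group M for M :: "('m, 'z) dg_scheme" (structure) +
  assumes gr_subgroup: "additive_subgroup (gr M n) M"
    and direct_sum: "x \<in> carrier M \<Longrightarrow> \<exists>!f. is_decomp M x f"
    and dif_add: "\<lbrakk>x \<in> carrier M; y \<in> carrier M\<rbrakk> \<Longrightarrow> dif M (x \<oplus> y) = dif M x \<oplus> dif M y"
    and dif_gr: "x \<in> gr M n \<Longrightarrow> dif M x \<in> gr M (n + 1)"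
    and dif_dif: "x \<in> carrier M \<Longrightarrow> dif M (dif M x) = \<zero>"

locale dg_ring = R?: ring A + C?: dg_complex A for A :: "('a, 'z) dg_scheme" (structure) +
  assumes one_gr: "\<one> \<in> gr A 0"
    and mult_gr: "\<lbrakk>a \<in> gr A i; b \<in> gr A j\<rbrakk> \<Longrightarrow> a \<otimes> b \<in> gr A (i + j)"
    and leibniz: "\<lbrakk>a \<in> gr A i; b \<in> carrier A\<rbrakk> \<Longrightarrow>
      dif A (a \<otimes> b) = dif A a \<otimes> b \<oplus> signed A i (a \<otimes> dif A b)"
    and graded_comm: "\<lbrakk>a \<in> gr A i; b \<in> gr A j\<rbrakk> \<Longrightarrow> b \<otimes> a = signed A (i * j) (a \<otimes> b)"
    and odd_square: "\<lbrakk>a \<in> gr A i; odd i\<rbrakk> \<Longrightarrow> a \<otimes> a = \<zero>"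
    and nonpos: "0 < n \<Longrightarrow> gr A n = {\<zero>}"

locale dg_mod = A?: dg_ring A + M?: dg_complex M
  for A :: "('a, 'z) dg_scheme" (structure) and M :: "('a, 'm, 'y) dg_module_scheme" (structure) +
  assumes act_gr: "\<lbrakk>a \<in> gr A i; x \<in> gr M j\<rbrakk> \<Longrightarrow> act M a x \<in> gr M (i + j)"
    and act_closed: "\<lbrakk>a \<in> carrier A; x \<in> carrier M\<rbrakk> \<Longrightarrow> act M a x \<in> carrier M"
    and act_l_distr: "\<lbrakk>a \<in> carrier A; b \<in> carrier A; x \<in> carrier M\<rbrakk> \<Longrightarrow>
      act M (a \<oplus>\<^bsub>A\<^esub> b) x = act M a x \<oplus>\<^bsub>M\<^esub> act M b x"
    and act_r_distr: "\<lbrakk>a \<in> carrier A; x \<in> carrier M; y \<in> carrier M\<rbrakk> \<Longrightarrow>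
      act M a (x \<oplus>\<^bsub>M\<^esub> y) = act M a x \<oplus>\<^bsub>M\<^esub> act M a y"
    and act_assoc: "\<lbrakk>a \<in> carrier A; b \<in> carrier A; x \<in> carrier M\<rbrakk> \<Longrightarrow>
      act M (a \<otimes>\<^bsub>A\<^esub> b) x = act M a (act M b x)"
    and act_one: "x \<in> carrier M \<Longrightarrow> act M \<one>\<^bsub>A\<^esub> x = x"
    and act_leibniz: "\<lbrakk>a \<in> gr A i; x \<in> carrier M\<rbrakk> \<Longrightarrow>
      dif M (act M a x) = act M (dif A a) x \<oplus>\<^bsub>M\<^esub> signed M i (act M a (dif M x))"

definition self_mod :: "('a, 'z) dg_scheme \<Rightarrow> ('a, 'a) dg_module" where
  "self_mod A = \<lparr>carrier = carrier A, mult = mult A, one = one A, zero = zero A, add = add A,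
     gr = gr A, dif = dif A, act = mult A\<rparr>"


section \<open>Cohomology\<close>

definition cocycles :: "('m, 'z) dg_scheme \<Rightarrow> int \<Rightarrow> 'm set" where
  "cocycles M n = {x \<in> gr M n. dif M x = \<zero>\<^bsub>M\<^esub>}"

definition cobounds :: "('m, 'z) dg_scheme \<Rightarrow> int \<Rightarrow> 'm set" where
  "cobounds M n = dif M ` gr M (n - 1)"

definition coh_class :: "('m, 'z) dg_scheme \<Rightarrow> int \<Rightarrow> 'm \<Rightarrow> 'm set" where
  "coh_class M n x = cobounds M n +>\<^bsub>M\<^esub> x"

text \<open>Since \<open>A\<close> is non-positive, every element of degree 0 is a cocycle.\<close>

definition H0 :: "('a, 'z) dg_scheme \<Rightarrow> 'a set ring" where
  "H0 A = (A\<lparr>carrier := gr A 0\<rparr>) Quot (cobounds A 0)"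

text \<open>\<open>coh M n\<close> is a module over \<open>H0 A\<close>; its ring multiplication is not used.\<close>

definition coh :: "('a, 'm, 'y) dg_module_scheme \<Rightarrow> int \<Rightarrow> ('a set, 'm set) module" where
  "coh M n = \<lparr>carrier = coh_class M n ` cocycles M n, mult = undefined, one = undefined,
     zero = cobounds M n, add = set_add M,
     smult = (\<lambda>X Y. \<Union>a \<in> X. \<Union>y \<in> Y. coh_class M n (act M a y))\<rparr>"

definition coh_nonzero :: "('a, 'm, 'y) dg_module_scheme \<Rightarrow> int \<Rightarrow> bool" where
  "coh_nonzero M n \<longleftrightarrow> carrier (coh M n) \<noteq> {\<zero>\<^bsub>coh M n\<^esub>}"

text \<open>An object of the derived category is zero iff it is acyclic.\<close>

definition acyclic_dg :: "('a, 'm, 'y) dg_module_scheme \<Rightarrow> bool" where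
  "acyclic_dg M \<longleftrightarrow> (\<forall>n. \<not> coh_nonzero M n)"

definition dg_inf :: "('a, 'm, 'y) dg_module_scheme \<Rightarrow> ereal" where
  "dg_inf M = (INF n \<in> {n. coh_nonzero M n}. ereal (of_int n))"

definition noetherian_local_dg_ring :: "('a, 'z) dg_scheme \<Rightarrow> 'a set set \<Rightarrow> bool" where
  "noetherian_local_dg_ring A m \<longleftrightarrow> dg_ring A \<and>
     noetherian_ring (H0 A) \<and> (\<forall>n. fin_gen (H0 A) (coh (self_mod A) n)) \<and>
     maximalideal m (H0 A) \<and> (\<forall>J. maximalideal J (H0 A) \<longrightarrow> J = m)"

definition D_plus_f :: "('a, 'z) dg_scheme \<Rightarrow> ('a, 'm, 'y) dg_module_scheme \<Rightarrow> bool" where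
  "D_plus_f A M \<longleftrightarrow> dg_mod A M \<and> (\<exists>N. \<forall>n < N. \<not> coh_nonzero M n) \<and>
     (\<forall>n. fin_gen (H0 A) (coh M n))"


section \<open>Derived Hom\<close>

text \<open>The Hom complex \<open>Hom_A(P, M)\<close>: in degree \<open>n\<close> the graded maps \<open>f\<close> of degree \<open>n\<close> with
  $f(ax) = (-1)^{n |a|} a f(x)$, with differential $f \mapsto d f - (-1)^n f d$.\<close>

definition hom_gr :: "('a, 'z) dg_scheme \<Rightarrow> ('a, 'p, 'x) dg_module_scheme \<Rightarrow>
    ('a, 'm, 'y) dg_module_scheme \<Rightarrow> int \<Rightarrow> ('p \<Rightarrow> 'm) set" where
  "hom_gr A P M n = {f \<in> carrier P \<rightarrow>\<^sub>E carrier M.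
     (\<forall>x \<in> carrier P. \<forall>y \<in> carrier P. f (x \<oplus>\<^bsub>P\<^esub> y) = f x \<oplus>\<^bsub>M\<^esub> f y) \<and>
     (\<forall>i. \<forall>x \<in> gr P i. f x \<in> gr M (i + n)) \<and>
     (\<forall>i. \<forall>a \<in> gr A i. \<forall>x \<in> carrier P. f (act P a x) = signed M (n * i) (act M a (f x)))}"

definition hom_dif :: "('a, 'p, 'x) dg_module_scheme \<Rightarrow> ('a, 'm, 'y) dg_module_scheme \<Rightarrow>
    int \<Rightarrow> ('p \<Rightarrow> 'm) \<Rightarrow> 'p \<Rightarrow> 'm" where
  "hom_dif P M n f = (\<lambda>x \<in> carrier P. dif M (f x) \<ominus>\<^bsub>M\<^esub> signed M n (f (dif P x)))"

definition hom_cocycles :: "('a, 'z) dg_scheme \<Rightarrow> ('a, 'p, 'x) dg_module_scheme \<Rightarrow>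
    ('a, 'm, 'y) dg_module_scheme \<Rightarrow> int \<Rightarrow> ('p \<Rightarrow> 'm) set" where
  "hom_cocycles A P M n = {f \<in> hom_gr A P M n. hom_dif P M n f = (\<lambda>x \<in> carrier P. \<zero>\<^bsub>M\<^esub>)}"

definition hom_cobounds :: "('a, 'z) dg_scheme \<Rightarrow> ('a, 'p, 'x) dg_module_scheme \<Rightarrow>
    ('a, 'm, 'y) dg_module_scheme \<Rightarrow> int \<Rightarrow> ('p \<Rightarrow> 'm) set" where
  "hom_cobounds A P M n = hom_dif P M (n - 1) ` hom_gr A P M (n - 1)"

definition lin_comb :: "('a, 'z) dg_scheme \<Rightarrow> ('a, 'p, 'x) dg_module_scheme \<Rightarrow> 'p set \<Rightarrow>
    ('p \<Rightarrow> 'a) \<Rightarrow> 'p \<Rightarrow> bool" where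
  "lin_comb A P B c x \<longleftrightarrow> (\<forall>b \<in> B. c b \<in> carrier A) \<and> (\<forall>b. b \<notin> B \<longrightarrow> c b = \<zero>\<^bsub>A\<^esub>) \<and>
     finite {b. c b \<noteq> \<zero>\<^bsub>A\<^esub>} \<and> x = (\<Oplus>\<^bsub>P\<^esub>b \<in> {b. c b \<noteq> \<zero>\<^bsub>A\<^esub>}. act P (c b) b)"

text \<open>\<open>P\<close> is semi-free: it has a homogeneous basis \<open>B 0 \<union> B 1 \<union> \<dots>\<close> over the underlying graded
  ring such that the differential maps \<open>B j\<close> into the span of \<open>B 0 \<union> \<dots> \<union> B (j - 1)\<close>.\<close>

definition semifree :: "('a, 'z) dg_scheme \<Rightarrow> ('a, 'p, 'x) dg_module_scheme \<Rightarrow> bool" where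
  "semifree A P \<longleftrightarrow> dg_mod A P \<and> (\<exists>B :: nat \<Rightarrow> 'p set.
     (\<forall>j. B j \<subseteq> (\<Union>n. gr P n)) \<and>
     (\<forall>i j. i \<noteq> j \<longrightarrow> B i \<inter> B j = {}) \<and>
     (\<forall>x \<in> carrier P. \<exists>!c. lin_comb A P (\<Union>j. B j) c x) \<and>
     (\<forall>j. \<forall>b \<in> B j. \<exists>c. lin_comb A P (\<Union>i<j. B i) c (dif P b)))"

definition quasi_iso :: "('a, 'z) dg_scheme \<Rightarrow> ('a, 'p, 'x) dg_module_scheme \<Rightarrow>
    ('a, 'm, 'y) dg_module_scheme \<Rightarrow> ('p \<Rightarrow> 'm) \<Rightarrow> bool" where
  "quasi_iso A P M q \<longleftrightarrow> q \<in> hom_cocycles A P M 0 \<and>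
     (\<forall>n. bij_betw (\<lambda>Y. \<Union>y \<in> Y. coh_class M n (q y)) (carrier (coh P n)) (carrier (coh M n)))"

text \<open>\<open>RHom_nonzero A X M n\<close> says that \<open>H^n(RHom_A(X, M))\<close> is nonzero, where \<open>RHom_A(X, M)\<close> is
  \<open>Hom_A(P, M)\<close> for a semi-free resolution \<open>P\<close> of \<open>X\<close>. The choice of \<open>P\<close> does not matter, as any two
  semi-free resolutions are homotopy equivalent. Restricting to resolutions on the type
  \<open>('a + 'x) list\<close> loses nothing: \<open>X\<close> has a semi-free resolution whose cardinality is at most that of
  the disjoint union of \<open>A\<close>, \<open>X\<close> and the natural numbers, and that always fits into this type.\<close>

definition RHom_nonzero :: "('a, 'z) dg_scheme \<Rightarrow> ('a, 'x, 'w) dg_module_scheme \<Rightarrow>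
    ('a, 'm, 'y) dg_module_scheme \<Rightarrow> int \<Rightarrow> bool" where
  "RHom_nonzero A X M n \<longleftrightarrow> (\<exists>(P :: ('a, ('a + 'x) list) dg_module) q.
     semifree A P \<and> quasi_iso A P X q \<and> hom_cocycles A P M n \<noteq> hom_cobounds A P M n)"

text \<open>The residue field \<open>H0 A Quot m\<close> as a DG-module in degree 0, through \<open>A \<rightarrow> H0 A\<close>.\<close>

definition residue_mod :: "('a, 'z) dg_scheme \<Rightarrow> 'a set set \<Rightarrow> ('a, 'a set set) dg_module" where
  "residue_mod A m = (let k = H0 A Quot m in
     \<lparr>carrier = carrier k, mult = mult k, one = one k, zero = zero k, add = add k,
      gr = (\<lambda>n. if n = 0 then carrier k else {\<zero>\<^bsub>k\<^esub>}),
      dif = (\<lambda>_. \<zero>\<^bsub>k\<^esub>),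
      act = (\<lambda>a x. (m +>\<^bsub>H0 A\<^esub> coh_class A 0 (hpart A 0 a)) \<otimes>\<^bsub>k\<^esub> x)\<rparr>)"

definition depth :: "('a, 'z) dg_scheme \<Rightarrow> 'a set set \<Rightarrow> ('a, 'm, 'y) dg_module_scheme \<Rightarrow> ereal" where
  "depth A m M = (INF n \<in> {n. RHom_nonzero A (residue_mod A m) M n}. ereal (of_int n))"


section \<open>Localization and associated primes\<close>

text \<open>The preimage of \<open>p\<close> in $A^0$, and its complement.\<close>

definition prime_preimage :: "('a, 'z) dg_scheme \<Rightarrow> 'a set set \<Rightarrow> 'a set" where
  "prime_preimage A p = {a \<in> gr A 0. coh_class A 0 a \<in> p}"

definition denoms :: "('a, 'z) dg_scheme \<Rightarrow> 'a set set \<Rightarrow> 'a set" where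
  "denoms A p = gr A 0 - prime_preimage A p"

text \<open>$A \otimes_{A^0} A^0_{\mathfrak p}$ is the localization of \<open>A\<close> at the central multiplicative
  set \<open>denoms A p\<close>, whose elements are cocycles.\<close>

definition loc_ring :: "('a, 'z) dg_scheme \<Rightarrow> 'a set set \<Rightarrow> ('a \<times> 'a) set dg" where
  "loc_ring A p = (let S = denoms A p; F = frac S (carrier A) (mult A) in
     \<lparr>carrier = {F a s | a s. a \<in> carrier A \<and> s \<in> S},
      mult = (\<lambda>X Y. \<Union>(a, s) \<in> X. \<Union>(b, t) \<in> Y. F (a \<otimes>\<^bsub>A\<^esub> b) (s \<otimes>\<^bsub>A\<^esub> t)),
      one = F \<one>\<^bsub>A\<^esub> \<one>\<^bsub>A\<^esub>,
      zero = F \<zero>\<^bsub>A\<^esub> \<one>\<^bsub>A\<^esub>,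
      add = (\<lambda>X Y. \<Union>(a, s) \<in> X. \<Union>(b, t) \<in> Y.
        F ((t \<otimes>\<^bsub>A\<^esub> a) \<oplus>\<^bsub>A\<^esub> (s \<otimes>\<^bsub>A\<^esub> b)) (s \<otimes>\<^bsub>A\<^esub> t)),
      gr = (\<lambda>n. {F a s | a s. a \<in> gr A n \<and> s \<in> S}),
      dif = (\<lambda>X. \<Union>(a, s) \<in> X. F (dif A a) s)\<rparr>)"

text \<open>Because \<open>loc_ring A p\<close> is flat over \<open>A\<close>, the derived tensor product of \<open>M\<close> with it is the
  ordinary one, which is the module of fractions of \<open>M\<close>.\<close>

definition loc_mod :: "('a, 'z) dg_scheme \<Rightarrow> 'a set set \<Rightarrow> ('a, 'm, 'y) dg_module_scheme \<Rightarrow>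
    (('a \<times> 'a) set, ('m \<times> 'a) set) dg_module" where
  "loc_mod A p M = (let S = denoms A p; F = frac S (carrier M) (act M) in
     \<lparr>carrier = {F x s | x s. x \<in> carrier M \<and> s \<in> S},
      mult = undefined, one = undefined,
      zero = F \<zero>\<^bsub>M\<^esub> \<one>\<^bsub>A\<^esub>,
      add = (\<lambda>X Y. \<Union>(x, s) \<in> X. \<Union>(y, t) \<in> Y.
        F (act M t x \<oplus>\<^bsub>M\<^esub> act M s y) (s \<otimes>\<^bsub>A\<^esub> t)),
      gr = (\<lambda>n. {F x s | x s. x \<in> gr M n \<and> s \<in> S}),
      dif = (\<lambda>X. \<Union>(x, s) \<in> X. F (dif M x) s),
      act = (\<lambda>X Y. \<Union>(a, s) \<in> X. \<Union>(y, t) \<in> Y. F (act M a y) (s \<otimes>\<^bsub>A\<^esub> t))\<rparr>)"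

text \<open>The maximal ideal of \<open>H0 (loc_ring A p)\<close>: the classes of the fractions \<open>a/s\<close> with \<open>a\<close> in the
  preimage of \<open>p\<close>.\<close>

definition loc_max :: "('a, 'z) dg_scheme \<Rightarrow> 'a set set \<Rightarrow> ('a \<times> 'a) set set set" where
  "loc_max A p = {coh_class (loc_ring A p) 0 (frac (denoms A p) (carrier A) (mult A) a s) | a s.
     a \<in> prime_preimage A p \<and> s \<in> denoms A p}"

definition Ass :: "('a, 'z) dg_scheme \<Rightarrow> ('a, 'm, 'y) dg_module_scheme \<Rightarrow> 'a set set set" where
  "Ass A M = {p. primeideal p (H0 A) \<and> \<not> acyclic_dg (loc_mod A p M) \<and>
     depth (loc_ring A p) (loc_max A p) (loc_mod A p M) = dg_inf (loc_mod A p M)}"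


section \<open>Regular sequences and sequential depth\<close>

text \<open>Elements of iterated cones on \<open>M\<close>. A single type for all of them is needed because the
  definition of regular sequences recurses through cones.\<close>

datatype 'm cone_elem = Base (base: 'm) | CPair (shifted: "'m cone_elem") (unshifted: "'m cone_elem")

definition embed :: "('a, 'm, 'y) dg_module_scheme \<Rightarrow> ('a, 'm cone_elem) dg_module" where
  "embed M = \<lparr>carrier = Base ` carrier M, mult = undefined, one = undefined,
     zero = Base \<zero>\<^bsub>M\<^esub>,
     add = (\<lambda>x y. Base (base x \<oplus>\<^bsub>M\<^esub> base y)),
     gr = (\<lambda>n. Base ` gr M n),
     dif = (\<lambda>x. Base (dif M (base x))),
     act = (\<lambda>a x. Base (act M a (base x)))\<rparr>"

text \<open>The automorphism of \<open>A\<close> that multiplies degree \<open>n\<close> by $(-1)^n$; the action of \<open>A\<close> on a shifted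
  module \<open>M[1]\<close> is the action on \<open>M\<close> precomposed with it.\<close>

definition sign_aut :: "('a, 'z) dg_scheme \<Rightarrow> 'a \<Rightarrow> 'a" where
  "sign_aut A a = (\<Oplus>\<^bsub>A\<^esub>n \<in> {n. hpart A n a \<noteq> \<zero>\<^bsub>A\<^esub>}. signed A n (hpart A n a))"

text \<open>The cone \<open>N[1] \<oplus> N\<close> of the multiplication by \<open>a\<close> in $A^0$, with differential
  $(u, v) \mapsto (-du, au + dv)$.\<close>

definition cone :: "('a, 'z) dg_scheme \<Rightarrow> ('a, 'm cone_elem) dg_module \<Rightarrow> 'a \<Rightarrow>
    ('a, 'm cone_elem) dg_module" where
  "cone A N a = \<lparr>carrier = {CPair u v | u v. u \<in> carrier N \<and> v \<in> carrier N},
     mult = undefined, one = undefined,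
     zero = CPair \<zero>\<^bsub>N\<^esub> \<zero>\<^bsub>N\<^esub>,
     add = (\<lambda>x y. CPair (shifted x \<oplus>\<^bsub>N\<^esub> shifted y) (unshifted x \<oplus>\<^bsub>N\<^esub> unshifted y)),
     gr = (\<lambda>n. {CPair u v | u v. u \<in> gr N (n + 1) \<and> v \<in> gr N n}),
     dif = (\<lambda>x. CPair (\<ominus>\<^bsub>N\<^esub> dif N (shifted x)) (act N a (shifted x) \<oplus>\<^bsub>N\<^esub> dif N (unshifted x))),
     act = (\<lambda>b x. CPair (act N (sign_aut A b) (shifted x)) (act N b (unshifted x)))\<rparr>"

text \<open>For \<open>x\<close> in \<open>H0 A\<close>, the map \<open>x : N \<rightarrow> N\<close> in the derived category is multiplication by any
  representative of the coset \<open>x\<close>.\<close>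

definition koszul :: "('a, 'z) dg_scheme \<Rightarrow> ('a, 'm cone_elem) dg_module \<Rightarrow> 'a set \<Rightarrow>
    ('a, 'm cone_elem) dg_module" where
  "koszul A N x = cone A N (SOME a. a \<in> x)"

definition regular_elem :: "('a, 'm, 'y) dg_module_scheme \<Rightarrow> 'a set \<Rightarrow> bool" where
  "regular_elem M x \<longleftrightarrow> (\<forall>n. dg_inf M = ereal (of_int n) \<longrightarrow>
     inj_on (smult (coh M n) x) (carrier (coh M n)))"

primrec regular_seq :: "('a, 'z) dg_scheme \<Rightarrow> 'a set set \<Rightarrow> 'a set list \<Rightarrow>
    ('a, 'm cone_elem) dg_module \<Rightarrow> bool" where
  "regular_seq A m [] N \<longleftrightarrow> True"
| "regular_seq A m (x # xs) N \<longleftrightarrow>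
     x \<in> m \<and> regular_elem N x \<and> regular_seq A m xs (koszul A N x)"

definition seq_depth :: "('a, 'z) dg_scheme \<Rightarrow> 'a set set \<Rightarrow> ('a, 'm, 'y) dg_module_scheme \<Rightarrow> enat" where
  "seq_depth A m M = (SUP xs \<in> {xs. regular_seq A m xs (embed M)}. enat (length xs))"

end

theory Submission
  imports Defs
begin

text \<open>
  Let \<open>i\<close> be the infimum of \<open>M\<close>. The proof first turns the hypothesis \<open>p \<in> Ass A M\<close> into a statement about the
  single module \<open>coh M i\<close>, and then follows a regular sequence by commutative algebra.

  As \<open>p\<close> lies in the support of \<open>coh M i\<close>, the localization of \<open>M\<close> at \<open>p\<close> has infimum \<open>i\<close>, and \<open>p \<in> Ass A M\<close>
  says that its depth is \<open>i\<close>. So some semi-free resolution \<open>P\<close> of the residue field at \<open>p\<close> has a map of degree \<open>i\<close>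
  into the localization that is not null-homotopic. Such a map is nonzero on the cohomology of \<open>P\<close> in degree 0
  (\<open>semifree_hom_vanishing_on_bottom\<close>): up to homotopy it factors through the truncation of \<open>P\<close> to degrees at
  most 0, and if it vanished on the cohomology in degree 0 it would have its image in an acyclic submodule of the
  localization, to which semi-freeness of \<open>P\<close> applies (\<open>semifree_lift\<close>). Hence the localization has a nonzero class of
  degree \<open>i\<close> that the maximal ideal kills (\<open>RHom_residue_bottom\<close>), and after clearing denominators \<open>coh M i\<close> has an
  element with annihilator \<open>p\<close> (\<open>Ass_imp_assoc_prime_bottom\<close>): \<open>p\<close> is an associated prime of \<open>coh M i\<close> in the
  sense of commutative algebra.

  Now let \<open>x\<close> be \<open>M\<close>-regular. By the exact sequence of the cone of \<open>x\<close>, the cone has infimum \<open>i\<close> again, all its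
  cohomology modules are noetherian, and the one in degree \<open>i\<close> contains \<open>coh M i\<close> modulo \<open>x\<close>. As \<open>x\<close> is regular on
  \<open>coh M i\<close>, it is not in \<open>p\<close>, and the quotient has an associated prime that contains \<open>p\<close> and \<open>x\<close>
  (\<open>assoc_prime_mod_regular\<close>). So each element of a regular sequence makes the associated prime strictly bigger,
  and a regular sequence of length \<open>n\<close> yields a chain of \<open>n\<close> strict inclusions of primes that starts
  at \<open>p\<close> (\<open>regular_seq_prime_chain\<close>). This is a chain of primes of \<open>H0 A Quot p\<close>.
\<close>


section \<open>Noetherian modules and associated primes\<close>

text \<open>The ascending chain condition, rather than finite generation of submodules: it is the form that
  passes through exact sequences and that is used below.\<close>

locale noetherian_module = module R L for R (structure) and L (structure) +
  assumes chain_stationary: "\<lbrakk>\<And>k :: nat. submodule (U k) R L; \<And>k. U k \<subseteq> U (Suc k)\<rbrakk>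
    \<Longrightarrow> \<exists>n. \<forall>k\<ge>n. U k = U n"

lemma (in cring) ideal_if_closed:
  assumes sub: "I \<subseteq> carrier R" and ne: "I \<noteq> {}"
    and add: "\<And>a b. \<lbrakk>a \<in> I; b \<in> I\<rbrakk> \<Longrightarrow> a \<oplus> b \<in> I"
    and mult: "\<And>r a. \<lbrakk>r \<in> carrier R; a \<in> I\<rbrakk> \<Longrightarrow> r \<otimes> a \<in> I"
  shows "ideal I R"
proof (rule idealI[OF ring_axioms])
  show "subgroup I (add_monoid R)"
  proof (rule add.subgroupI[OF sub ne])
    fix a assume "a \<in> I"
    then show "\<ominus> a \<in> I" using mult[of "\<ominus> \<one>" a] sub by (simp add: l_minus subset_iff)
  qed (rule add)
  fix a x assume "a \<in> I" "x \<in> carrier R"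
  then show "x \<otimes> a \<in> I" "a \<otimes> x \<in> I" using mult[of x a] sub m_comm[of a x] by auto
qed

lemma (in module) submodule_if_closed:
  assumes sub: "H \<subseteq> carrier M" and ne: "H \<noteq> {}"
    and add: "\<And>a b. \<lbrakk>a \<in> H; b \<in> H\<rbrakk> \<Longrightarrow> a \<oplus>\<^bsub>M\<^esub> b \<in> H"
    and smult: "\<And>r a. \<lbrakk>r \<in> carrier R; a \<in> H\<rbrakk> \<Longrightarrow> r \<odot>\<^bsub>M\<^esub> a \<in> H"
  shows "submodule H R M"
proof (rule submoduleI[OF sub _ _ add smult])
  obtain h where "h \<in> H" using ne by blast
  then show "\<zero>\<^bsub>M\<^esub> \<in> H" using smult[of \<zero> h] sub by auto
  fix a assume "a \<in> H"
  then show "\<ominus>\<^bsub>M\<^esub> a \<in> H" using smult[of "\<ominus> \<one>" a] sub by (auto simp: smult_l_minus)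
qed

definition linear_map where
  "linear_map R L L' f \<longleftrightarrow> f \<in> carrier L \<rightarrow> carrier L' \<and>
     (\<forall>x \<in> carrier L. \<forall>y \<in> carrier L. f (x \<oplus>\<^bsub>L\<^esub> y) = f x \<oplus>\<^bsub>L'\<^esub> f y) \<and>
     (\<forall>r \<in> carrier R. \<forall>x \<in> carrier L. f (r \<odot>\<^bsub>L\<^esub> x) = r \<odot>\<^bsub>L'\<^esub> f x)"

lemma linear_mapD:
  assumes "linear_map R L L' f"
  shows "x \<in> carrier L \<Longrightarrow> f x \<in> carrier L'"
    and "\<lbrakk>x \<in> carrier L; y \<in> carrier L\<rbrakk> \<Longrightarrow> f (x \<oplus>\<^bsub>L\<^esub> y) = f x \<oplus>\<^bsub>L'\<^esub> f y"
    and "\<lbrakk>r \<in> carrier R; x \<in> carrier L\<rbrakk> \<Longrightarrow> f (r \<odot>\<^bsub>L\<^esub> x) = r \<odot>\<^bsub>L'\<^esub> f x"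
  using assms by (auto simp: linear_map_def)

lemma linear_map_zero:
  assumes "module R L" "module R L'" "linear_map R L L' f"
  shows "f \<zero>\<^bsub>L\<^esub> = \<zero>\<^bsub>L'\<^esub>"
proof -
  interpret L: module R L by fact
  interpret L': module R L' by fact
  have "f (\<zero>\<^bsub>R\<^esub> \<odot>\<^bsub>L\<^esub> \<zero>\<^bsub>L\<^esub>) = \<zero>\<^bsub>R\<^esub> \<odot>\<^bsub>L'\<^esub> f \<zero>\<^bsub>L\<^esub>"
    using assms(3) by (simp add: linear_mapD del: L.smult_l_null L.smult_r_null)
  then show ?thesis
    using linear_mapD(1)[OF assms(3) L.zero_closed] by simp
qed

lemma linear_map_minus:
  assumes "module R L" "module R L'" "linear_map R L L' f" "x \<in> carrier L"
  shows "f (\<ominus>\<^bsub>L\<^esub> x) = \<ominus>\<^bsub>L'\<^esub> f x"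
proof -
  interpret L: module R L by fact
  interpret L': module R L' by fact
  have "f (\<ominus>\<^bsub>L\<^esub> x) \<oplus>\<^bsub>L'\<^esub> f x = \<zero>\<^bsub>L'\<^esub>"
    using linear_mapD(2)[OF assms(3), of "\<ominus>\<^bsub>L\<^esub> x" x] assms(4) linear_map_zero[OF assms(1-3)]
    by (simp add: L.M.l_neg)
  then show ?thesis
    using L'.M.minus_equality linear_mapD(1)[OF assms(3)] assms(4) by simp
qed

lemma submodule_zero: "submodule U R L \<Longrightarrow> \<zero>\<^bsub>L\<^esub> \<in> U"
  using subgroup.one_closed[of U "add_monoid L"] by (simp add: submodule.axioms(1))

lemma linear_map_vimage_submodule:
  assumes "module R L" "module R L'" "linear_map R L L' f" "submodule U R L'"
  shows "submodule {x \<in> carrier L. f x \<in> U} R L"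
proof -
  interpret L: module R L by fact
  interpret L': module R L' by fact
  note U = L'.submoduleE[OF assms(4)]
  show ?thesis
    by (intro L.submoduleI)
      (auto simp: submodule_zero[OF assms(4)] linear_map_zero[OF assms(1-3)] linear_map_minus[OF assms(1-3)] U linear_mapD[OF assms(3)])
qed

lemma linear_map_image_submodule:
  assumes "module R L" "module R L'" "linear_map R L L' f" "submodule U R L"
  shows "submodule (f ` U) R L'"
proof -
  interpret L: module R L by fact
  interpret L': module R L' by fact
  note U = L.submoduleE[OF assms(4)]
  show ?thesis
  proof (rule L'.submodule_if_closed)
    show "f ` U \<subseteq> carrier L'" using U(1) linear_mapD(1)[OF assms(3)] by auto
    show "f ` U \<noteq> {}" using U(2) by blast
  next
    fix a b assume "a \<in> f ` U" "b \<in> f ` U"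
    then obtain u v where u: "u \<in> U" "a = f u" "v \<in> U" "b = f v" by auto
    then have "u \<in> carrier L" "v \<in> carrier L" using U(1) by auto
    then have "a \<oplus>\<^bsub>L'\<^esub> b = f (u \<oplus>\<^bsub>L\<^esub> v)" using u linear_mapD(2)[OF assms(3)] by simp
    then show "a \<oplus>\<^bsub>L'\<^esub> b \<in> f ` U" using U(5) u by auto
  next
    fix r a assume r: "r \<in> carrier R" and "a \<in> f ` U"
    then obtain u where u: "u \<in> U" "a = f u" by auto
    then have "u \<in> carrier L" using U(1) by auto
    then have "r \<odot>\<^bsub>L'\<^esub> a = f (r \<odot>\<^bsub>L\<^esub> u)" using u r linear_mapD(3)[OF assms(3)] by simp
    then show "r \<odot>\<^bsub>L'\<^esub> a \<in> f ` U" using U(4) u r by auto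
  qed
qed

lemma stationary_mono:
  fixes U :: "nat \<Rightarrow> 'x set"
  assumes "\<And>k. U k \<subseteq> U (Suc k)"
  shows "n \<le> k \<Longrightarrow> U n \<subseteq> U k"
  using assms by (rule lift_Suc_mono_le)

text \<open>A chain in the middle term of an exact sequence is determined, from some index on, by its
  preimage in the left term and its image in the right term.\<close>

lemma noetherian_module_exact:
  assumes L: "module R L"
    and N: "noetherian_module R L1" "noetherian_module R L2"
    and f: "linear_map R L1 L f" and g: "linear_map R L L2 g"
    and ex: "\<And>x. \<lbrakk>x \<in> carrier L; g x = \<zero>\<^bsub>L2\<^esub>\<rbrakk> \<Longrightarrow> x \<in> f ` carrier L1"
  shows "noetherian_module R L"
proof -
  interpret L: module R L by fact
  interpret L1: noetherian_module R L1 by fact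
  interpret L2: noetherian_module R L2 by fact
  note m = L1.module_axioms L2.module_axioms
  show ?thesis
  proof unfold_locales
    fix U :: "nat \<Rightarrow> _ set" assume U: "\<And>k. submodule (U k) R L" "\<And>k. U k \<subseteq> U (Suc k)"
    note UE = L.submoduleE[OF U(1)]
    obtain n1 where n1: "\<And>k. k \<ge> n1 \<Longrightarrow> {x \<in> carrier L1. f x \<in> U k} = {x \<in> carrier L1. f x \<in> U n1}"
      by (atomize_elim, rule L1.chain_stationary[OF linear_map_vimage_submodule[OF m(1) L f U(1)]]) (use U in auto)
    obtain n2 where n2: "\<And>k. k \<ge> n2 \<Longrightarrow> g ` U k = g ` U n2"
      by (atomize_elim, rule L2.chain_stationary[OF linear_map_image_submodule[OF L m(2) g U(1)]]) (use U in auto)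
    define n where "n = max n1 n2"
    have "U k \<subseteq> U n" if "k \<ge> n" for k
    proof
      fix x assume x: "x \<in> U k"
      have "g ` U k = g ` U n" using n2[of k] n2[of n] that by (simp add: n_def)
      then obtain y where y: "y \<in> U n" "g x = g y" using x by blast
      have yk: "y \<in> U k" using y(1) stationary_mono[of U, OF U(2) that] by auto
      have c: "x \<in> carrier L" "y \<in> carrier L" using UE(1)[of k] x yk by auto
      have d: "x \<ominus>\<^bsub>L\<^esub> y \<in> U k" using UE(3,5)[of _ k] x yk by (simp add: a_minus_def)
      have "g (x \<ominus>\<^bsub>L\<^esub> y) = \<zero>\<^bsub>L2\<^esub>"
        using c y(2) linear_mapD(1,2)[OF g] linear_map_minus[OF L m(2) g]
        by (simp add: a_minus_def L2.M.r_neg)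
      then obtain v where v: "v \<in> carrier L1" "x \<ominus>\<^bsub>L\<^esub> y = f v" using ex c by blast
      then have "v \<in> {x \<in> carrier L1. f x \<in> U n}"
        using n1[of k] n1[of n] that d by (auto simp: n_def)
      then have "x \<ominus>\<^bsub>L\<^esub> y \<in> U n" using v by auto
      then have "(x \<ominus>\<^bsub>L\<^esub> y) \<oplus>\<^bsub>L\<^esub> y \<in> U n" using y(1) UE(5) by blast
      then show "x \<in> U n" using c by (simp add: a_minus_def L.M.a_assoc L.M.l_neg)
    qed
    then show "\<exists>n. \<forall>k\<ge>n. U k = U n"
      using stationary_mono[of U, OF U(2)] by (intro exI[of _ n]) blast
  qed
qed

lemma (in noetherian_ring) ideal_chain_stationary:
  assumes "\<And>k :: nat. ideal (I k) R" "\<And>k. I k \<subseteq> I (Suc k)"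
  shows "\<exists>n. \<forall>k\<ge>n. I k = I n"
proof -
  note mono = stationary_mono[of I, OF assms(2)]
  have "subset.chain {I. ideal I R} (range I)"
    unfolding subset.chain_def using assms(1) mono nat_le_linear by blast
  then have "\<Union>(range I) \<in> range I" using ideal_chain_is_trivial by blast
  then obtain n where "\<Union>(range I) = I n" by auto
  then show ?thesis using mono by (intro exI[of _ n]) blast
qed

lemma (in noetherian_ring) maximal_ideal_in_family:
  assumes "F \<noteq> {}" "\<And>I. I \<in> F \<Longrightarrow> ideal I R"
  obtains I where "I \<in> F" "\<And>J. \<lbrakk>J \<in> F; I \<subseteq> J\<rbrakk> \<Longrightarrow> J = I"
proof -
  have "\<Union>C \<in> F" if C: "C \<noteq> {}" "subset.chain F C" for C
  proof -
    have "subset.chain {I. ideal I R} C" using C assms(2) by (auto simp: subset.chain_def)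
    then have "\<Union>C \<in> C" using C(1) ideal_chain_is_trivial by blast
    then show ?thesis using C by (auto simp: subset.chain_def)
  qed
  then have "\<exists>I\<in>F. \<forall>J\<in>F. I \<subseteq> J \<longrightarrow> J = I" by (rule subset_Zorn_nonempty[OF assms(1)])
  then show ?thesis using that by blast
qed

text \<open>A chain of submodules of \<open>N + R s\<close> is determined by its intersections with \<open>N\<close> and by the ideals of
  those coefficients of \<open>s\<close> that occur in its elements.\<close>

lemma (in module) span_insert_stationary:
  fixes U :: "nat \<Rightarrow> 'c set"
  assumes R: "noetherian_ring R"
    and N: "submodule N R M" and s: "s \<in> carrier M"
    and st: "\<And>U :: nat \<Rightarrow> _ set. \<lbrakk>\<And>k. submodule (U k) R M; \<And>k. U k \<subseteq> U (Suc k); \<And>k. U k \<subseteq> N\<rbrakk>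
      \<Longrightarrow> \<exists>n. \<forall>k\<ge>n. U k = U n"
    and U: "\<And>k. submodule (U k) R M" "\<And>k. U k \<subseteq> U (Suc k)"
      "\<And>k. U k \<subseteq> {v \<oplus>\<^bsub>M\<^esub> r \<odot>\<^bsub>M\<^esub> s | v r. v \<in> N \<and> r \<in> carrier R}"
  shows "\<exists>n. \<forall>k\<ge>n. U k = U n"
proof -
  note UE = submoduleE[OF U(1)] and NE = submoduleE[OF N]
  note zero = submodule_zero
  have 1: "submodule (U k \<inter> N) R M" for k
    by (rule submoduleI) (use UE(1,3,4,5) NE zero[OF U(1)[of k]] zero[OF N] in auto)
  define I where "I k = {r \<in> carrier R. \<exists>v\<in>N. v \<oplus>\<^bsub>M\<^esub> r \<odot>\<^bsub>M\<^esub> s \<in> U k}" for k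
  have cl: "v \<in> carrier M" if "v \<in> N" for v using NE(1) that by auto
  have 2: "ideal (I k) R" for k
  proof (rule R.ideal_if_closed)
    show "I k \<subseteq> carrier R" by (auto simp: I_def)
    have "\<zero> \<in> I k"
      unfolding I_def using zero[OF N] zero[OF U(1)[of k]] s by (auto intro!: bexI[of _ "\<zero>\<^bsub>M\<^esub>"])
    then show "I k \<noteq> {}" by auto
  next
    fix a b assume "a \<in> I k" "b \<in> I k"
    then obtain v w where v: "a \<in> carrier R" "v \<in> N" "v \<oplus>\<^bsub>M\<^esub> a \<odot>\<^bsub>M\<^esub> s \<in> U k"
      "b \<in> carrier R" "w \<in> N" "w \<oplus>\<^bsub>M\<^esub> b \<odot>\<^bsub>M\<^esub> s \<in> U k" by (auto simp: I_def)
    have "(v \<oplus>\<^bsub>M\<^esub> a \<odot>\<^bsub>M\<^esub> s) \<oplus>\<^bsub>M\<^esub> (w \<oplus>\<^bsub>M\<^esub> b \<odot>\<^bsub>M\<^esub> s) = (v \<oplus>\<^bsub>M\<^esub> w) \<oplus>\<^bsub>M\<^esub> (a \<oplus> b) \<odot>\<^bsub>M\<^esub> s"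
      using v s cl by (simp add: smult_l_distr M.a_ac)
    then show "a \<oplus> b \<in> I k"
      using v UE(5)[OF v(3,6)] NE(5)[OF v(2,5)] by (auto simp: I_def)
  next
    fix r a assume r: "r \<in> carrier R" and "a \<in> I k"
    then obtain v where v: "a \<in> carrier R" "v \<in> N" "v \<oplus>\<^bsub>M\<^esub> a \<odot>\<^bsub>M\<^esub> s \<in> U k" by (auto simp: I_def)
    have "r \<odot>\<^bsub>M\<^esub> (v \<oplus>\<^bsub>M\<^esub> a \<odot>\<^bsub>M\<^esub> s) = r \<odot>\<^bsub>M\<^esub> v \<oplus>\<^bsub>M\<^esub> (r \<otimes> a) \<odot>\<^bsub>M\<^esub> s"
      using v s r cl by (simp add: smult_r_distr smult_assoc1)
    then show "r \<otimes> a \<in> I k"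
      using v r UE(4)[OF r v(3)] NE(4)[OF r v(2)] by (auto simp: I_def)
  qed
  obtain n1 where n1: "\<And>k. k \<ge> n1 \<Longrightarrow> I k = I n1"
    using noetherian_ring.ideal_chain_stationary[OF R, of I] 2 U(2) by (fastforce simp: I_def)
  obtain n2 where n2: "\<And>k. k \<ge> n2 \<Longrightarrow> U k \<inter> N = U n2 \<inter> N"
    using st[of "\<lambda>k. U k \<inter> N"] 1 U(2) by blast
  define n where "n = max n1 n2"
  have "U k \<subseteq> U n" if "k \<ge> n" for k
  proof
    fix x assume x: "x \<in> U k"
    then obtain v r where v: "v \<in> N" "r \<in> carrier R" "x = v \<oplus>\<^bsub>M\<^esub> r \<odot>\<^bsub>M\<^esub> s" using U(3) by blast
    then have "r \<in> I k" using x by (auto simp: I_def)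
    then have "r \<in> I n" using n1[of k] n1[of n] that by (auto simp: n_def)
    then obtain w where w: "w \<in> N" "w \<oplus>\<^bsub>M\<^esub> r \<odot>\<^bsub>M\<^esub> s \<in> U n" by (auto simp: I_def)
    let ?y = "w \<oplus>\<^bsub>M\<^esub> r \<odot>\<^bsub>M\<^esub> s"
    have yk: "?y \<in> U k" using w(2) stationary_mono[of U, OF U(2) that] by auto
    have eq: "x \<oplus>\<^bsub>M\<^esub> \<ominus>\<^bsub>M\<^esub> ?y = v \<oplus>\<^bsub>M\<^esub> \<ominus>\<^bsub>M\<^esub> w"
    proof -
      have c: "r \<odot>\<^bsub>M\<^esub> s \<in> carrier M" using v s by auto
      have "x \<oplus>\<^bsub>M\<^esub> \<ominus>\<^bsub>M\<^esub> ?y = (v \<oplus>\<^bsub>M\<^esub> \<ominus>\<^bsub>M\<^esub> w) \<oplus>\<^bsub>M\<^esub> (r \<odot>\<^bsub>M\<^esub> s \<oplus>\<^bsub>M\<^esub> \<ominus>\<^bsub>M\<^esub> (r \<odot>\<^bsub>M\<^esub> s))"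
        unfolding v(3) using v(1) w(1) cl c by (simp add: M.minus_add M.a_ac)
      then show ?thesis using v(1) w(1) cl c by (simp add: M.r_neg)
    qed
    have "x \<oplus>\<^bsub>M\<^esub> \<ominus>\<^bsub>M\<^esub> ?y \<in> U k \<inter> N"
      using UE(5)[OF x UE(3)[OF yk]] NE(5)[OF v(1) NE(3)[OF w(1)]] eq by auto
    then have "x \<oplus>\<^bsub>M\<^esub> \<ominus>\<^bsub>M\<^esub> ?y \<in> U n" using n2[of k] n2[of n] that by (auto simp: n_def)
    then have "(x \<oplus>\<^bsub>M\<^esub> \<ominus>\<^bsub>M\<^esub> ?y) \<oplus>\<^bsub>M\<^esub> ?y \<in> U n" using w(2) UE(5) by blast
    moreover have "x \<in> carrier M" "?y \<in> carrier M" using UE(1) x w(2) by blast+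
    ultimately show "x \<in> U n" by (simp add: M.a_assoc M.l_neg)
  qed
  then show ?thesis using stationary_mono[of U, OF U(2)] by (intro exI[of _ n]) blast
qed

lemma (in module) finsum_in_submodule:
  assumes "submodule N R M" "finite S" "S \<subseteq> N" "c \<in> S \<rightarrow> carrier R"
  shows "(\<Oplus>\<^bsub>M\<^esub>s\<in>S. c s \<odot>\<^bsub>M\<^esub> s) \<in> N"
  using assms(2-4)
proof (induction S rule: finite_induct)
  case empty
  then show ?case
    using submodule_zero[OF assms(1)] by simp
next
  case (insert x F)
  have cl: "f \<in> carrier M" if "f \<in> N" for f using that submoduleE(1)[OF assms(1)] by auto
  have "(\<Oplus>\<^bsub>M\<^esub>s\<in>insert x F. c s \<odot>\<^bsub>M\<^esub> s) = c x \<odot>\<^bsub>M\<^esub> x \<oplus>\<^bsub>M\<^esub> (\<Oplus>\<^bsub>M\<^esub>s\<in>F. c s \<odot>\<^bsub>M\<^esub> s)"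
    using insert cl by (intro M.finsum_insert) (auto simp: Pi_def)
  moreover have "c x \<odot>\<^bsub>M\<^esub> x \<in> N" using insert submoduleE(4)[OF assms(1)] by auto
  ultimately show ?case using insert submoduleE(5)[OF assms(1)] by auto
qed

lemma (in module) fin_gen_imp_noetherian:
  assumes R: "noetherian_ring R" and fg: "fin_gen R M"
  shows "noetherian_module R M"
proof -
  obtain S where S: "finite S" "S \<subseteq> carrier M"
    and gen: "\<And>x. x \<in> carrier M \<Longrightarrow> \<exists>c \<in> S \<rightarrow> carrier R. x = (\<Oplus>\<^bsub>M\<^esub>s\<in>S. c s \<odot>\<^bsub>M\<^esub> s)"
    using fg by (auto simp: fin_gen_def)
  have "\<exists>N. submodule N R M \<and> S \<subseteq> N \<and> (\<forall>U :: nat \<Rightarrow> _ set. (\<forall>k. submodule (U k) R M) \<longrightarrow>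
      (\<forall>k. U k \<subseteq> U (Suc k)) \<longrightarrow> (\<forall>k. U k \<subseteq> N) \<longrightarrow> (\<exists>n. \<forall>k\<ge>n. U k = U n))"
    using S
  proof (induction S rule: finite_induct)
    case empty
    have "submodule {\<zero>\<^bsub>M\<^esub>} R M" by (rule submoduleI) auto
    moreover have "\<exists>n. \<forall>k\<ge>n. U k = U n" if "\<forall>k. submodule (U k) R M" "\<forall>k. U k \<subseteq> {\<zero>\<^bsub>M\<^esub>}" for U :: "nat \<Rightarrow> _ set"
      using that submoduleE(2) by (metis subset_singletonD)
    ultimately show ?case by blast
  next
    case (insert s F)
    then obtain N where N: "submodule N R M" "F \<subseteq> N" and st: "\<And>U :: nat \<Rightarrow> _ set. \<lbrakk>\<And>k. submodule (U k) R M;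
      \<And>k. U k \<subseteq> U (Suc k); \<And>k. U k \<subseteq> N\<rbrakk> \<Longrightarrow> \<exists>n. \<forall>k\<ge>n. U k = U n" by auto
    let ?N = "{v \<oplus>\<^bsub>M\<^esub> r \<odot>\<^bsub>M\<^esub> s | v r. v \<in> N \<and> r \<in> carrier R}"
    note NE = submoduleE[OF N(1)]
    have s: "s \<in> carrier M" using insert by auto
    have cl: "v \<in> carrier M" if "v \<in> N" for v using NE(1) that by auto
    note z = submodule_zero[OF N(1)]
    have "submodule ?N R M"
    proof (rule submodule_if_closed)
      show "?N \<subseteq> carrier M" using cl s by auto
      show "?N \<noteq> {}" using z R.zero_closed by blast
    next
      fix a b assume "a \<in> ?N" "b \<in> ?N"
      then obtain v r w t where v: "v \<in> N" "r \<in> carrier R" "a = v \<oplus>\<^bsub>M\<^esub> r \<odot>\<^bsub>M\<^esub> s"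
         "w \<in> N" "t \<in> carrier R" "b = w \<oplus>\<^bsub>M\<^esub> t \<odot>\<^bsub>M\<^esub> s" by auto
      then have "a \<oplus>\<^bsub>M\<^esub> b = (v \<oplus>\<^bsub>M\<^esub> w) \<oplus>\<^bsub>M\<^esub> (r \<oplus> t) \<odot>\<^bsub>M\<^esub> s" using s cl by (simp add: smult_l_distr M.a_ac)
      then show "a \<oplus>\<^bsub>M\<^esub> b \<in> ?N" using v NE(5) by blast
    next
      fix t a assume t: "t \<in> carrier R" and "a \<in> ?N"
      then obtain v r where v: "v \<in> N" "r \<in> carrier R" "a = v \<oplus>\<^bsub>M\<^esub> r \<odot>\<^bsub>M\<^esub> s" by auto
      then have "t \<odot>\<^bsub>M\<^esub> a = t \<odot>\<^bsub>M\<^esub> v \<oplus>\<^bsub>M\<^esub> (t \<otimes> r) \<odot>\<^bsub>M\<^esub> s" using s cl t by (simp add: smult_r_distr smult_assoc1)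
      then show "t \<odot>\<^bsub>M\<^esub> a \<in> ?N" using v t NE(4) by blast
    qed
    moreover have "s \<in> ?N"
    proof -
      have "s = \<zero>\<^bsub>M\<^esub> \<oplus>\<^bsub>M\<^esub> \<one> \<odot>\<^bsub>M\<^esub> s" using s by simp
      then show ?thesis using z R.one_closed by blast
    qed
    moreover have "v \<in> ?N" if "v \<in> N" for v
    proof -
      have "v = v \<oplus>\<^bsub>M\<^esub> \<zero> \<odot>\<^bsub>M\<^esub> s" using that s cl by simp
      then show ?thesis using that R.zero_closed by blast
    qed
    ultimately show ?case using N(2)
      by (intro exI[of _ ?N] conjI allI impI span_insert_stationary[OF R N(1) s st]) auto
  qed
  then obtain N where N: "submodule N R M" "S \<subseteq> N" and st: "\<And>U :: nat \<Rightarrow> _ set. \<lbrakk>\<And>k. submodule (U k) R M;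
      \<And>k. U k \<subseteq> U (Suc k); \<And>k. U k \<subseteq> N\<rbrakk> \<Longrightarrow> \<exists>n. \<forall>k\<ge>n. U k = U n" by auto
  have "carrier M \<subseteq> N" using gen finsum_in_submodule[OF N(1) S(1) N(2)] by blast
  then show ?thesis
    using st submoduleE(1) by unfold_locales blast
qed

lemma (in module) smult_left_commute:
  assumes "a \<in> carrier R" "b \<in> carrier R" "x \<in> carrier M"
  shows "a \<odot>\<^bsub>M\<^esub> (b \<odot>\<^bsub>M\<^esub> x) = b \<odot>\<^bsub>M\<^esub> (a \<odot>\<^bsub>M\<^esub> x)"
  using assms smult_assoc1[of a b x] smult_assoc1[of b a x] R.m_comm[of a b] by simp

definition ann :: "('a, 'z) ring_scheme \<Rightarrow> ('a, 'l, 'y) module_scheme \<Rightarrow> 'l \<Rightarrow> 'a set" where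
  "ann R L z = {r \<in> carrier R. r \<odot>\<^bsub>L\<^esub> z = \<zero>\<^bsub>L\<^esub>}"

definition assoc_primes :: "('a, 'z) ring_scheme \<Rightarrow> ('a, 'l, 'y) module_scheme \<Rightarrow> 'a set set" where
  "assoc_primes R L = {p. primeideal p R \<and> (\<exists>z \<in> carrier L. p = ann R L z)}"

context module
begin

lemma ann_ideal:
  assumes "z \<in> carrier M"
  shows "ideal (ann R M z) R"
proof (rule R.ideal_if_closed)
  have "\<zero> \<in> ann R M z" using assms by (simp add: ann_def)
  then show "ann R M z \<noteq> {}" by blast
qed (use assms in \<open>auto simp: ann_def smult_l_distr smult_assoc1\<close>)

lemma ann_subset_ann_smult:
  "\<lbrakk>z \<in> carrier M; r \<in> carrier R\<rbrakk> \<Longrightarrow> ann R M z \<subseteq> ann R M (r \<odot>\<^bsub>M\<^esub> z)"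
  unfolding ann_def by (auto simp: smult_left_commute[of _ r])

text \<open>An annihilator that is maximal among the annihilators of nonzero elements is prime.\<close>

lemma assoc_prime_above_ann:
  assumes R: "noetherian_ring R" and y: "y \<in> carrier M" "y \<noteq> \<zero>\<^bsub>M\<^esub>"
  shows "\<exists>q \<in> assoc_primes R M. ann R M y \<subseteq> q"
proof -
  let ?F = "{ann R M z | z. z \<in> carrier M \<and> z \<noteq> \<zero>\<^bsub>M\<^esub> \<and> ann R M y \<subseteq> ann R M z}"
  obtain I where I: "I \<in> ?F" and Imax: "\<And>J. \<lbrakk>J \<in> ?F; I \<subseteq> J\<rbrakk> \<Longrightarrow> J = I"
  proof -
    have "ann R M y \<in> ?F" using y by auto
    then have "?F \<noteq> {}" by (metis empty_iff)
    moreover have "ideal I R" if "I \<in> ?F" for I using that ann_ideal by auto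
    ultimately show ?thesis
      by (rule noetherian_ring.maximal_ideal_in_family[OF R]) (assumption, rule that)
  qed
  then obtain z where z: "z \<in> carrier M" "z \<noteq> \<zero>\<^bsub>M\<^esub>" "ann R M y \<subseteq> ann R M z" "I = ann R M z"
    by auto
  have max: "ann R M w = ann R M z"
    if "w \<in> carrier M" "w \<noteq> \<zero>\<^bsub>M\<^esub>" "ann R M y \<subseteq> ann R M w" "ann R M z \<subseteq> ann R M w" for w
    using Imax[of "ann R M w"] that z(4) by auto
  have "primeideal (ann R M z) R"
  proof (rule primeidealI[OF ann_ideal[OF z(1)] R.cring_axioms])
    have "\<one> \<notin> ann R M z" using z by (simp add: ann_def)
    then show "carrier R \<noteq> ann R M z" by (metis R.one_closed)
  next
    fix a b assume ab: "a \<in> carrier R" "b \<in> carrier R" "a \<otimes> b \<in> ann R M z"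
    show "a \<in> ann R M z \<or> b \<in> ann R M z"
    proof (cases "b \<odot>\<^bsub>M\<^esub> z = \<zero>\<^bsub>M\<^esub>")
      case False
      then have "ann R M (b \<odot>\<^bsub>M\<^esub> z) = ann R M z"
        using max[of "b \<odot>\<^bsub>M\<^esub> z"] ann_subset_ann_smult[OF z(1) ab(2)] ab z by auto
      moreover have "a \<in> ann R M (b \<odot>\<^bsub>M\<^esub> z)" using ab z by (auto simp: ann_def smult_assoc1)
      ultimately show ?thesis by simp
    qed (use ab in \<open>auto simp: ann_def\<close>)
  qed
  then show ?thesis using z by (auto simp: assoc_primes_def)
qed

end

lemma (in cring) local_one_minus_unit:
  assumes N: "noetherian_ring R" and m: "maximalideal m R" and loc: "\<And>J. maximalideal J R \<Longrightarrow> J = m"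
    and x: "x \<in> m"
  shows "\<exists>u \<in> carrier R. u \<otimes> (\<one> \<ominus> x) = \<one>"
proof (rule ccontr)
  interpret m: maximalideal m R by fact
  assume no: "\<not> ?thesis"
  have xc: "x \<in> carrier R" using x m.a_subset by auto
  let ?F = "{I. ideal I R \<and> I \<noteq> carrier R \<and> \<one> \<ominus> x \<in> I}"
  have "PIdl (\<one> \<ominus> x) \<in> ?F"
  proof -
    have "\<one> \<notin> PIdl (\<one> \<ominus> x)" using no by (auto simp: cgenideal_def)
    then show ?thesis using cgenideal_ideal cgenideal_self xc by auto
  qed
  then have "?F \<noteq> {}" by blast
  then obtain I where I: "I \<in> ?F" and max: "\<And>J. \<lbrakk>J \<in> ?F; I \<subseteq> J\<rbrakk> \<Longrightarrow> J = I"
    by (rule noetherian_ring.maximal_ideal_in_family[OF N]) blast+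
  have "maximalideal I R"
  proof (rule maximalidealI)
    show "ideal I R" "carrier R \<noteq> I" using I by auto
    fix J assume "ideal J R" "I \<subseteq> J" "J \<subseteq> carrier R"
    then show "J = I \<or> J = carrier R" using max[of J] I by auto
  qed
  then have "\<one> \<ominus> x \<in> m" using loc I by auto
  then have "(\<one> \<ominus> x) \<oplus> x \<in> m" using x by simp
  then have "\<one> \<in> m" using xc by (simp add: minus_eq a_assoc l_neg)
  then show False using m.one_imp_carrier m.I_notcarr by auto
qed

text \<open>Here \<open>L'\<close> contains \<open>L/xL\<close>, with \<open>x\<close> regular on \<open>L\<close>.
  If every element killed by \<open>p\<close> were divisible by \<open>x\<close>, the quotients of such an
  element by the powers of \<open>x\<close> would again be killed by \<open>p\<close>, and the ascending chain of the submodules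
  that they generate could only stop at zero, since \<open>1 - r x\<close> is a unit for all \<open>r\<close>. So some element killed
  by \<open>p\<close> survives modulo \<open>x\<close>, where it is killed by \<open>p\<close> and by \<open>x\<close>; and \<open>x\<close> is not in \<open>p\<close>.\<close>

lemma assoc_prime_mod_regular:
  fixes R (structure)
  assumes R: "noetherian_ring R" "maximalideal m R" "\<And>J. maximalideal J R \<Longrightarrow> J = m"
    and L: "noetherian_module R L" and L': "module R L'"
    and x: "x \<in> m" "inj_on (smult L x) (carrier L)"
    and f: "linear_map R L L' f"
    and ker: "\<And>v. v \<in> carrier L \<Longrightarrow> f v = \<zero>\<^bsub>L'\<^esub> \<longleftrightarrow> v \<in> smult L x ` carrier L"
    and p: "p \<in> assoc_primes R L"
  shows "\<exists>q \<in> assoc_primes R L'. p \<subset> q"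
proof -
  interpret L: noetherian_module R L by fact
  interpret L': module R L' by fact
  interpret m: maximalideal m R by fact
  have xc: "x \<in> carrier R" using x(1) m.a_subset by auto
  obtain z where z: "z \<in> carrier L" "p = ann R L z" and pp: "primeideal p R"
    using p by (auto simp: assoc_primes_def)
  have z0: "z \<noteq> \<zero>\<^bsub>L\<^esub>"
  proof
    assume "z = \<zero>\<^bsub>L\<^esub>"
    then have "p = carrier R" using z by (auto simp: ann_def)
    then show False using primeideal.I_notcarr[OF pp] by simp
  qed
  have inj: "w = \<zero>\<^bsub>L\<^esub>" if "w \<in> carrier L" "x \<odot>\<^bsub>L\<^esub> w = \<zero>\<^bsub>L\<^esub>" for w
    using inj_onD[OF x(2), of w "\<zero>\<^bsub>L\<^esub>"] that xc by simp
  have "\<exists>y \<in> carrier L. p \<subseteq> ann R L y \<and> y \<notin> smult L x ` carrier L"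
  proof (rule ccontr)
    assume "\<not> ?thesis"
    then have div: "y \<in> smult L x ` carrier L" if "y \<in> carrier L" "p \<subseteq> ann R L y" for y
      using that by blast
    let ?K = "{y \<in> carrier L. p \<subseteq> ann R L y}"
    have "\<exists>y'. y' \<in> ?K \<and> x \<odot>\<^bsub>L\<^esub> y' = y" if y: "y \<in> ?K" for y
    proof -
      obtain y' where y': "y' \<in> carrier L" "x \<odot>\<^bsub>L\<^esub> y' = y" using div y by blast
      have "r \<odot>\<^bsub>L\<^esub> y' = \<zero>\<^bsub>L\<^esub>" if "r \<in> p" for r
      proof (rule inj)
        have r: "r \<in> carrier R" "r \<odot>\<^bsub>L\<^esub> y = \<zero>\<^bsub>L\<^esub>" using that y by (auto simp: ann_def)
        then show "r \<odot>\<^bsub>L\<^esub> y' \<in> carrier L" using y' by simp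
        have "x \<odot>\<^bsub>L\<^esub> (r \<odot>\<^bsub>L\<^esub> y') = r \<odot>\<^bsub>L\<^esub> (x \<odot>\<^bsub>L\<^esub> y')"
          using r y' xc by (intro L.smult_left_commute) auto
        then show "x \<odot>\<^bsub>L\<^esub> (r \<odot>\<^bsub>L\<^esub> y') = \<zero>\<^bsub>L\<^esub>" using r y' by simp
      qed
      then show ?thesis using y' z(2) by (auto simp: ann_def)
    qed
    then have "\<forall>y\<in>?K. \<exists>y'. y' \<in> ?K \<and> x \<odot>\<^bsub>L\<^esub> y' = y" by (intro ballI)
    from bchoice[OF this] obtain g where g: "\<And>y. y \<in> ?K \<Longrightarrow> g y \<in> ?K \<and> x \<odot>\<^bsub>L\<^esub> g y = y" by (elim exE) (rule that, rule bspec)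
    \<comment> \<open>\<open>Y k\<close> is the quotient of \<open>z\<close> by the \<open>k\<close>-th power of \<open>x\<close>.\<close>
    define Y where "Y k = (g ^^ k) z" for k
    have Y: "Y k \<in> ?K" for k
      by (induction k) (use z g in \<open>auto simp: Y_def\<close>)
    have Yc: "Y k \<in> carrier L" for k using Y[of k] by auto
    have step: "x \<odot>\<^bsub>L\<^esub> Y (Suc k) = Y k" for k using g[OF Y[of k]] by (simp add: Y_def)
    let ?U = "\<lambda>k. (\<lambda>r. r \<odot>\<^bsub>L\<^esub> Y k) ` carrier R"
    have "submodule (?U k) R L" for k
    proof (rule L.submodule_if_closed)
      show "?U k \<subseteq> carrier L" using Yc by auto
      show "?U k \<noteq> {}" by blast
    next
      fix a b assume "a \<in> ?U k" "b \<in> ?U k"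
      then obtain r t where "r \<in> carrier R" "a = r \<odot>\<^bsub>L\<^esub> Y k" "t \<in> carrier R" "b = t \<odot>\<^bsub>L\<^esub> Y k" by auto
      then show "a \<oplus>\<^bsub>L\<^esub> b \<in> ?U k" using Yc by (intro image_eqI[of _ _ "r \<oplus> t"]) (auto simp: L.smult_l_distr)
    next
      fix t a assume "t \<in> carrier R" "a \<in> ?U k"
      then obtain r where "r \<in> carrier R" "a = r \<odot>\<^bsub>L\<^esub> Y k" by auto
      then show "t \<odot>\<^bsub>L\<^esub> a \<in> ?U k" using Yc \<open>t \<in> carrier R\<close>
        by (intro image_eqI[of _ _ "t \<otimes> r"]) (auto simp: L.smult_assoc1)
    qed
    moreover have "?U k \<subseteq> ?U (Suc k)" for k
    proof
      fix a assume "a \<in> ?U k"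
      then obtain r where r: "r \<in> carrier R" "a = r \<odot>\<^bsub>L\<^esub> Y k" by auto
      then show "a \<in> ?U (Suc k)"
        using Yc step[of k] xc by (intro image_eqI[of _ _ "r \<otimes> x"]) (auto simp: L.smult_assoc1)
    qed
    ultimately have "\<exists>n. \<forall>k\<ge>n. ?U k = ?U n" by (rule L.chain_stationary)
    then obtain n where "\<forall>k\<ge>n. ?U k = ?U n" by (rule exE)
    then have "?U (Suc n) = ?U n" by (rule allE[of _ "Suc n"]) simp
    moreover have "Y (Suc n) \<in> ?U (Suc n)" using Yc by (intro image_eqI[of _ _ "\<one>"]) auto
    ultimately obtain r where r: "r \<in> carrier R" "Y (Suc n) = r \<odot>\<^bsub>L\<^esub> Y n" by auto
    then have eq: "Y (Suc n) = (r \<otimes> x) \<odot>\<^bsub>L\<^esub> Y (Suc n)"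
      using step[of n] xc Yc by (simp add: L.smult_assoc1)
    have rx: "r \<otimes> x \<in> m" "r \<otimes> x \<in> carrier R" using m.I_l_closed[OF x(1) r(1)] r xc by auto
    have "(\<one> \<ominus> r \<otimes> x) \<odot>\<^bsub>L\<^esub> Y (Suc n) = Y (Suc n) \<oplus>\<^bsub>L\<^esub> \<ominus>\<^bsub>L\<^esub> ((r \<otimes> x) \<odot>\<^bsub>L\<^esub> Y (Suc n))"
      using rx Yc by (simp add: a_minus_def L.smult_l_distr L.smult_l_minus)
    also have "\<dots> = \<zero>\<^bsub>L\<^esub>" using eq Yc[of "Suc n"] by (simp add: L.M.r_neg)
    finally have k0: "(\<one> \<ominus> r \<otimes> x) \<odot>\<^bsub>L\<^esub> Y (Suc n) = \<zero>\<^bsub>L\<^esub>" .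
    obtain u where u: "u \<in> carrier R" "u \<otimes> (\<one> \<ominus> r \<otimes> x) = \<one>"
      using L.R.local_one_minus_unit[OF R rx(1)] by blast
    have "Y (Suc n) = (u \<otimes> (\<one> \<ominus> r \<otimes> x)) \<odot>\<^bsub>L\<^esub> Y (Suc n)" using u Yc by simp
    also have "\<dots> = u \<odot>\<^bsub>L\<^esub> ((\<one> \<ominus> r \<otimes> x) \<odot>\<^bsub>L\<^esub> Y (Suc n))"
      using u Yc rx by (intro L.smult_assoc1) auto
    finally have Y0: "Y (Suc n) = \<zero>\<^bsub>L\<^esub>" using k0 u by simp
    have "Y k = \<zero>\<^bsub>L\<^esub> \<Longrightarrow> z = \<zero>\<^bsub>L\<^esub>" for k
    proof (induction k)
      case (Suc k)
      then show ?case using step[of k] xc by simp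
    qed (simp add: Y_def)
    then show False using z0 Y0 by blast
  qed
  then obtain y where y: "y \<in> carrier L" "p \<subseteq> ann R L y" "y \<notin> smult L x ` carrier L" by blast
  have fy: "f y \<in> carrier L'" "f y \<noteq> \<zero>\<^bsub>L'\<^esub>" using linear_mapD(1)[OF f] ker y by auto
  obtain q where q: "q \<in> assoc_primes R L'" "ann R L' (f y) \<subseteq> q"
    using L'.assoc_prime_above_ann[OF R(1) fy] by blast
  have "r \<in> ann R L' (f y)" if "r \<in> p" for r
    using y(1,2) that linear_mapD(3)[OF f, of r y] linear_map_zero[OF L.module_axioms L' f]
    by (auto simp: ann_def)
  moreover have "x \<in> ann R L' (f y)"
    using linear_mapD(3)[OF f, of x y] ker[of "x \<odot>\<^bsub>L\<^esub> y"] y xc by (auto simp: ann_def)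
  moreover have "x \<notin> p" using inj[OF z(1)] z z0 by (auto simp: ann_def)
  ultimately show ?thesis using q by blast
qed

lemma (in cring) primeideal_image_quotient:
  assumes I: "ideal I R" and q: "primeideal q R" and Iq: "I \<subseteq> q"
  shows "primeideal ((+>) I ` q) (R Quot I)"
    and "a \<in> carrier R \<Longrightarrow> I +> a \<in> (+>) I ` q \<longleftrightarrow> a \<in> q"
proof -
  interpret I: ideal I R by fact
  interpret q: primeideal q R by fact
  show mem: "I +> a \<in> (+>) I ` q \<longleftrightarrow> a \<in> q" if a: "a \<in> carrier R" for a
  proof
    assume "I +> a \<in> (+>) I ` q"
    then obtain b where b: "b \<in> q" "I +> a = I +> b" by auto
    then have bc: "b \<in> carrier R" using q.a_subset by auto
    then have "a \<ominus> b \<in> I" using quotient_eq_iff_same_a_r_cos[OF I a] b by auto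
    then have "(a \<ominus> b) \<oplus> b \<in> q" using Iq b by auto
    then show "a \<in> q" using a bc by (simp add: minus_eq a_assoc l_neg)
  qed auto
  have carr: "carrier (R Quot I) = (+>) I ` carrier R"
    by (auto simp: FactRing_def A_RCOSETS_def')
  show "primeideal ((+>) I ` q) (R Quot I)"
  proof (rule primeidealI)
    show "ideal ((+>) I ` q) (R Quot I)" by (rule ring_ideal_imp_quot_ideal[OF I q.is_ideal])
    show "cring (R Quot I)" by (rule I.quotient_is_cring[OF is_cring])
    show "carrier (R Quot I) \<noteq> (+>) I ` q"
    proof
      assume "carrier (R Quot I) = (+>) I ` q"
      then have "\<one> \<in> q" using mem[of \<one>] carr by auto
      then show False using q.one_imp_carrier q.I_notcarr by auto
    qed
  next
    fix a b assume "a \<in> carrier (R Quot I)" "b \<in> carrier (R Quot I)" and m: "a \<otimes>\<^bsub>R Quot I\<^esub> b \<in> (+>) I ` q"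
    then obtain a' b' where a: "a' \<in> carrier R" "a = I +> a'" "b' \<in> carrier R" "b = I +> b'"
      using carr by auto
    then have "a \<otimes>\<^bsub>R Quot I\<^esub> b = I +> (a' \<otimes> b')" by (simp add: FactRing_def I.rcoset_mult_add)
    then have "a' \<otimes> b' \<in> q" using m mem[of "a' \<otimes> b'"] a by auto
    then show "a \<in> (+>) I ` q \<or> b \<in> (+>) I ` q" using q.I_prime a by auto
  qed
qed

lemma (in cring) prime_chain_krull_dim_quotient:
  assumes P: "\<And>i. i \<le> n \<Longrightarrow> primeideal (P i) R" "\<And>i. i < n \<Longrightarrow> P i \<subset> P (Suc i)"
  shows "enat n \<le> krull_dim (R Quot P 0)"
proof -
  have above: "P 0 \<subseteq> P i" if "i \<le> n" for i
    using that
  proof (induction i)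
    case (Suc i)
    then show ?case using P(2)[of i] by auto
  qed simp
  have I: "ideal (P 0) R" using P(1)[of 0] by (auto dest: primeideal.axioms)
  let ?Q = "\<lambda>i. (+>) (P 0) ` P i"
  have "\<forall>i\<le>n. primeideal (?Q i) (R Quot P 0)"
    using primeideal_image_quotient(1)[OF I P(1) above] by blast
  moreover have "\<forall>i<n. ?Q i \<subset> ?Q (Suc i)"
  proof (intro allI impI)
    fix i assume i: "i < n"
    then obtain a where a: "a \<in> P (Suc i)" "a \<notin> P i" using P(2) by blast
    interpret S: primeideal "P (Suc i)" R using P(1) i by auto
    have "a \<in> carrier R" using a S.a_subset by auto
    then have "P 0 +> a \<notin> ?Q i" using primeideal_image_quotient(2)[OF I P(1)[of i] above[of i]] i a by auto
    then show "?Q i \<subset> ?Q (Suc i)" using P(2)[OF i] a by blast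
  qed
  ultimately show ?thesis
    unfolding krull_dim_def by (intro SUP_upper CollectI exI[of _ ?Q] conjI)
qed


section \<open>Graded complexes without a direct sum decomposition\<close>

text \<open>What the cohomology and the Hom complexes see of a DG-module: its homogeneous elements and the
  differential between them. Cones and modules of fractions inherit this structure directly.\<close>

locale pre_complex = abelian_group M for M :: "('m, 'z) dg_scheme" (structure) +
  assumes gr_additive_subgroup: "additive_subgroup (gr M n) M"
    and dif_closed: "x \<in> carrier M \<Longrightarrow> dif M x \<in> carrier M"
    and dif_distrib: "\<lbrakk>x \<in> carrier M; y \<in> carrier M\<rbrakk> \<Longrightarrow> dif M (x \<oplus> y) = dif M x \<oplus> dif M y"
    and dif_degree: "x \<in> gr M n \<Longrightarrow> dif M x \<in> gr M (n + 1)"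
    and dif_square: "x \<in> carrier M \<Longrightarrow> dif M (dif M x) = \<zero>"
begin

lemma gr_carrier: "x \<in> gr M n \<Longrightarrow> x \<in> carrier M"
  using additive_subgroup.a_subset[OF gr_additive_subgroup] by blast

lemma gr_zero [simp]: "\<zero> \<in> gr M n"
  by (rule additive_subgroup.zero_closed[OF gr_additive_subgroup])

lemma gr_add: "\<lbrakk>x \<in> gr M n; y \<in> gr M n\<rbrakk> \<Longrightarrow> x \<oplus> y \<in> gr M n"
  by (rule additive_subgroup.a_closed[OF gr_additive_subgroup])

lemma gr_minus: "x \<in> gr M n \<Longrightarrow> \<ominus> x \<in> gr M n"
  by (rule additive_subgroup.a_inv_closed[OF gr_additive_subgroup])

lemma gr_diff: "\<lbrakk>x \<in> gr M n; y \<in> gr M n\<rbrakk> \<Longrightarrow> x \<ominus> y \<in> gr M n"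
  by (simp add: minus_eq gr_add gr_minus)

lemma minus_zero_eq [simp]: "\<ominus> \<zero> = \<zero>"
  by (rule minus_equality) auto

lemma dif_zero [simp]: "dif M \<zero> = \<zero>"
  using dif_distrib[of \<zero> \<zero>] dif_closed[of \<zero>] add.r_cancel_one' by force

lemma dif_minus:
  assumes "x \<in> carrier M"
  shows "dif M (\<ominus> x) = \<ominus> dif M x"
proof -
  have "dif M (\<ominus> x) \<oplus> dif M x = \<zero>"
    using dif_distrib[of "\<ominus> x" x] assms by (simp add: l_neg)
  then show ?thesis using assms by (simp add: minus_equality dif_closed)
qed

lemma dif_diff: "\<lbrakk>x \<in> carrier M; y \<in> carrier M\<rbrakk> \<Longrightarrow> dif M (x \<ominus> y) = dif M x \<ominus> dif M y"
  by (simp add: minus_eq dif_distrib dif_minus)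

lemma signed_closed [simp]: "x \<in> carrier M \<Longrightarrow> signed M i x \<in> carrier M"
  by (simp add: signed_def)

lemma signed_zero [simp]: "signed M i \<zero> = \<zero>"
  by (simp add: signed_def)

lemma signed_gr: "x \<in> gr M n \<Longrightarrow> signed M i x \<in> gr M n"
  by (simp add: signed_def gr_minus)

lemma signed_add: "\<lbrakk>x \<in> carrier M; y \<in> carrier M\<rbrakk> \<Longrightarrow> signed M i (x \<oplus> y) = signed M i x \<oplus> signed M i y"
  by (simp add: signed_def minus_add)

lemma signed_signed: "x \<in> carrier M \<Longrightarrow> signed M i (signed M j x) = signed M (i + j) x"
  by (auto simp: signed_def)

lemma dif_signed: "x \<in> carrier M \<Longrightarrow> dif M (signed M i x) = signed M i (dif M x)"
  by (simp add: signed_def dif_minus)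

lemma cocycles_carrier: "x \<in> cocycles M n \<Longrightarrow> x \<in> carrier M"
  by (auto simp: cocycles_def gr_carrier)

lemma cobounds_subset_cocycles: "cobounds M n \<subseteq> cocycles M n"
  using dif_degree[of _ "n - 1"] dif_square gr_carrier by (auto simp: cobounds_def cocycles_def)

lemma cobounds_carrier: "x \<in> cobounds M n \<Longrightarrow> x \<in> carrier M"
  using cobounds_subset_cocycles cocycles_carrier by blast

lemma cocycles_zero [simp]: "\<zero> \<in> cocycles M n"
  by (simp add: cocycles_def)

lemma cocycles_add: "\<lbrakk>x \<in> cocycles M n; y \<in> cocycles M n\<rbrakk> \<Longrightarrow> x \<oplus> y \<in> cocycles M n"
  by (auto simp: cocycles_def gr_add dif_distrib gr_carrier)

lemma cocycles_minus: "x \<in> cocycles M n \<Longrightarrow> \<ominus> x \<in> cocycles M n"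
  by (auto simp: cocycles_def gr_minus dif_minus gr_carrier)

lemma cobounds_additive_subgroup: "additive_subgroup (cobounds M n) M"
proof (rule additive_subgroupI, rule add.subgroupI)
  show "cobounds M n \<subseteq> carrier M" using cobounds_carrier by blast
  show "cobounds M n \<noteq> {}" using gr_zero by (auto simp: cobounds_def simp del: gr_zero)
next
  fix a assume "a \<in> cobounds M n"
  then show "\<ominus> a \<in> cobounds M n"
    by (auto simp: cobounds_def gr_carrier dif_minus[symmetric] intro!: imageI gr_minus)
next
  fix a b assume "a \<in> cobounds M n" "b \<in> cobounds M n"
  then show "a \<oplus> b \<in> cobounds M n"
    by (auto simp: cobounds_def gr_carrier dif_distrib[symmetric] intro!: imageI gr_add)
qed

lemma cobounds_abelian_subgroup: "abelian_subgroup (cobounds M n) M"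
  by (rule abelian_subgroupI3[OF cobounds_additive_subgroup]) (rule abelian_group_axioms)

lemma cobounds_zero [simp]: "\<zero> \<in> cobounds M n"
  by (rule additive_subgroup.zero_closed[OF cobounds_additive_subgroup])

lemma cobounds_add: "\<lbrakk>x \<in> cobounds M n; y \<in> cobounds M n\<rbrakk> \<Longrightarrow> x \<oplus> y \<in> cobounds M n"
  by (rule additive_subgroup.a_closed[OF cobounds_additive_subgroup])

lemma cobounds_minus: "x \<in> cobounds M n \<Longrightarrow> \<ominus> x \<in> cobounds M n"
  by (rule additive_subgroup.a_inv_closed[OF cobounds_additive_subgroup])

lemma dif_in_cobounds: "x \<in> gr M n \<Longrightarrow> dif M x \<in> cobounds M (n + 1)"
  by (simp add: cobounds_def)

lemma mem_coh_class: "y \<in> coh_class M n x \<longleftrightarrow> (\<exists>b \<in> cobounds M n. y = b \<oplus> x)"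
  by (auto simp: coh_class_def a_r_coset_def')

lemma coh_class_self: "x \<in> carrier M \<Longrightarrow> x \<in> coh_class M n x"
  by (auto simp: mem_coh_class intro!: bexI[of _ \<zero>])

lemma coh_class_eqI:
  assumes "x \<in> carrier M" "y \<in> coh_class M n x"
  shows "coh_class M n y = coh_class M n x"
  unfolding coh_class_def
  using assms a_repr_independence[of y "cobounds M n" x]
    additive_subgroup.a_subgroup[OF cobounds_additive_subgroup]
  by (simp add: coh_class_def)

lemma coh_class_eq_iff:
  assumes x: "x \<in> carrier M" and y: "y \<in> carrier M"
  shows "coh_class M n x = coh_class M n y \<longleftrightarrow> x \<ominus> y \<in> cobounds M n"
proof
  assume "coh_class M n x = coh_class M n y"
  then have "x \<in> coh_class M n y" using coh_class_self[OF x, of n] by simp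
  then obtain b where "b \<in> cobounds M n" "x = b \<oplus> y" by (auto simp: mem_coh_class)
  then show "x \<ominus> y \<in> cobounds M n" using y cobounds_carrier by (simp add: minus_eq a_assoc r_neg)
next
  assume "x \<ominus> y \<in> cobounds M n"
  moreover have "x = (x \<ominus> y) \<oplus> y" using x y by (simp add: minus_eq a_assoc l_neg)
  ultimately have "x \<in> coh_class M n y" by (auto simp: mem_coh_class)
  then show "coh_class M n x = coh_class M n y" using y by (rule coh_class_eqI[rotated])
qed

lemma coh_class_zero: "coh_class M n \<zero> = cobounds M n"
  unfolding coh_class_def using cobounds_carrier by (intro a_coset_add_zero) blast

lemma coh_class_eq_zero_iff: "x \<in> carrier M \<Longrightarrow> coh_class M n x = cobounds M n \<longleftrightarrow> x \<in> cobounds M n"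
  using coh_class_eq_iff[of x \<zero> n] by (simp add: coh_class_zero minus_eq)

lemma coh_class_add:
  "\<lbrakk>x \<in> carrier M; y \<in> carrier M\<rbrakk> \<Longrightarrow> coh_class M n x <+> coh_class M n y = coh_class M n (x \<oplus> y)"
  unfolding coh_class_def by (rule abelian_subgroup.a_rcos_sum[OF cobounds_abelian_subgroup])

end

lemma (in dg_complex) dif_zero': "dif M \<zero> = \<zero>"
proof -
  have "dif M \<zero> \<in> gr M 1"
    using dif_gr[of \<zero> 0] additive_subgroup.zero_closed[OF gr_subgroup] by simp
  then have "dif M \<zero> \<in> carrier M" using additive_subgroup.a_subset[OF gr_subgroup] by blast
  then show ?thesis using dif_add[of \<zero> \<zero>] add.r_cancel_one' by force
qed

lemma (in dg_complex) dif_carrier: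
  assumes "x \<in> carrier M"
  shows "dif M x \<in> carrier M"
proof -
  obtain f where f: "is_decomp M x f" using direct_sum[OF assms] by blast
  have sub: "f n \<in> carrier M" "dif M (f n) \<in> carrier M" for n
    using f dif_gr[of "f n" n] additive_subgroup.a_subset[OF gr_subgroup] by (auto simp: is_decomp_def)
  have "dif M (\<Oplus>n\<in>T. f n) \<in> carrier M" if "finite T" for T
    using that
  proof (induction T rule: finite_induct)
    case (insert n T)
    have "(\<Oplus>n\<in>insert n T. f n) = f n \<oplus> (\<Oplus>n\<in>T. f n)"
      using insert sub by (intro finsum_insert) auto
    then show ?case using insert sub dif_add[of "f n" "\<Oplus>n\<in>T. f n"] by simp
  qed (simp add: dif_zero')
  then show ?thesis using f by (auto simp: is_decomp_def)
qed

sublocale dg_complex \<subseteq> pre_complex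
  by (intro pre_complex.intro abelian_group_axioms pre_complex_axioms.intro)
    (auto intro: gr_subgroup dif_carrier dif_add dif_gr dif_dif)


section \<open>Homogeneous components\<close>

context dg_complex
begin

lemma decompI:
  assumes "\<And>n. f n \<in> gr M n" "finite T" "\<And>n. n \<notin> T \<Longrightarrow> f n = \<zero>" "x = (\<Oplus>n\<in>T. f n)"
  shows "is_decomp M x f"
proof -
  have "finite {n. f n \<noteq> \<zero>}" using assms(2,3) by (metis (mono_tags) finite_subset mem_Collect_eq subsetI)
  moreover have "(\<Oplus>n\<in>T. f n) = (\<Oplus>n\<in>{n. f n \<noteq> \<zero>}. f n)"
    using assms gr_carrier[OF assms(1)] by (intro add.finprod_mono_neutral_cong_right) auto
  ultimately show ?thesis using assms by (simp add: is_decomp_def)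
qed

lemma hpart_decomp:
  assumes "x \<in> carrier M"
  shows "is_decomp M x (\<lambda>n. hpart M n x)"
  unfolding hpart_def using theI'[OF direct_sum[OF assms]] .

lemma decomp_carrier: "is_decomp M x f \<Longrightarrow> x \<in> carrier M"
  using gr_carrier by (fastforce simp: is_decomp_def intro!: finsum_closed)

lemma hpart_eq:
  assumes "is_decomp M x f"
  shows "hpart M n x = f n"
  unfolding hpart_def using the1_equality[of "is_decomp M x" f] direct_sum[OF decomp_carrier[OF assms]] assms by auto

lemma hpart_gr: "x \<in> carrier M \<Longrightarrow> hpart M n x \<in> gr M n"
  using hpart_decomp by (simp add: is_decomp_def)

lemma hpart_carrier: "x \<in> carrier M \<Longrightarrow> hpart M n x \<in> carrier M"
  using hpart_gr gr_carrier by blast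

lemma hpart_homog:
  assumes "x \<in> gr M m"
  shows "hpart M n x = (if n = m then x else \<zero>)"
proof -
  have "is_decomp M x (\<lambda>n. if n = m then x else \<zero>)"
    by (rule decompI[where T = "{m}"]) (use assms gr_carrier in auto)
  then show ?thesis using hpart_eq by blast
qed

lemma hpart_add:
  assumes x: "x \<in> carrier M" and y: "y \<in> carrier M"
  shows "hpart M n (x \<oplus> y) = hpart M n x \<oplus> hpart M n y"
proof -
  let ?X = "{n. hpart M n x \<noteq> \<zero>}" and ?Y = "{n. hpart M n y \<noteq> \<zero>}"
  have c: "hpart M n x \<in> carrier M" "hpart M n y \<in> carrier M" for n
    using hpart_gr x y gr_carrier by auto
  have f: "finite ?X" "finite ?Y" using hpart_decomp x y by (auto simp: is_decomp_def)
  have "x = (\<Oplus>n\<in>?X. hpart M n x)" "y = (\<Oplus>n\<in>?Y. hpart M n y)"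
    using hpart_decomp x y by (auto simp: is_decomp_def)
  moreover have "(\<Oplus>n\<in>?X. hpart M n x) = (\<Oplus>n\<in>?X \<union> ?Y. hpart M n x)"
    using f c by (intro add.finprod_mono_neutral_cong_left) auto
  moreover have "(\<Oplus>n\<in>?Y. hpart M n y) = (\<Oplus>n\<in>?X \<union> ?Y. hpart M n y)"
    using f c by (intro add.finprod_mono_neutral_cong_left) auto
  ultimately have "x \<oplus> y = (\<Oplus>n\<in>?X \<union> ?Y. hpart M n x \<oplus> hpart M n y)"
    using c by (simp add: finsum_addf Pi_def)
  then have "is_decomp M (x \<oplus> y) (\<lambda>n. hpart M n x \<oplus> hpart M n y)"
    using f c by (intro decompI[where T = "?X \<union> ?Y"]) (auto simp: gr_add hpart_gr x y)
  then show ?thesis using hpart_eq by blast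
qed

lemma hpart_ext:
  assumes "x \<in> carrier M" "y \<in> carrier M" "\<And>n. hpart M n x = hpart M n y"
  shows "x = y"
  using hpart_decomp[OF assms(1)] hpart_decomp[OF assms(2)] assms(3) by (auto simp: is_decomp_def)

lemma homogeneous_induct [consumes 1, case_names zero add homogeneous]:
  assumes x: "x \<in> carrier M"
    and zero: "P \<zero>"
    and add: "\<And>x y. \<lbrakk>x \<in> carrier M; y \<in> carrier M; P x; P y\<rbrakk> \<Longrightarrow> P (x \<oplus> y)"
    and homogeneous: "\<And>n x. x \<in> gr M n \<Longrightarrow> P x"
  shows "P x"
proof -
  have c: "hpart M n x \<in> carrier M" for n using hpart_gr x gr_carrier by auto
  have "P (\<Oplus>n\<in>T. hpart M n x)" if "finite T" for T
    using that
  proof (induction T rule: finite_induct)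
    case (insert n T)
    have "(\<Oplus>n\<in>insert n T. hpart M n x) = hpart M n x \<oplus> (\<Oplus>n\<in>T. hpart M n x)"
      using insert c by (intro finsum_insert) auto
    then show ?case using insert c add homogeneous[OF hpart_gr[OF x]] by simp
  qed (simp add: zero)
  then show ?thesis using hpart_decomp[OF x] unfolding is_decomp_def by (metis (no_types, lifting))
qed

text \<open>An element is determined by its components, and those of \<open>sign_aut M x\<close> are known; so identities
  for \<open>sign_aut\<close> can be checked on components.\<close>

lemma sign_aut_decomp:
  assumes "x \<in> carrier M"
  shows "is_decomp M (sign_aut M x) (\<lambda>n. signed M n (hpart M n x))"
  using hpart_decomp[OF assms]
  by (intro decompI[where T = "{n. hpart M n x \<noteq> \<zero>}"]) (auto simp: is_decomp_def sign_aut_def signed_gr)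

lemma sign_aut_closed: "x \<in> carrier M \<Longrightarrow> sign_aut M x \<in> carrier M"
  using sign_aut_decomp decomp_carrier by blast

lemma hpart_sign_aut: "x \<in> carrier M \<Longrightarrow> hpart M n (sign_aut M x) = signed M n (hpart M n x)"
  using sign_aut_decomp hpart_eq by blast

lemma sign_aut_add:
  assumes "x \<in> carrier M" "y \<in> carrier M"
  shows "sign_aut M (x \<oplus> y) = sign_aut M x \<oplus> sign_aut M y"
  by (rule hpart_ext)
    (use assms in \<open>simp_all add: sign_aut_closed hpart_sign_aut hpart_add signed_add hpart_carrier\<close>)

lemma sign_aut_homog: "x \<in> gr M n \<Longrightarrow> sign_aut M x = signed M n x"
  by (rule hpart_ext)
    (auto simp: sign_aut_closed hpart_sign_aut hpart_homog[of x n] hpart_homog[OF signed_gr] gr_carrier)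

lemma sign_aut_zero [simp]: "sign_aut M \<zero> = \<zero>"
  using sign_aut_homog[OF gr_zero[of 0]] by simp

end

lemma (in dg_ring) sign_aut_mult:
  assumes "a \<in> carrier A" "b \<in> carrier A"
  shows "sign_aut A (a \<otimes> b) = sign_aut A a \<otimes> sign_aut A b"
  using assms(1)
proof (induction a rule: homogeneous_induct)
  case zero
  show ?case using assms by (simp add: sign_aut_closed)
next
  case (add x y)
  then show ?case using assms by (simp add: l_distr sign_aut_add sign_aut_closed)
next
  case (homogeneous i x)
  show ?case using assms(2)
  proof (induction b rule: homogeneous_induct)
    case zero
    show ?case using homogeneous by (simp add: sign_aut_closed gr_carrier)
  next
    case (add y z)
    then show ?case using homogeneous by (simp add: r_distr sign_aut_add sign_aut_closed gr_carrier)
  next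
    case (homogeneous j y)
    then show ?case using \<open>x \<in> gr A i\<close> gr_carrier mult_gr
      by (auto simp: sign_aut_homog[of _ i] sign_aut_homog[of _ j] sign_aut_homog[of _ "i + j"] signed_def
          l_minus r_minus)
  qed
qed


section \<open>Cohomology as a module over the ring H0\<close>

locale pre_dg_mod = A?: dg_ring A + M?: pre_complex M
  for A :: "('a, 'z) dg_scheme" (structure) and M :: "('a, 'm, 'y) dg_module_scheme" (structure) +
  assumes act_degree: "\<lbrakk>a \<in> gr A i; x \<in> gr M j\<rbrakk> \<Longrightarrow> act M a x \<in> gr M (i + j)"
    and act_carrier: "\<lbrakk>a \<in> carrier A; x \<in> carrier M\<rbrakk> \<Longrightarrow> act M a x \<in> carrier M"
    and act_add_left: "\<lbrakk>a \<in> carrier A; b \<in> carrier A; x \<in> carrier M\<rbrakk> \<Longrightarrow>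
      act M (a \<oplus>\<^bsub>A\<^esub> b) x = act M a x \<oplus>\<^bsub>M\<^esub> act M b x"
    and act_add_right: "\<lbrakk>a \<in> carrier A; x \<in> carrier M; y \<in> carrier M\<rbrakk> \<Longrightarrow>
      act M a (x \<oplus>\<^bsub>M\<^esub> y) = act M a x \<oplus>\<^bsub>M\<^esub> act M a y"
    and act_mult: "\<lbrakk>a \<in> carrier A; b \<in> carrier A; x \<in> carrier M\<rbrakk> \<Longrightarrow>
      act M (a \<otimes>\<^bsub>A\<^esub> b) x = act M a (act M b x)"
    and act_unit: "x \<in> carrier M \<Longrightarrow> act M \<one>\<^bsub>A\<^esub> x = x"
    and dif_act: "\<lbrakk>a \<in> gr A i; x \<in> carrier M\<rbrakk> \<Longrightarrow>
      dif M (act M a x) = act M (dif A a) x \<oplus>\<^bsub>M\<^esub> signed M i (act M a (dif M x))"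

sublocale dg_mod \<subseteq> pre_dg_mod
  by (intro pre_dg_mod.intro pre_dg_mod_axioms.intro A.dg_ring_axioms M.pre_complex_axioms)
    (fact act_gr act_closed act_l_distr act_r_distr act_assoc act_one act_leibniz)+

context dg_ring
begin

lemma dif_gr0: "a \<in> gr A 0 \<Longrightarrow> dif A a = \<zero>"
  using dif_degree[of a 0] nonpos[of 1] by simp

lemma gr0_cocycles: "cocycles A 0 = gr A 0"
  using dif_gr0 by (auto simp: cocycles_def)

lemma gr0_commute:
  assumes "a \<in> gr A 0" "b \<in> carrier A"
  shows "b \<otimes> a = a \<otimes> b"
  using assms(2)
proof (induction b rule: homogeneous_induct)
  case (homogeneous n x)
  then show ?case using graded_comm[OF assms(1) homogeneous] by (simp add: signed_def)
qed (use assms gr_carrier in \<open>auto simp: l_distr r_distr\<close>)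

lemma gr0_mult: "\<lbrakk>a \<in> gr A 0; b \<in> gr A 0\<rbrakk> \<Longrightarrow> a \<otimes> b \<in> gr A 0"
  using mult_gr[of a 0 b 0] by simp

lemma gr0_cring: "cring (A\<lparr>carrier := gr A 0\<rparr>)"
proof (rule cringI)
  show "abelian_group (A\<lparr>carrier := gr A 0\<rparr>)"
  proof (rule abelian_groupI)
    fix x assume "x \<in> carrier (A\<lparr>carrier := gr A 0\<rparr>)"
    then have x: "x \<in> gr A 0" by simp
    then show "\<exists>y\<in>carrier (A\<lparr>carrier := gr A 0\<rparr>). y \<oplus>\<^bsub>A\<lparr>carrier := gr A 0\<rparr>\<^esub> x = \<zero>\<^bsub>A\<lparr>carrier := gr A 0\<rparr>\<^esub>"
      by (intro bexI[of _ "\<ominus> x"]) (auto simp: gr_carrier l_neg gr_minus)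
  qed (auto simp: gr_add gr_carrier a_ac)
  show "comm_monoid (A\<lparr>carrier := gr A 0\<rparr>)"
    by (rule comm_monoidI) (auto simp: gr0_mult one_gr gr_carrier m_assoc intro: gr0_commute)
qed (auto simp: gr_carrier l_distr)

lemma cobounds_ideal: "ideal (cobounds A 0) (A\<lparr>carrier := gr A 0\<rparr>)"
proof (rule idealI)
  interpret A0: cring "A\<lparr>carrier := gr A 0\<rparr>" by (rule gr0_cring)
  show "ring (A\<lparr>carrier := gr A 0\<rparr>)" by (rule A0.ring_axioms)
  have inv: "\<ominus>\<^bsub>A\<lparr>carrier := gr A 0\<rparr>\<^esub> x = \<ominus> x" if "x \<in> gr A 0" for x
    by (rule A0.minus_equality) (use that in \<open>auto simp: l_neg gr_carrier gr_minus\<close>)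
  have sub: "cobounds A 0 \<subseteq> gr A 0" using cobounds_subset_cocycles gr0_cocycles by blast
  show "subgroup (cobounds A 0) (add_monoid (A\<lparr>carrier := gr A 0\<rparr>))"
  proof (rule A0.add.subgroupI)
    show "cobounds A 0 \<subseteq> carrier (A\<lparr>carrier := gr A 0\<rparr>)" using sub by simp
    show "cobounds A 0 \<noteq> {}" using cobounds_zero by blast
  next
    fix a assume "a \<in> cobounds A 0"
    then show "\<ominus>\<^bsub>A\<lparr>carrier := gr A 0\<rparr>\<^esub> a \<in> cobounds A 0" using inv sub cobounds_minus by auto
  next
    fix a b assume "a \<in> cobounds A 0" "b \<in> cobounds A 0"
    then show "a \<oplus>\<^bsub>A\<lparr>carrier := gr A 0\<rparr>\<^esub> b \<in> cobounds A 0" by (simp add: cobounds_add)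
  qed
next
  fix a x assume "a \<in> cobounds A 0" and "x \<in> carrier (A\<lparr>carrier := gr A 0\<rparr>)"
  then obtain b where b: "b \<in> gr A (-1)" "a = dif A b" and x: "x \<in> gr A 0" by (auto simp: cobounds_def)
  have "x \<otimes> a = dif A (x \<otimes> b)"
    using b x leibniz[OF x gr_carrier[OF b(1)]] by (simp add: dif_gr0 gr_carrier dif_closed signed_def)
  moreover have "x \<otimes> b \<in> gr A (0 - 1)" using mult_gr[OF x b(1)] by simp
  ultimately show "x \<otimes>\<^bsub>A\<lparr>carrier := gr A 0\<rparr>\<^esub> a \<in> cobounds A 0" by (auto simp: cobounds_def)
  then show "a \<otimes>\<^bsub>A\<lparr>carrier := gr A 0\<rparr>\<^esub> x \<in> cobounds A 0"
    using b x gr0_commute[OF x, of a] by (simp add: dif_closed gr_carrier)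
qed

lemma H0_cring: "cring (H0 A)"
  unfolding H0_def by (rule ideal.quotient_is_cring[OF cobounds_ideal gr0_cring])

lemma H0_coset: "cobounds A 0 +>\<^bsub>A\<lparr>carrier := gr A 0\<rparr>\<^esub> a = coh_class A 0 a"
  by (auto simp: coh_class_def a_r_coset_def r_coset_def)

lemma H0_carrier: "carrier (H0 A) = coh_class A 0 ` gr A 0"
  by (auto simp: H0_def FactRing_def A_RCOSETS_def' H0_coset)

lemma H0_zero: "\<zero>\<^bsub>H0 A\<^esub> = cobounds A 0"
  by (simp add: H0_def FactRing_def)

lemma H0_one: "\<one>\<^bsub>H0 A\<^esub> = coh_class A 0 \<one>"
  by (simp add: H0_def FactRing_def H0_coset)

lemma H0_add: "\<lbrakk>a \<in> gr A 0; b \<in> gr A 0\<rbrakk> \<Longrightarrow>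
    coh_class A 0 a \<oplus>\<^bsub>H0 A\<^esub> coh_class A 0 b = coh_class A 0 (a \<oplus> b)"
  using ideal.a_rcos_sum[OF cobounds_ideal, of a b] by (simp add: H0_def FactRing_def H0_coset)

lemma H0_mult: "\<lbrakk>a \<in> gr A 0; b \<in> gr A 0\<rbrakk> \<Longrightarrow>
    coh_class A 0 a \<otimes>\<^bsub>H0 A\<^esub> coh_class A 0 b = coh_class A 0 (a \<otimes> b)"
  using ideal.rcoset_mult_add[OF cobounds_ideal, of a b] by (simp add: H0_def FactRing_def H0_coset)

lemma H0_rep:
  assumes "X \<in> carrier (H0 A)" "a \<in> X"
  shows "a \<in> gr A 0" "X = coh_class A 0 a"
proof -
  obtain c where c: "c \<in> gr A 0" "X = coh_class A 0 c" using assms(1) H0_carrier by auto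
  then obtain b where "b \<in> cobounds A 0" "a = b \<oplus> c" using assms(2) by (auto simp: mem_coh_class)
  then show "a \<in> gr A 0" using c cobounds_subset_cocycles gr0_cocycles gr_add by blast
  show "X = coh_class A 0 a" using coh_class_eqI[of c a 0] c assms(2) gr_carrier by simp
qed

end

context pre_dg_mod
begin

lemma act_zero_left: "x \<in> carrier M \<Longrightarrow> act M \<zero>\<^bsub>A\<^esub> x = \<zero>\<^bsub>M\<^esub>"
  using act_add_left[of "\<zero>\<^bsub>A\<^esub>" "\<zero>\<^bsub>A\<^esub>" x] act_carrier[of "\<zero>\<^bsub>A\<^esub>" x] M.add.r_cancel_one' by force

lemma act_zero_right: "a \<in> carrier A \<Longrightarrow> act M a \<zero>\<^bsub>M\<^esub> = \<zero>\<^bsub>M\<^esub>"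
  using act_add_right[of a "\<zero>\<^bsub>M\<^esub>" "\<zero>\<^bsub>M\<^esub>"] act_carrier[of a "\<zero>\<^bsub>M\<^esub>"] M.add.r_cancel_one' by force

lemma act_minus_left:
  assumes "a \<in> carrier A" "x \<in> carrier M"
  shows "act M (\<ominus>\<^bsub>A\<^esub> a) x = \<ominus>\<^bsub>M\<^esub> act M a x"
proof -
  have "act M (\<ominus>\<^bsub>A\<^esub> a) x \<oplus>\<^bsub>M\<^esub> act M a x = \<zero>\<^bsub>M\<^esub>"
    using act_add_left[of "\<ominus>\<^bsub>A\<^esub> a" a x] assms by (simp add: act_zero_left A.R.l_neg)
  then show ?thesis using assms by (simp add: M.minus_equality act_carrier)
qed

lemma act_minus_right:
  assumes "a \<in> carrier A" "x \<in> carrier M"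
  shows "act M a (\<ominus>\<^bsub>M\<^esub> x) = \<ominus>\<^bsub>M\<^esub> act M a x"
proof -
  have "act M a (\<ominus>\<^bsub>M\<^esub> x) \<oplus>\<^bsub>M\<^esub> act M a x = \<zero>\<^bsub>M\<^esub>"
    using act_add_right[of a "\<ominus>\<^bsub>M\<^esub> x" x] assms by (simp add: act_zero_right M.l_neg)
  then show ?thesis using assms by (simp add: M.minus_equality act_carrier)
qed

lemma act_diff_right:
  "\<lbrakk>a \<in> carrier A; x \<in> carrier M; y \<in> carrier M\<rbrakk> \<Longrightarrow> act M a (x \<ominus>\<^bsub>M\<^esub> y) = act M a x \<ominus>\<^bsub>M\<^esub> act M a y"
  by (simp add: M.minus_eq act_add_right act_minus_right)

lemma act_signed_left: "\<lbrakk>a \<in> carrier A; x \<in> carrier M\<rbrakk> \<Longrightarrow> act M (signed A i a) x = signed M i (act M a x)"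
  by (simp add: signed_def act_minus_left)

lemma act_signed_right: "\<lbrakk>a \<in> carrier A; x \<in> carrier M\<rbrakk> \<Longrightarrow> act M a (signed M i x) = signed M i (act M a x)"
  by (simp add: signed_def act_minus_right)

lemma act_gr0_degree: "\<lbrakk>a \<in> gr A 0; x \<in> gr M n\<rbrakk> \<Longrightarrow> act M a x \<in> gr M n"
  using act_degree[of a 0 x n] by simp

lemma dif_act0: "\<lbrakk>a \<in> gr A 0; x \<in> carrier M\<rbrakk> \<Longrightarrow> dif M (act M a x) = act M a (dif M x)"
  using dif_act[of a 0 x] by (simp add: A.dif_gr0 act_zero_left signed_def act_carrier A.C.gr_carrier dif_closed)

lemma act0_commute:
  "\<lbrakk>a \<in> gr A 0; b \<in> carrier A; x \<in> carrier M\<rbrakk> \<Longrightarrow> act M a (act M b x) = act M b (act M a x)"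
  using act_mult[of a b x] act_mult[of b a x] A.gr0_commute[of a b] A.C.gr_carrier[of a 0] by simp

lemma act0_cocycles: "\<lbrakk>a \<in> gr A 0; x \<in> cocycles M n\<rbrakk> \<Longrightarrow> act M a x \<in> cocycles M n"
  by (auto simp: cocycles_def act_gr0_degree dif_act0 M.gr_carrier act_zero_right A.C.gr_carrier)

lemma act0_cobounds: "\<lbrakk>a \<in> gr A 0; x \<in> cobounds M n\<rbrakk> \<Longrightarrow> act M a x \<in> cobounds M n"
  by (auto simp: cobounds_def M.gr_carrier dif_act0[symmetric] act_gr0_degree intro!: imageI)

text \<open>Multiplication by \<open>dif A b\<close> is null-homotopic, with multiplication by \<open>b\<close> as the homotopy. This is
  why \<open>H0 A\<close>, and not only the degree 0 part of \<open>A\<close>, acts on cohomology.\<close>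

lemma cobounds_act_cocycles:
  assumes "a \<in> cobounds A 0" "x \<in> cocycles M n"
  shows "act M a x \<in> cobounds M n"
proof -
  obtain b where b: "b \<in> gr A (-1)" "a = dif A b" using assms(1) by (auto simp: cobounds_def)
  have x: "x \<in> gr M n" "dif M x = \<zero>\<^bsub>M\<^esub>" using assms(2) by (auto simp: cocycles_def)
  have c: "b \<in> carrier A" "x \<in> carrier M" using b x A.C.gr_carrier M.gr_carrier by auto
  have "dif M (act M b x) = act M a x"
    using dif_act[OF b(1) c(2)] b x c by (simp add: act_zero_right act_carrier A.C.dif_closed)
  moreover have "act M b x \<in> gr M (n - 1)" using act_degree[OF b(1) x(1)] by simp
  ultimately show ?thesis by (metis cobounds_def image_eqI)
qed

lemma coh_carrier: "carrier (coh M n) = coh_class M n ` cocycles M n"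
  by (simp add: coh_def)

lemma coh_zero: "\<zero>\<^bsub>coh M n\<^esub> = cobounds M n"
  by (simp add: coh_def)

lemma coh_add: "\<lbrakk>x \<in> cocycles M n; y \<in> cocycles M n\<rbrakk> \<Longrightarrow>
    coh_class M n x \<oplus>\<^bsub>coh M n\<^esub> coh_class M n y = coh_class M n (x \<oplus>\<^bsub>M\<^esub> y)"
  by (simp add: coh_def coh_class_add cocycles_carrier)

lemma coh_smult:
  assumes a: "a \<in> gr A 0" and x: "x \<in> cocycles M n"
  shows "coh_class A 0 a \<odot>\<^bsub>coh M n\<^esub> coh_class M n x = coh_class M n (act M a x)"
proof -
  have c: "a \<in> carrier A" "x \<in> carrier M" using a x A.C.gr_carrier M.cocycles_carrier by auto
  have rep: "coh_class M n (act M b y) = coh_class M n (act M a x)"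
    if bx: "b \<in> coh_class A 0 a" "y \<in> coh_class M n x" for b y
  proof -
    obtain e f where e: "e \<in> cobounds A 0" "b = e \<oplus>\<^bsub>A\<^esub> a" and f: "f \<in> cobounds M n" "y = f \<oplus>\<^bsub>M\<^esub> x"
      using bx A.C.mem_coh_class M.mem_coh_class by blast
    have ec: "e \<in> gr A 0" using e A.C.cobounds_subset_cocycles A.gr0_cocycles by blast
    have b: "b \<in> gr A 0" using e ec a by (simp add: A.C.gr_add)
    note c' = A.C.gr_carrier[OF ec] A.C.gr_carrier[OF b] M.cobounds_carrier[OF f(1)]
    have "act M b y = act M b f \<oplus>\<^bsub>M\<^esub> (act M e x \<oplus>\<^bsub>M\<^esub> act M a x)"
      using c c' e f by (simp add: act_add_right act_add_left act_carrier)
    then have "act M b y \<ominus>\<^bsub>M\<^esub> act M a x = act M b f \<oplus>\<^bsub>M\<^esub> act M e x"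
      using c c' by (simp add: act_carrier M.minus_eq M.a_assoc M.r_neg)
    also have "\<dots> \<in> cobounds M n"
      by (intro M.cobounds_add act0_cobounds b f cobounds_act_cocycles e x)
    finally show ?thesis
      using c c' f by (subst M.coh_class_eq_iff) (auto simp: act_carrier)
  qed
  have ne: "coh_class A 0 a \<noteq> {}" "coh_class M n x \<noteq> {}"
    using A.C.coh_class_self[OF c(1)] M.coh_class_self[OF c(2)] by blast+
  have "(\<Union>b\<in>coh_class A 0 a. \<Union>y\<in>coh_class M n x. coh_class M n (act M b y)) = coh_class M n (act M a x)"
    by (intro SUP_eq_const ne rep)
  then show ?thesis by (simp add: coh_def)
qed

lemma coh_abelian_group: "abelian_group (coh M n)"
proof (rule abelian_groupI)
  fix X assume "X \<in> carrier (coh M n)"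
  then obtain x where x: "x \<in> cocycles M n" "X = coh_class M n x" by (auto simp: coh_carrier)
  have "coh_class M n (\<ominus>\<^bsub>M\<^esub> x) \<oplus>\<^bsub>coh M n\<^esub> X = \<zero>\<^bsub>coh M n\<^esub>"
    using x by (simp add: coh_add M.cocycles_minus coh_zero M.l_neg M.cocycles_carrier M.coh_class_zero)
  then show "\<exists>Y\<in>carrier (coh M n). Y \<oplus>\<^bsub>coh M n\<^esub> X = \<zero>\<^bsub>coh M n\<^esub>"
    using x M.cocycles_minus coh_carrier by blast
next
  show "\<zero>\<^bsub>coh M n\<^esub> \<in> carrier (coh M n)"
    using M.cocycles_zero[of n] M.coh_class_zero[of n] coh_carrier coh_zero by (metis image_eqI)
next
  fix X assume "X \<in> carrier (coh M n)"
  then obtain x where x: "x \<in> cocycles M n" "X = coh_class M n x" by (auto simp: coh_carrier)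
  then show "\<zero>\<^bsub>coh M n\<^esub> \<oplus>\<^bsub>coh M n\<^esub> X = X"
    using coh_add[OF M.cocycles_zero x(1)] by (simp add: coh_zero M.coh_class_zero M.cocycles_carrier)
next
  fix X Y Z assume "X \<in> carrier (coh M n)" "Y \<in> carrier (coh M n)" "Z \<in> carrier (coh M n)"
  then show "X \<oplus>\<^bsub>coh M n\<^esub> Y \<oplus>\<^bsub>coh M n\<^esub> Z = X \<oplus>\<^bsub>coh M n\<^esub> (Y \<oplus>\<^bsub>coh M n\<^esub> Z)"
    by (auto simp: coh_carrier coh_add M.cocycles_add M.a_assoc M.cocycles_carrier)
next
  fix X Y assume "X \<in> carrier (coh M n)" "Y \<in> carrier (coh M n)"
  then show "X \<oplus>\<^bsub>coh M n\<^esub> Y = Y \<oplus>\<^bsub>coh M n\<^esub> X"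
    by (auto simp: coh_carrier coh_add M.cocycles_carrier M.a_comm)
qed (auto simp: coh_carrier coh_add M.cocycles_add)

lemma coh_module: "Module.module (H0 A) (coh M n)"
proof (rule moduleI[OF A.H0_cring coh_abelian_group])
qed (auto simp: A.H0_carrier coh_carrier coh_smult coh_add A.H0_add A.H0_mult A.H0_one A.C.gr_add A.gr0_mult
    A.one_gr M.cocycles_add act0_cocycles act_add_left act_add_right act_mult act_unit
    A.C.gr_carrier M.cocycles_carrier)

lemma coh_nonzero_iff: "coh_nonzero M n \<longleftrightarrow> (\<exists>x \<in> cocycles M n. x \<notin> cobounds M n)"
proof
  interpret C: Module.module "H0 A" "coh M n" by (rule coh_module)
  assume "coh_nonzero M n"
  then obtain X where "X \<in> carrier (coh M n)" "X \<noteq> \<zero>\<^bsub>coh M n\<^esub>"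
    using C.M.zero_closed unfolding coh_nonzero_def by blast
  then show "\<exists>x \<in> cocycles M n. x \<notin> cobounds M n"
    using M.coh_class_eq_zero_iff[OF M.cocycles_carrier] unfolding coh_carrier coh_zero by blast
next
  assume "\<exists>x \<in> cocycles M n. x \<notin> cobounds M n"
  then obtain x where "x \<in> cocycles M n" "x \<notin> cobounds M n" by blast
  then have "coh_class M n x \<in> carrier (coh M n)" "coh_class M n x \<noteq> \<zero>\<^bsub>coh M n\<^esub>"
    using M.coh_class_eq_zero_iff M.cocycles_carrier by (auto simp: coh_carrier coh_zero)
  then show "coh_nonzero M n" unfolding coh_nonzero_def by blast
qed

end


section \<open>Maps on cohomology\<close>

text \<open>The map that \<open>f\<close> induces on classes, in the form in which it occurs in \<open>quasi_iso\<close>. The target degree is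
  free, so that projections from a cone onto a shifted module are covered.\<close>

definition coh_map :: "('n, 'z) dg_scheme \<Rightarrow> int \<Rightarrow> ('m \<Rightarrow> 'n) \<Rightarrow> 'm set \<Rightarrow> 'n set" where
  "coh_map N n f Y = (\<Union>y \<in> Y. coh_class N n (f y))"

lemma coh_map_class:
  assumes M: "pre_complex M" and N: "pre_complex N"
    and cocyc: "\<And>x. x \<in> cocycles M k \<Longrightarrow> f x \<in> cocycles N n"
    and add: "\<And>x y. \<lbrakk>x \<in> cocycles M k; y \<in> cocycles M k\<rbrakk> \<Longrightarrow> f (x \<oplus>\<^bsub>M\<^esub> y) = f x \<oplus>\<^bsub>N\<^esub> f y"
    and cobd: "\<And>x. x \<in> cobounds M k \<Longrightarrow> f x \<in> cobounds N n"
    and x: "x \<in> cocycles M k"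
  shows "coh_map N n f (coh_class M k x) = coh_class N n (f x)"
proof -
  interpret M: pre_complex M by fact
  interpret N: pre_complex N by fact
  have "coh_class N n (f y) = coh_class N n (f x)" if y: "y \<in> coh_class M k x" for y
  proof -
    obtain b where b: "b \<in> cobounds M k" "y = b \<oplus>\<^bsub>M\<^esub> x" using y M.mem_coh_class by blast
    then have "f y = f b \<oplus>\<^bsub>N\<^esub> f x" using add x M.cobounds_subset_cocycles by blast
    then have "f y \<in> coh_class N n (f x)" using cobd[OF b(1)] N.mem_coh_class by blast
    then show ?thesis by (rule N.coh_class_eqI[OF N.cocycles_carrier[OF cocyc[OF x]]])
  qed
  then show ?thesis
    using M.coh_class_self[OF M.cocycles_carrier[OF x]] unfolding coh_map_def by blast
qed

lemma coh_map_linear: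
  assumes M: "pre_dg_mod A M" and N: "pre_dg_mod A N"
    and cocyc: "\<And>x. x \<in> cocycles M k \<Longrightarrow> f x \<in> cocycles N n"
    and add: "\<And>x y. \<lbrakk>x \<in> cocycles M k; y \<in> cocycles M k\<rbrakk> \<Longrightarrow> f (x \<oplus>\<^bsub>M\<^esub> y) = f x \<oplus>\<^bsub>N\<^esub> f y"
    and cobd: "\<And>x. x \<in> cobounds M k \<Longrightarrow> f x \<in> cobounds N n"
    and lin: "\<And>a x. \<lbrakk>a \<in> gr A 0; x \<in> cocycles M k\<rbrakk> \<Longrightarrow> f (act M a x) = act N a (f x)"
  shows "linear_map (H0 A) (coh M k) (coh N n) (coh_map N n f)"
proof -
  interpret M: pre_dg_mod A M by fact
  interpret N: pre_dg_mod A N by fact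
  note cl = coh_map_class[where f = f and k = k and n = n, OF M.M.pre_complex_axioms N.M.pre_complex_axioms cocyc add cobd]
  show ?thesis
    unfolding linear_map_def
  proof (intro conjI ballI funcsetI)
    fix X assume "X \<in> carrier (coh M k)"
    then obtain x where "x \<in> cocycles M k" "X = coh_class M k x" using M.coh_carrier by blast
    then show "coh_map N n f X \<in> carrier (coh N n)" using cl cocyc N.coh_carrier by simp
  next
    fix X Y assume "X \<in> carrier (coh M k)" "Y \<in> carrier (coh M k)"
    then obtain x y where "x \<in> cocycles M k" "X = coh_class M k x" "y \<in> cocycles M k" "Y = coh_class M k y"
      by (auto simp: M.coh_carrier)
    then show "coh_map N n f (X \<oplus>\<^bsub>coh M k\<^esub> Y) = coh_map N n f X \<oplus>\<^bsub>coh N n\<^esub> coh_map N n f Y"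
      using cl cocyc add by (simp add: M.coh_add N.coh_add M.M.cocycles_add)
  next
    fix r X assume "r \<in> carrier (H0 A)" "X \<in> carrier (coh M k)"
    then obtain a x where "a \<in> gr A 0" "r = coh_class A 0 a" "x \<in> cocycles M k" "X = coh_class M k x"
      by (auto simp: M.coh_carrier M.A.H0_carrier)
    then show "coh_map N n f (r \<odot>\<^bsub>coh M k\<^esub> X) = r \<odot>\<^bsub>coh N n\<^esub> coh_map N n f X"
      using cl cocyc lin by (simp add: M.coh_smult N.coh_smult M.act0_cocycles)
  qed
qed

lemma assoc_primes_injective:
  assumes L: "module R L" "module R L'" and f: "linear_map R L L' f" "inj_on f (carrier L)"
  shows "assoc_primes R L \<subseteq> assoc_primes R L'"
proof -
  interpret L: module R L by fact
  interpret L': module R L' by fact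
  have "ann R L' (f z) = ann R L z" if z: "z \<in> carrier L" for z
  proof -
    have "r \<odot>\<^bsub>L'\<^esub> f z = \<zero>\<^bsub>L'\<^esub> \<longleftrightarrow> r \<odot>\<^bsub>L\<^esub> z = \<zero>\<^bsub>L\<^esub>" if r: "r \<in> carrier R" for r
      using inj_onD[OF f(2), of "r \<odot>\<^bsub>L\<^esub> z" "\<zero>\<^bsub>L\<^esub>"] linear_mapD(3)[OF f(1) r z]
        linear_map_zero[OF L f(1)] r z by auto
    then show ?thesis by (auto simp: ann_def)
  qed
  then show ?thesis using linear_mapD(1)[OF f(1)] by (force simp: assoc_primes_def)
qed


section \<open>Cones\<close>

lemma embed_pre_dg_mod:
  assumes "pre_dg_mod A M"
  shows "pre_dg_mod A (embed M)"
proof -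
  interpret M: pre_dg_mod A M by fact
  have ab: "abelian_group (embed M)"
  proof (rule abelian_groupI)
    fix x assume "x \<in> carrier (embed M)"
    then obtain y where "y \<in> carrier M" "x = Base y" by (auto simp: embed_def)
    then show "\<exists>y\<in>carrier (embed M). y \<oplus>\<^bsub>embed M\<^esub> x = \<zero>\<^bsub>embed M\<^esub>"
      by (intro bexI[of _ "Base (\<ominus>\<^bsub>M\<^esub> y)"]) (auto simp: embed_def M.l_neg)
  qed (auto simp: embed_def M.a_ac)
  then interpret E: abelian_group "embed M" .
  have minus: "\<ominus>\<^bsub>embed M\<^esub> Base x = Base (\<ominus>\<^bsub>M\<^esub> x)" if "x \<in> carrier M" for x
    by (rule E.minus_equality) (use that in \<open>auto simp: embed_def M.l_neg\<close>)
  have signed: "signed (embed M) i (Base x) = Base (signed M i x)" if "x \<in> carrier M" for i x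
    using minus that by (simp add: signed_def)
  show ?thesis
  proof (intro pre_dg_mod.intro pre_complex.intro pre_complex_axioms.intro pre_dg_mod_axioms.intro
      M.A.dg_ring_axioms ab)
    fix n show "additive_subgroup (gr (embed M) n) (embed M)"
    proof (rule additive_subgroupI, rule E.add.subgroupI)
      show "gr (embed M) n \<noteq> {}" using M.M.gr_zero[of n] unfolding embed_def by (simp, blast)
    next
      fix a assume "a \<in> gr (embed M) n"
      then show "\<ominus>\<^bsub>embed M\<^esub> a \<in> gr (embed M) n"
        using minus M.M.gr_carrier M.M.gr_minus by (auto simp: embed_def)
    qed (use M.M.gr_carrier M.M.gr_add in \<open>auto simp: embed_def\<close>)
  next
    fix a i x assume "a \<in> gr A i" "x \<in> carrier (embed M)"
    then show "dif (embed M) (act (embed M) a x) =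
        act (embed M) (dif A a) x \<oplus>\<^bsub>embed M\<^esub> signed (embed M) i (act (embed M) a (dif (embed M) x))"
      using signed M.dif_act M.act_carrier M.M.dif_closed M.A.C.gr_carrier by (auto simp: embed_def)
  qed (auto simp: embed_def M.M.dif_closed M.M.dif_distrib M.M.dif_degree M.M.dif_square M.act_degree
      M.act_carrier M.act_add_left M.act_add_right M.act_mult M.act_unit)
qed

lemma embed_cocycles: "cocycles (embed M) n = Base ` cocycles M n"
  by (auto simp: cocycles_def embed_def)

lemma embed_cobounds: "cobounds (embed M) n = Base ` cobounds M n"
  by (auto simp: cobounds_def embed_def image_image)

lemma embed_coh_map:
  assumes "pre_dg_mod A M"
  shows "linear_map (H0 A) (coh M n) (coh (embed M) n) (coh_map (embed M) n Base)"
    and "bij_betw (coh_map (embed M) n Base) (carrier (coh M n)) (carrier (coh (embed M) n))"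
proof -
  interpret M: pre_dg_mod A M by fact
  interpret E: pre_dg_mod A "embed M" by (rule embed_pre_dg_mod[OF assms])
  have h: "\<And>x. x \<in> cocycles M n \<Longrightarrow> Base x \<in> cocycles (embed M) n"
    "\<And>x. x \<in> cobounds M n \<Longrightarrow> Base x \<in> cobounds (embed M) n"
    by (simp_all add: embed_cocycles embed_cobounds)
  have h2: "\<And>x y. Base (x \<oplus>\<^bsub>M\<^esub> y) = Base x \<oplus>\<^bsub>embed M\<^esub> Base y"
    "\<And>a x. Base (act M a x) = act (embed M) a (Base x)"
    by (simp_all add: embed_def)
  show "linear_map (H0 A) (coh M n) (coh (embed M) n) (coh_map (embed M) n Base)"
    by (rule coh_map_linear[OF assms E.pre_dg_mod_axioms]) (simp_all add: h h2)
  have cl: "coh_map (embed M) n Base (coh_class M n x) = coh_class (embed M) n (Base x)"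
    if "x \<in> cocycles M n" for x
    by (rule coh_map_class[OF M.M.pre_complex_axioms E.M.pre_complex_axioms]) (simp_all add: h h2 that)
  have minus: "\<ominus>\<^bsub>embed M\<^esub> Base x = Base (\<ominus>\<^bsub>M\<^esub> x)" if "x \<in> carrier M" for x
    by (rule E.M.minus_equality) (use that in \<open>auto simp: embed_def M.l_neg\<close>)
  show "bij_betw (coh_map (embed M) n Base) (carrier (coh M n)) (carrier (coh (embed M) n))"
    unfolding bij_betw_def
  proof
    show "inj_on (coh_map (embed M) n Base) (carrier (coh M n))"
    proof (rule inj_onI)
      fix X Y assume "X \<in> carrier (coh M n)" "Y \<in> carrier (coh M n)"
      then obtain x y where x: "x \<in> cocycles M n" "X = coh_class M n x" and y: "y \<in> cocycles M n" "Y = coh_class M n y"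
        by (auto simp: M.coh_carrier)
      note c = M.M.cocycles_carrier[OF x(1)] M.M.cocycles_carrier[OF y(1)]
        E.M.cocycles_carrier[OF h(1)[OF x(1)]] E.M.cocycles_carrier[OF h(1)[OF y(1)]]
      assume "coh_map (embed M) n Base X = coh_map (embed M) n Base Y"
      then have "Base x \<ominus>\<^bsub>embed M\<^esub> Base y \<in> cobounds (embed M) n"
        using cl x y E.M.coh_class_eq_iff[OF c(3,4)] by simp
      moreover have "Base x \<ominus>\<^bsub>embed M\<^esub> Base y = Base (x \<ominus>\<^bsub>M\<^esub> y)"
        using c by (simp add: E.M.minus_eq M.minus_eq minus h2)
      ultimately have "x \<ominus>\<^bsub>M\<^esub> y \<in> cobounds M n" by (simp add: embed_cobounds image_iff)
      then show "X = Y" using x y M.M.coh_class_eq_iff[OF c(1,2)] by simp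
    qed
    show "coh_map (embed M) n Base ` carrier (coh M n) = carrier (coh (embed M) n)"
      using cl by (simp add: M.coh_carrier E.coh_carrier embed_cocycles image_image)
  qed
qed

lemma cone_simps:
  "CPair u v \<in> carrier (cone A N a) \<longleftrightarrow> u \<in> carrier N \<and> v \<in> carrier N"
  "\<zero>\<^bsub>cone A N a\<^esub> = CPair \<zero>\<^bsub>N\<^esub> \<zero>\<^bsub>N\<^esub>"
  "CPair u v \<oplus>\<^bsub>cone A N a\<^esub> CPair u' v' = CPair (u \<oplus>\<^bsub>N\<^esub> u') (v \<oplus>\<^bsub>N\<^esub> v')"
  "CPair u v \<in> gr (cone A N a) n \<longleftrightarrow> u \<in> gr N (n + 1) \<and> v \<in> gr N n"
  "dif (cone A N a) (CPair u v) = CPair (\<ominus>\<^bsub>N\<^esub> dif N u) (act N a u \<oplus>\<^bsub>N\<^esub> dif N v)"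
  "act (cone A N a) b (CPair u v) = CPair (act N (sign_aut A b) u) (act N b v)"
  by (auto simp: cone_def)

lemma cone_carrierE:
  assumes "x \<in> carrier (cone A N a)"
  obtains u v where "x = CPair u v" "u \<in> carrier N" "v \<in> carrier N"
  using assms by (auto simp: cone_def)

lemma cone_grE:
  assumes "x \<in> gr (cone A N a) n"
  obtains u v where "x = CPair u v" "u \<in> gr N (n + 1)" "v \<in> gr N n"
  using assms by (auto simp: cone_def)

locale cone_of = N?: pre_dg_mod A N for A :: "('a, 'z) dg_scheme" and N :: "('a, 'm cone_elem) dg_module" +
  fixes a :: 'a
  assumes a_gr0: "a \<in> gr A 0"
begin

abbreviation C where "C \<equiv> cone A N a"

lemma a_carrier: "a \<in> carrier A"
  using a_gr0 A.C.gr_carrier by blast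

lemma cone_abelian_group: "abelian_group C"
proof (rule abelian_groupI)
  fix x assume "x \<in> carrier C"
  then obtain u v where x: "x = CPair u v" "u \<in> carrier N" "v \<in> carrier N" by (rule cone_carrierE)
  then show "\<exists>y\<in>carrier C. y \<oplus>\<^bsub>C\<^esub> x = \<zero>\<^bsub>C\<^esub>"
    by (intro bexI[of _ "CPair (\<ominus>\<^bsub>N\<^esub> u) (\<ominus>\<^bsub>N\<^esub> v)"]) (auto simp: cone_simps M.l_neg)
qed (auto simp: cone_simps M.a_ac elim!: cone_carrierE)

lemma cone_minus:
  assumes "u \<in> carrier N" "v \<in> carrier N"
  shows "\<ominus>\<^bsub>C\<^esub> CPair u v = CPair (\<ominus>\<^bsub>N\<^esub> u) (\<ominus>\<^bsub>N\<^esub> v)"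
  by (rule abelian_group.minus_equality[OF cone_abelian_group])
    (use assms in \<open>auto simp: cone_simps M.l_neg\<close>)

lemma cone_signed:
  "\<lbrakk>u \<in> carrier N; v \<in> carrier N\<rbrakk> \<Longrightarrow> signed C i (CPair u v) = CPair (signed N i u) (signed N i v)"
  by (simp add: signed_def cone_minus)

text \<open>The sign in front of \<open>dif N u\<close> is absorbed by \<open>sign_aut\<close> acting on the first component; the term
  \<open>act N a u\<close> is compatible with the action because \<open>a\<close>, being of degree 0, commutes with \<open>A\<close>.\<close>

lemma cone_pre_dg_mod: "pre_dg_mod A C"
proof (intro pre_dg_mod.intro pre_complex.intro pre_complex_axioms.intro pre_dg_mod_axioms.intro
    A.dg_ring_axioms cone_abelian_group)
  interpret C: abelian_group C by (rule cone_abelian_group)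
  fix n show "additive_subgroup (gr C n) C"
  proof (rule additive_subgroupI, rule C.add.subgroupI)
    show "gr C n \<noteq> {}" using cone_simps(4)[of "\<zero>\<^bsub>N\<^esub>" "\<zero>\<^bsub>N\<^esub>" A N a n] M.gr_zero by blast
    show "gr C n \<subseteq> carrier C" by (auto simp: cone_simps M.gr_carrier elim!: cone_grE)
  next
    fix x assume "x \<in> gr C n"
    then show "\<ominus>\<^bsub>C\<^esub> x \<in> gr C n"
      by (auto elim!: cone_grE simp: M.gr_carrier cone_minus cone_simps M.gr_minus)
  next
    fix x y assume "x \<in> gr C n" "y \<in> gr C n"
    then show "x \<oplus>\<^bsub>C\<^esub> y \<in> gr C n"
      by (auto elim!: cone_grE simp: cone_simps M.gr_add)
  qed
next
  fix x assume "x \<in> carrier C"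
  then show "dif C x \<in> carrier C"
    by (auto elim!: cone_carrierE simp: cone_simps act_carrier a_carrier M.dif_closed)
next
  fix x y assume "x \<in> carrier C" "y \<in> carrier C"
  then show "dif C (x \<oplus>\<^bsub>C\<^esub> y) = dif C x \<oplus>\<^bsub>C\<^esub> dif C y"
    by (auto elim!: cone_carrierE simp: cone_simps act_carrier a_carrier M.dif_closed M.dif_distrib
      act_add_right M.minus_add M.a_ac)
next
  fix x n assume "x \<in> gr C n"
  then obtain u v where x: "x = CPair u v" "u \<in> gr N (n + 1)" "v \<in> gr N n" by (rule cone_grE)
  then show "dif C x \<in> gr C (n + 1)"
    using M.gr_minus[OF M.dif_degree[OF x(2)]] M.dif_degree[OF x(3)] act_gr0_degree[OF a_gr0 x(2)]
    by (simp add: cone_simps M.gr_add)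
next
  fix x assume "x \<in> carrier C"
  then obtain u v where x: "x = CPair u v" "u \<in> carrier N" "v \<in> carrier N" by (rule cone_carrierE)
  then show "dif C (dif C x) = \<zero>\<^bsub>C\<^esub>"
    by (simp add: cone_simps M.dif_minus M.dif_closed M.dif_square M.dif_distrib act_carrier a_carrier
      act_minus_right dif_act0 a_gr0 M.l_neg)
next
  fix b i x j assume b: "b \<in> gr A i" and "x \<in> gr C j"
  then obtain u v where x: "x = CPair u v" "u \<in> gr N (j + 1)" "v \<in> gr N j" by (auto elim: cone_grE)
  then show "act C b x \<in> gr C (i + j)"
    using act_degree[OF b x(2)] act_degree[OF b x(3)] b
    by (simp add: cone_simps A.C.sign_aut_homog[OF b] act_signed_left A.C.gr_carrier M.gr_carrier
      M.signed_gr add.assoc)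
next
  fix b x assume "b \<in> carrier A" "x \<in> carrier C"
  then show "act C b x \<in> carrier C"
    by (auto elim!: cone_carrierE simp: cone_simps act_carrier A.C.sign_aut_closed)
next
  fix b c x assume "b \<in> carrier A" "c \<in> carrier A" "x \<in> carrier C"
  then show "act C (b \<oplus>\<^bsub>A\<^esub> c) x = act C b x \<oplus>\<^bsub>C\<^esub> act C c x"
    by (auto elim!: cone_carrierE simp: cone_simps act_add_left A.C.sign_aut_closed A.C.sign_aut_add)
next
  fix b x y assume "b \<in> carrier A" "x \<in> carrier C" "y \<in> carrier C"
  then show "act C b (x \<oplus>\<^bsub>C\<^esub> y) = act C b x \<oplus>\<^bsub>C\<^esub> act C b y"
    by (auto elim!: cone_carrierE simp: cone_simps act_add_right A.C.sign_aut_closed)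
next
  fix b c x assume "b \<in> carrier A" "c \<in> carrier A" "x \<in> carrier C"
  then show "act C (b \<otimes>\<^bsub>A\<^esub> c) x = act C b (act C c x)"
    by (auto elim!: cone_carrierE simp: cone_simps act_mult A.C.sign_aut_closed A.sign_aut_mult)
next
  fix x assume "x \<in> carrier C"
  then show "act C \<one>\<^bsub>A\<^esub> x = x"
    using A.C.sign_aut_homog[OF A.one_gr]
    by (auto elim!: cone_carrierE simp: cone_simps act_unit signed_def)
next
  fix b i x assume b: "b \<in> gr A i" and "x \<in> carrier C"
  then obtain u v where x: "x = CPair u v" "u \<in> carrier N" "v \<in> carrier N" by (auto elim: cone_carrierE)
  have bc: "b \<in> carrier A" "dif A b \<in> carrier A" using b A.C.gr_carrier A.C.dif_closed by auto
  have s: "act N (sign_aut A b) y = signed N i (act N b y)" if "y \<in> carrier N" for y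
    using that bc by (simp add: A.C.sign_aut_homog[OF b] act_signed_left)
  have s': "act N (sign_aut A (dif A b)) y = signed N (i + 1) (act N (dif A b) y)" if "y \<in> carrier N" for y
    using that bc A.C.sign_aut_homog[OF A.C.dif_degree[OF b]] by (simp add: act_signed_left)
  note c = x(2,3) bc act_carrier[OF bc(1)] act_carrier[OF bc(2)] act_carrier[OF a_carrier] M.dif_closed
  have 1: "\<ominus>\<^bsub>N\<^esub> dif N (signed N i (act N b u)) =
      signed N (i + 1) (act N (dif A b) u) \<oplus>\<^bsub>N\<^esub> signed N i (signed N i (act N b (\<ominus>\<^bsub>N\<^esub> dif N u)))"
    using c by (simp add: M.dif_signed dif_act[OF b] M.signed_add M.signed_signed act_minus_right)
      (simp add: signed_def M.minus_add)
  have 2: "act N a (signed N i (act N b u)) \<oplus>\<^bsub>N\<^esub> dif N (act N b v) =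
      act N (dif A b) v \<oplus>\<^bsub>N\<^esub> signed N i (act N b (act N a u \<oplus>\<^bsub>N\<^esub> dif N v))"
    using c by (simp add: dif_act[OF b] act_signed_right a_carrier act_add_right M.signed_add
        act0_commute[OF a_gr0] M.a_lcomm)
  show "dif C (act C b x) = act C (dif A b) x \<oplus>\<^bsub>C\<^esub> signed C i (act C b (dif C x))"
    using c 1 2 by (simp add: x(1) cone_simps s s' cone_signed)
qed

sublocale C: pre_dg_mod A C
  by (rule cone_pre_dg_mod)

lemma cone_cocycles: "CPair u v \<in> cocycles C n \<longleftrightarrow>
    u \<in> cocycles N (n + 1) \<and> v \<in> gr N n \<and> act N a u \<oplus>\<^bsub>N\<^esub> dif N v = \<zero>\<^bsub>N\<^esub>"
proof -
  have "\<ominus>\<^bsub>N\<^esub> dif N u = \<zero>\<^bsub>N\<^esub> \<longleftrightarrow> dif N u = \<zero>\<^bsub>N\<^esub>" if "u \<in> carrier N"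
    using M.add.inv_eq_1_iff that M.dif_closed by simp
  then show ?thesis using M.gr_carrier by (auto simp: cocycles_def cone_simps)
qed

lemma cone_cobounds: "CPair u v \<in> cobounds C n \<longleftrightarrow>
    (\<exists>u' \<in> gr N n. \<exists>v' \<in> gr N (n - 1). u = \<ominus>\<^bsub>N\<^esub> dif N u' \<and> v = act N a u' \<oplus>\<^bsub>N\<^esub> dif N v')"
proof
  assume "CPair u v \<in> cobounds C n"
  then obtain x where x: "x \<in> gr C (n - 1)" "CPair u v = dif C x" by (auto simp: cobounds_def)
  then obtain u' v' where "x = CPair u' v'" "u' \<in> gr N (n - 1 + 1)" "v' \<in> gr N (n - 1)"
    by (auto elim: cone_grE)
  then show "\<exists>u' \<in> gr N n. \<exists>v' \<in> gr N (n - 1). u = \<ominus>\<^bsub>N\<^esub> dif N u' \<and> v = act N a u' \<oplus>\<^bsub>N\<^esub> dif N v'"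
    using x by (auto simp: cone_simps)
next
  assume "\<exists>u' \<in> gr N n. \<exists>v' \<in> gr N (n - 1). u = \<ominus>\<^bsub>N\<^esub> dif N u' \<and> v = act N a u' \<oplus>\<^bsub>N\<^esub> dif N v'"
  then obtain u' v' where *: "u' \<in> gr N n" "v' \<in> gr N (n - 1)" "u = \<ominus>\<^bsub>N\<^esub> dif N u'" "v = act N a u' \<oplus>\<^bsub>N\<^esub> dif N v'"
    by blast
  then have "CPair u v = dif C (CPair u' v')" "CPair u' v' \<in> gr C (n - 1)" by (simp_all add: cone_simps)
  then show "CPair u v \<in> cobounds C n" unfolding cobounds_def by (rule image_eqI)
qed

end


section \<open>The long exact sequence of a cone\<close>

context cone_of
begin

abbreviation from_N :: "int \<Rightarrow> 'm cone_elem set \<Rightarrow> 'm cone_elem set" where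
  "from_N n \<equiv> coh_map C n (CPair \<zero>\<^bsub>N\<^esub>)"

abbreviation to_N :: "int \<Rightarrow> 'm cone_elem set \<Rightarrow> 'm cone_elem set" where
  "to_N n \<equiv> coh_map N (n + 1) shifted"

lemma from_N_facts:
  "v \<in> cocycles N n \<Longrightarrow> CPair \<zero>\<^bsub>N\<^esub> v \<in> cocycles C n"
  "\<lbrakk>v \<in> cocycles N n; w \<in> cocycles N n\<rbrakk> \<Longrightarrow> CPair \<zero>\<^bsub>N\<^esub> (v \<oplus>\<^bsub>N\<^esub> w) = CPair \<zero>\<^bsub>N\<^esub> v \<oplus>\<^bsub>C\<^esub> CPair \<zero>\<^bsub>N\<^esub> w"
  "v \<in> cobounds N n \<Longrightarrow> CPair \<zero>\<^bsub>N\<^esub> v \<in> cobounds C n"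
  "\<lbrakk>b \<in> gr A 0; v \<in> cocycles N n\<rbrakk> \<Longrightarrow> CPair \<zero>\<^bsub>N\<^esub> (act N b v) = act C b (CPair \<zero>\<^bsub>N\<^esub> v)"
proof -
  show "v \<in> cocycles N n \<Longrightarrow> CPair \<zero>\<^bsub>N\<^esub> v \<in> cocycles C n"
    by (simp add: cone_cocycles act_zero_right a_carrier) (simp add: cocycles_def)
  show "CPair \<zero>\<^bsub>N\<^esub> (v \<oplus>\<^bsub>N\<^esub> w) = CPair \<zero>\<^bsub>N\<^esub> v \<oplus>\<^bsub>C\<^esub> CPair \<zero>\<^bsub>N\<^esub> w"
    by (simp add: cone_simps)
  show "CPair \<zero>\<^bsub>N\<^esub> v \<in> cobounds C n" if v: "v \<in> cobounds N n"
  proof -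
    obtain v' where v': "v' \<in> gr N (n - 1)" "v = dif N v'" using v by (auto simp: cobounds_def)
    show ?thesis
      unfolding cone_cobounds
      by (rule bexI[of _ "\<zero>\<^bsub>N\<^esub>"], rule bexI[of _ v'])
        (use v' in \<open>simp_all add: act_zero_right a_carrier M.dif_closed M.gr_carrier\<close>)
  qed
  show "CPair \<zero>\<^bsub>N\<^esub> (act N b v) = act C b (CPair \<zero>\<^bsub>N\<^esub> v)" if "b \<in> gr A 0"
    using that by (simp add: cone_simps act_zero_right A.C.sign_aut_closed A.C.gr_carrier)
qed

lemma from_N_class: "v \<in> cocycles N n \<Longrightarrow> from_N n (coh_class N n v) = coh_class C n (CPair \<zero>\<^bsub>N\<^esub> v)"
  by (rule coh_map_class[OF M.pre_complex_axioms C.M.pre_complex_axioms]) (use from_N_facts in auto)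

lemma from_N_linear: "linear_map (H0 A) (coh N n) (coh C n) (from_N n)"
  by (rule coh_map_linear[OF pre_dg_mod_axioms cone_pre_dg_mod]) (use from_N_facts in auto)

lemma cone_cocyclesE:
  assumes "x \<in> cocycles C n"
  obtains u v where "x = CPair u v" "u \<in> cocycles N (n + 1)" "v \<in> gr N n"
    "act N a u \<oplus>\<^bsub>N\<^esub> dif N v = \<zero>\<^bsub>N\<^esub>"
  using assms cone_cocycles by (cases x) (auto simp: cocycles_def cone_def)

lemma cone_coboundsI:
  "\<lbrakk>u \<in> gr N n; v \<in> gr N (n - 1)\<rbrakk> \<Longrightarrow> CPair (\<ominus>\<^bsub>N\<^esub> dif N u) (act N a u \<oplus>\<^bsub>N\<^esub> dif N v) \<in> cobounds C n"
  by (auto simp: cone_cobounds)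

lemma to_N_facts:
  "x \<in> cocycles C n \<Longrightarrow> shifted x \<in> cocycles N (n + 1)"
  "\<lbrakk>x \<in> cocycles C n; y \<in> cocycles C n\<rbrakk> \<Longrightarrow> shifted (x \<oplus>\<^bsub>C\<^esub> y) = shifted x \<oplus>\<^bsub>N\<^esub> shifted y"
  "x \<in> cobounds C n \<Longrightarrow> shifted x \<in> cobounds N (n + 1)"
  "\<lbrakk>b \<in> gr A 0; x \<in> cocycles C n\<rbrakk> \<Longrightarrow> shifted (act C b x) = act N b (shifted x)"
proof -
  show "x \<in> cocycles C n \<Longrightarrow> shifted x \<in> cocycles N (n + 1)"
    by (auto elim: cone_cocyclesE)
  show "\<lbrakk>x \<in> cocycles C n; y \<in> cocycles C n\<rbrakk> \<Longrightarrow> shifted (x \<oplus>\<^bsub>C\<^esub> y) = shifted x \<oplus>\<^bsub>N\<^esub> shifted y"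
    by (auto elim!: cone_cocyclesE simp: cone_simps)
  show "shifted x \<in> cobounds N (n + 1)" if x: "x \<in> cobounds C n"
  proof -
    obtain u v where uv: "x = CPair u v"
      using x C.M.cobounds_carrier by (blast elim: cone_carrierE)
    then obtain u' where "u' \<in> gr N n" "u = \<ominus>\<^bsub>N\<^esub> dif N u'" using x by (auto simp: cone_cobounds)
    then show ?thesis
      using uv M.cobounds_minus[OF M.dif_in_cobounds] by simp
  qed
  show "\<lbrakk>b \<in> gr A 0; x \<in> cocycles C n\<rbrakk> \<Longrightarrow> shifted (act C b x) = act N b (shifted x)"
    by (auto elim!: cone_cocyclesE simp: cone_simps A.C.sign_aut_homog[of b 0] signed_def)
qed

lemma to_N_class: "x \<in> cocycles C n \<Longrightarrow> to_N n (coh_class C n x) = coh_class N (n + 1) (shifted x)"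
  by (rule coh_map_class[OF C.M.pre_complex_axioms M.pre_complex_axioms]) (use to_N_facts in auto)

lemma to_N_linear: "linear_map (H0 A) (coh C n) (coh N (n + 1)) (to_N n)"
  by (rule coh_map_linear[OF cone_pre_dg_mod pre_dg_mod_axioms]) (use to_N_facts in auto)

text \<open>Adding the coboundary of \<open>CPair u' 0\<close> removes the first component.\<close>

lemma cone_cocycle_reduce:
  assumes x: "CPair u v \<in> cocycles C n" and u': "u' \<in> gr N n" "u = dif N u'"
  shows "v \<oplus>\<^bsub>N\<^esub> act N a u' \<in> cocycles N n"
    and "coh_class C n (CPair u v) = coh_class C n (CPair \<zero>\<^bsub>N\<^esub> (v \<oplus>\<^bsub>N\<^esub> act N a u'))"
proof -
  have xv: "v \<in> gr N n" "act N a u \<oplus>\<^bsub>N\<^esub> dif N v = \<zero>\<^bsub>N\<^esub>" using x by (auto simp: cone_cocycles)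
  note c = M.gr_carrier[OF u'(1)] M.gr_carrier[OF xv(1)] act_carrier[OF a_carrier M.gr_carrier[OF u'(1)]]
    act_carrier[OF a_carrier M.dif_closed[OF M.gr_carrier[OF u'(1)]]]
  have "dif N (v \<oplus>\<^bsub>N\<^esub> act N a u') = \<zero>\<^bsub>N\<^esub>"
    using xv(2) c u'(2) by (simp add: M.dif_distrib dif_act0[OF a_gr0] M.dif_closed M.a_comm)
  then show cyc: "v \<oplus>\<^bsub>N\<^esub> act N a u' \<in> cocycles N n"
    using xv u' by (auto simp: cocycles_def intro!: M.gr_add act_gr0_degree a_gr0)
  let ?y = "CPair \<zero>\<^bsub>N\<^esub> (v \<oplus>\<^bsub>N\<^esub> act N a u')"
  have "CPair u v \<ominus>\<^bsub>C\<^esub> ?y = CPair (\<ominus>\<^bsub>N\<^esub> dif N (\<ominus>\<^bsub>N\<^esub> u')) (act N a (\<ominus>\<^bsub>N\<^esub> u') \<oplus>\<^bsub>N\<^esub> dif N \<zero>\<^bsub>N\<^esub>)"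
    using c u' by (simp add: C.M.minus_eq cone_minus cone_simps M.dif_minus M.dif_closed act_minus_right
      a_carrier M.minus_add M.a_assoc[symmetric] M.r_neg)
  then have "CPair u v \<ominus>\<^bsub>C\<^esub> ?y \<in> cobounds C n"
    by (simp only:) (rule cone_coboundsI[OF M.gr_minus[OF u'(1)] M.gr_zero])
  then show "coh_class C n (CPair u v) = coh_class C n ?y"
    using C.M.coh_class_eq_iff[OF C.M.cocycles_carrier[OF x] C.M.cocycles_carrier[OF from_N_facts(1)[OF cyc]]]
    by simp
qed

lemma cone_exact:
  assumes "X \<in> carrier (coh C n)" "to_N n X = \<zero>\<^bsub>coh N (n + 1)\<^esub>"
  shows "X \<in> from_N n ` carrier (coh N n)"
proof -
  obtain x where x: "x \<in> cocycles C n" "X = coh_class C n x" using assms(1) by (auto simp: C.coh_carrier)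
  obtain u v where uv: "x = CPair u v" "u \<in> cocycles N (n + 1)" using x(1) by (rule cone_cocyclesE)
  have "coh_class N (n + 1) u = cobounds N (n + 1)"
    using assms(2) x uv to_N_class[OF x(1)] by (simp add: coh_zero)
  then have "u \<in> cobounds N (n + 1)"
    using M.coh_class_eq_zero_iff[OF M.cocycles_carrier[OF uv(2)]] by simp
  then obtain u' where u': "u' \<in> gr N n" "u = dif N u'" by (auto simp: cobounds_def)
  note r = cone_cocycle_reduce[OF x(1)[unfolded uv(1)] u']
  show ?thesis
    unfolding coh_carrier x(2) uv(1) r(2) from_N_class[OF r(1), symmetric] using r(1) by blast
qed

lemma from_N_kernel:
  assumes "Y \<in> carrier (coh N n)"
  shows "from_N n Y = \<zero>\<^bsub>coh C n\<^esub> \<longleftrightarrow> Y \<in> smult (coh N n) (coh_class A 0 a) ` carrier (coh N n)"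
proof -
  obtain y where y: "y \<in> cocycles N n" "Y = coh_class N n y" using assms by (auto simp: coh_carrier)
  have yc: "y \<in> carrier N" by (rule M.cocycles_carrier[OF y(1)])
  have "from_N n Y = \<zero>\<^bsub>coh C n\<^esub> \<longleftrightarrow> CPair \<zero>\<^bsub>N\<^esub> y \<in> cobounds C n"
    using y from_N_class C.M.coh_class_eq_zero_iff[OF C.M.cocycles_carrier[OF from_N_facts(1)[OF y(1)]]]
    by (simp add: C.coh_zero)
  also have "\<dots> \<longleftrightarrow> (\<exists>u \<in> cocycles N n. y \<ominus>\<^bsub>N\<^esub> act N a u \<in> cobounds N n)"
  proof
    assume "CPair \<zero>\<^bsub>N\<^esub> y \<in> cobounds C n"
    then obtain u v where u: "u \<in> gr N n" "v \<in> gr N (n - 1)" "\<zero>\<^bsub>N\<^esub> = \<ominus>\<^bsub>N\<^esub> dif N u" "y = act N a u \<oplus>\<^bsub>N\<^esub> dif N v"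
      by (auto simp: cone_cobounds)
    note c = M.gr_carrier[OF u(1)] M.gr_carrier[OF u(2)]
    have "dif N u = \<zero>\<^bsub>N\<^esub>" using u(3) c M.dif_closed M.add.inv_eq_1_iff by metis
    then have "u \<in> cocycles N n" using u by (simp add: cocycles_def)
    moreover have "y \<ominus>\<^bsub>N\<^esub> act N a u = dif N v"
      unfolding u(4) using c act_carrier[OF a_carrier] M.dif_closed
      by (simp add: M.minus_eq M.a_comm[of "act N a u"] M.a_assoc M.r_neg)
    ultimately show "\<exists>u \<in> cocycles N n. y \<ominus>\<^bsub>N\<^esub> act N a u \<in> cobounds N n"
      using u(2) by (auto simp: cobounds_def)
  next
    assume "\<exists>u \<in> cocycles N n. y \<ominus>\<^bsub>N\<^esub> act N a u \<in> cobounds N n"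
    then obtain u v where u: "u \<in> cocycles N n" "v \<in> gr N (n - 1)" "y \<ominus>\<^bsub>N\<^esub> act N a u = dif N v"
      by (auto simp: cobounds_def)
    have "act N a u \<oplus>\<^bsub>N\<^esub> dif N v = y"
      using yc act_carrier[OF a_carrier M.cocycles_carrier[OF u(1)]]
      by (simp add: u(3)[symmetric] M.minus_eq M.a_lcomm[of "act N a u"] M.r_neg)
    moreover have "\<ominus>\<^bsub>N\<^esub> dif N u = \<zero>\<^bsub>N\<^esub>" "u \<in> gr N n" using u(1) by (auto simp: cocycles_def)
    ultimately show "CPair \<zero>\<^bsub>N\<^esub> y \<in> cobounds C n"
      unfolding cone_cobounds using u(2) by metis
  qed
  also have "\<dots> \<longleftrightarrow> (\<exists>u \<in> cocycles N n. coh_class N n y = coh_class N n (act N a u))"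
    using M.coh_class_eq_iff[OF yc] act_carrier[OF a_carrier] M.cocycles_carrier by metis
  also have "\<dots> \<longleftrightarrow> Y \<in> smult (coh N n) (coh_class A 0 a) ` carrier (coh N n)"
  proof -
    have "smult (coh N n) (coh_class A 0 a) ` carrier (coh N n) = (\<lambda>u. coh_class N n (act N a u)) ` cocycles N n"
      by (simp add: coh_carrier image_image coh_smult[OF a_gr0] cong: image_cong_simp)
    then show ?thesis using y(2) by auto
  qed
  finally show ?thesis .
qed

lemma cone_coh_noetherian:
  assumes "\<And>n. noetherian_module (H0 A) (coh N n)"
  shows "noetherian_module (H0 A) (coh C n)"
  by (rule noetherian_module_exact[OF C.coh_module assms assms from_N_linear to_N_linear cone_exact])

text \<open>The first component of a cocycle of degree \<open>i - 1\<close> is a class in degree \<open>i\<close> of \<open>N\<close> that \<open>a\<close> kills;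
  this is where regularity enters.\<close>

lemma cone_coh_vanishes:
  assumes below: "\<And>k. k < i \<Longrightarrow> \<not> coh_nonzero N k"
    and reg: "inj_on (smult (coh N i) (coh_class A 0 a)) (carrier (coh N i))"
    and k: "k < i"
  shows "\<not> coh_nonzero C k"
proof
  interpret L: Module.module "H0 A" "coh N i" by (rule coh_module)
  assume "coh_nonzero C k"
  then obtain x where x: "x \<in> cocycles C k" "x \<notin> cobounds C k" by (auto simp: C.coh_nonzero_iff)
  obtain u v where uv: "x = CPair u v" "u \<in> cocycles N (k + 1)" "v \<in> gr N k"
    "act N a u \<oplus>\<^bsub>N\<^esub> dif N v = \<zero>\<^bsub>N\<^esub>" using x(1) by (rule cone_cocyclesE)
  have "u \<in> cobounds N (k + 1)"
  proof (cases "k + 1 < i")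
    case True
    then show ?thesis using below uv(2) coh_nonzero_iff by blast
  next
    case False
    then have k1: "k + 1 = i" using k by simp
    note c = M.cocycles_carrier[OF uv(2)] M.gr_carrier[OF uv(3)]
    have "act N a u = \<ominus>\<^bsub>N\<^esub> dif N v"
      using uv(4) c by (intro M.minus_equality[symmetric]) (simp_all add: act_carrier a_carrier M.dif_closed)
    then have "act N a u \<in> cobounds N (k + 1)"
      using M.cobounds_minus[OF M.dif_in_cobounds[OF uv(3)]] by simp
    then have "coh_class A 0 a \<odot>\<^bsub>coh N i\<^esub> coh_class N i u = \<zero>\<^bsub>coh N i\<^esub>"
      using uv(2) k1 coh_smult[OF a_gr0, of u i] M.coh_class_eq_zero_iff c act_carrier[OF a_carrier]
      by (simp add: coh_zero)
    moreover have "coh_class A 0 a \<in> carrier (H0 A)" using a_gr0 A.H0_carrier by blast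
    moreover have "coh_class N i u \<in> carrier (coh N i)" using uv(2) k1 coh_carrier by blast
    ultimately have "coh_class N i u = \<zero>\<^bsub>coh N i\<^esub>"
      using inj_onD[OF reg, of "coh_class N i u" "\<zero>\<^bsub>coh N i\<^esub>"] by simp
    then show ?thesis using M.coh_class_eq_zero_iff c k1 by (simp add: coh_zero)
  qed
  then obtain u' where u': "u' \<in> gr N k" "u = dif N u'" by (auto simp: cobounds_def)
  note r = cone_cocycle_reduce[OF x(1)[unfolded uv(1)] u']
  have "v \<oplus>\<^bsub>N\<^esub> act N a u' \<in> cobounds N k" using below[OF k] r(1) coh_nonzero_iff by blast
  then have "CPair \<zero>\<^bsub>N\<^esub> (v \<oplus>\<^bsub>N\<^esub> act N a u') \<in> cobounds C k" by (rule from_N_facts(3))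
  then have "CPair u v \<in> cobounds C k"
    using r(2) C.M.coh_class_eq_zero_iff C.M.cobounds_carrier C.M.cocycles_carrier x(1) uv(1) by metis
  then show False using x uv by simp
qed

end


section \<open>Regular sequences give chains of primes\<close>

text \<open>A finite infimum of integers is attained. Both \<open>dg_inf\<close> and \<open>depth\<close> are such infima.\<close>

lemma INF_int_eq_iff:
  "(INF n\<in>S. ereal (of_int n)) = ereal (of_int i) \<longleftrightarrow> i \<in> S \<and> (\<forall>n\<in>S. i \<le> n)"
proof
  assume eq: "(INF n\<in>S. ereal (of_int n)) = ereal (of_int i)"
  have le: "i \<le> n" if "n \<in> S" for n
  proof -
    have "ereal (of_int i) \<le> ereal (of_int n)" unfolding eq[symmetric] using that by (rule INF_lower)
    then show ?thesis by simp
  qed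
  moreover have "i \<in> S"
  proof (rule ccontr)
    assume "i \<notin> S"
    then have "i + 1 \<le> n" if "n \<in> S" for n using le[OF that] that by (cases "i = n") auto
    then have "ereal (of_int (i + 1)) \<le> (INF n\<in>S. ereal (of_int n))"
      by (intro INF_greatest) (simp del: of_int_add)
    then show False using eq by simp
  qed
  ultimately show "i \<in> S \<and> (\<forall>n\<in>S. i \<le> n)" by blast
next
  assume "i \<in> S \<and> (\<forall>n\<in>S. i \<le> n)"
  then show "(INF n\<in>S. ereal (of_int n)) = ereal (of_int i)"
    by (intro antisym INF_lower INF_greatest) auto
qed

lemma dg_inf_eq_iff:
  "dg_inf M = ereal (of_int i) \<longleftrightarrow> coh_nonzero M i \<and> (\<forall>n < i. \<not> coh_nonzero M n)"
  unfolding dg_inf_def INF_int_eq_iff using not_less by auto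

lemma assoc_primes_coh_nonzero:
  assumes M: "pre_dg_mod A M" and p: "p \<in> assoc_primes (H0 A) (coh M i)"
  shows "coh_nonzero M i"
proof -
  interpret M: pre_dg_mod A M by fact
  interpret L: Module.module "H0 A" "coh M i" by (rule M.coh_module)
  obtain z where z: "z \<in> carrier (coh M i)" "p = ann (H0 A) (coh M i) z" and p: "primeideal p (H0 A)"
    using p by (auto simp: assoc_primes_def)
  have "z \<noteq> \<zero>\<^bsub>coh M i\<^esub>"
  proof
    assume "z = \<zero>\<^bsub>coh M i\<^esub>"
    then have "p = carrier (H0 A)" using z by (auto simp: ann_def)
    then show False using primeideal.I_notcarr[OF p] by simp
  qed
  then show ?thesis using z(1) unfolding coh_nonzero_def by blast
qed

text \<open>Passing from \<open>N\<close> to the cone of a regular element keeps the infimum \<open>i\<close> and the chain condition on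
  cohomology, and replaces \<open>p\<close> by a strictly bigger associated prime, as the cohomology of the cone
  in degree \<open>i\<close> contains that of \<open>N\<close> modulo the element.\<close>

lemma regular_seq_prime_chain:
  assumes A: "noetherian_local_dg_ring A m"
  shows "\<lbrakk>pre_dg_mod A N; \<And>n. noetherian_module (H0 A) (coh N n); \<And>k. k < i \<Longrightarrow> \<not> coh_nonzero N k;
      p \<in> assoc_primes (H0 A) (coh N i); regular_seq A m xs N\<rbrakk>
    \<Longrightarrow> \<exists>P. P 0 = p \<and> (\<forall>j \<le> length xs. primeideal (P j) (H0 A)) \<and> (\<forall>j < length xs. P j \<subset> P (Suc j))"
proof (induction xs arbitrary: N p)
  case Nil
  then show ?case by (intro exI[of _ "\<lambda>_. p"]) (simp add: assoc_primes_def)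
next
  case (Cons x xs)
  interpret N: pre_dg_mod A N by (rule Cons.prems(1))
  have H0: "noetherian_ring (H0 A)" "maximalideal m (H0 A)" "\<And>J. maximalideal J (H0 A) \<Longrightarrow> J = m"
    using A by (auto simp: noetherian_local_dg_ring_def)
  interpret m: maximalideal m "H0 A" by (rule H0(2))
  \<comment> \<open>The representative of \<open>x\<close> on which \<open>koszul\<close> forms the cone.\<close>
  define a where "a = (SOME a. a \<in> x)"
  have x: "x \<in> m" "regular_elem N x" "regular_seq A m xs (cone A N a)"
    using Cons.prems(5) by (simp_all add: koszul_def a_def)
  have xc: "x \<in> carrier (H0 A)" using x(1) m.a_subset by auto
  then obtain b where b: "b \<in> gr A 0" "x = coh_class A 0 b" by (auto simp: N.A.H0_carrier)
  have "b \<in> x" using b N.A.C.coh_class_self N.A.C.gr_carrier by auto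
  then have "a \<in> x" unfolding a_def by (rule someI)
  note a = N.A.H0_rep[OF xc this]
  interpret cone_of A N a by unfold_locales (rule a(1))
  have "dg_inf N = ereal (of_int i)"
    using assoc_primes_coh_nonzero[OF Cons.prems(1,4)] Cons.prems(3) by (simp add: dg_inf_eq_iff)
  then have inj: "inj_on (smult (coh N i) x) (carrier (coh N i))"
    using x(2) by (simp add: regular_elem_def)
  obtain q where q: "q \<in> assoc_primes (H0 A) (coh C i)" "p \<subset> q"
    using assoc_prime_mod_regular[OF H0 Cons.prems(2) C.coh_module x(1) inj from_N_linear _ Cons.prems(4)]
      from_N_kernel[of _ i] a(2) by auto
  have "\<exists>P. P 0 = q \<and> (\<forall>j \<le> length xs. primeideal (P j) (H0 A)) \<and> (\<forall>j < length xs. P j \<subset> P (Suc j))"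
    by (rule Cons.IH[OF cone_pre_dg_mod cone_coh_noetherian[OF Cons.prems(2)] cone_coh_vanishes q(1) x(3)])
      (use Cons.prems(3) inj a(2) in auto)
  then obtain P where P: "P 0 = q" "\<And>j. j \<le> length xs \<Longrightarrow> primeideal (P j) (H0 A)"
    "\<And>j. j < length xs \<Longrightarrow> P j \<subset> P (Suc j)" by blast
  have pp: "primeideal p (H0 A)" using Cons.prems(4) by (simp add: assoc_primes_def)
  show ?case
  proof (intro exI[of _ "case_nat p P"] conjI allI impI)
    fix j assume "j \<le> length (x # xs)"
    then show "primeideal (case j of 0 \<Rightarrow> p | Suc k \<Rightarrow> P k) (H0 A)" using P(2) pp by (cases j) auto
  next
    fix j assume "j < length (x # xs)"
    then show "(case j of 0 \<Rightarrow> p | Suc k \<Rightarrow> P k) \<subset> (case Suc j of 0 \<Rightarrow> p | Suc k \<Rightarrow> P k)"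
      using P(1,3) q(2) by (cases j) auto
  qed simp
qed

lemma seq_depth_le_krull_dim_assoc:
  assumes A: "noetherian_local_dg_ring A m" and M: "D_plus_f A M"
    and below: "\<And>k. k < i \<Longrightarrow> \<not> coh_nonzero M k"
    and p: "p \<in> assoc_primes (H0 A) (coh M i)"
  shows "seq_depth A m M \<le> krull_dim (H0 A Quot p)"
proof -
  interpret M: dg_mod A M using M by (simp add: D_plus_f_def)
  note M' = M.pre_dg_mod_axioms
  note e = embed_coh_map[OF M']
  interpret E: pre_dg_mod A "embed M" by (rule embed_pre_dg_mod[OF M'])
  have H0: "noetherian_ring (H0 A)" using A by (simp add: noetherian_local_dg_ring_def)
  have noeth: "noetherian_module (H0 A) (coh M n)" for n
    using M by (intro module.fin_gen_imp_noetherian[OF M.coh_module H0]) (simp add: D_plus_f_def)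
  have noethE: "noetherian_module (H0 A) (coh (embed M) n)" for n
  proof (rule noetherian_module_exact[OF E.coh_module noeth noeth e(1)])
    interpret L: Module.module "H0 A" "coh M n" by (rule M.coh_module)
    \<comment> \<open>Exactness with the zero map on the right is surjectivity on the left.\<close>
    show "linear_map (H0 A) (coh (embed M) n) (coh M n) (\<lambda>_. \<zero>\<^bsub>coh M n\<^esub>)"
      by (simp add: linear_map_def)
    show "x \<in> coh_map (embed M) n Base ` carrier (coh M n)" if "x \<in> carrier (coh (embed M) n)" for x
      using that e(2)[of n] by (simp add: bij_betw_def)
  qed
  have belowE: "\<not> coh_nonzero (embed M) k" if "k < i" for k
    using below[OF that] by (auto simp: E.coh_nonzero_iff M.coh_nonzero_iff embed_cocycles embed_cobounds)
  have pE: "p \<in> assoc_primes (H0 A) (coh (embed M) i)"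
    using p assoc_primes_injective[OF M.coh_module E.coh_module e(1)] e(2)[of i] by (auto simp: bij_betw_def)
  show ?thesis
    unfolding seq_depth_def
  proof (rule SUP_least)
    fix xs assume "xs \<in> {xs. regular_seq A m xs (embed M)}"
    then have "regular_seq A m xs (embed M)" by simp
    with regular_seq_prime_chain[OF A E.pre_dg_mod_axioms noethE belowE pE]
    have "\<exists>P. P 0 = p \<and> (\<forall>j \<le> length xs. primeideal (P j) (H0 A)) \<and> (\<forall>j < length xs. P j \<subset> P (Suc j))"
      by blast
    then obtain P where P: "P 0 = p" "\<forall>j \<le> length xs. primeideal (P j) (H0 A)" "\<forall>j < length xs. P j \<subset> P (Suc j)"
      by (elim exE conjE)
    show "enat (length xs) \<le> krull_dim (H0 A Quot p)"
      using cring.prime_chain_krull_dim_quotient[OF M.A.H0_cring, of "length xs" P] P by auto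
  qed
qed


section \<open>Linear combinations and homogeneous maps\<close>

lemma (in abelian_group) diff_eq_zero_iff:
  assumes "x \<in> carrier G" "y \<in> carrier G"
  shows "x \<ominus> y = \<zero> \<longleftrightarrow> x = y"
proof
  assume "x \<ominus> y = \<zero>"
  then have "(x \<ominus> y) \<oplus> y = y" using assms by simp
  then show "x = y" using assms by (simp add: minus_eq a_assoc l_neg)
qed (use assms in \<open>simp add: minus_eq r_neg\<close>)

lemma (in abelian_group) add_minus_self:
  "\<lbrakk>x \<in> carrier G; y \<in> carrier G\<rbrakk> \<Longrightarrow> x \<oplus> (y \<oplus> \<ominus> x) = y"
  by (simp add: a_lcomm[of x y] r_neg)

definition lin_sum :: "('a, 'z) dg_scheme \<Rightarrow> ('a, 'm, 'y) dg_module_scheme \<Rightarrow> ('p \<Rightarrow> 'a) \<Rightarrow> ('p \<Rightarrow> 'm) \<Rightarrow> 'm" where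
  "lin_sum A M c e = (\<Oplus>\<^bsub>M\<^esub>b \<in> {b. c b \<noteq> \<zero>\<^bsub>A\<^esub>}. act M (c b) (e b))"

definition coeffs :: "('a, 'z) dg_scheme \<Rightarrow> 'p set \<Rightarrow> ('p \<Rightarrow> 'a) \<Rightarrow> bool" where
  "coeffs A B c \<longleftrightarrow> (\<forall>b \<in> B. c b \<in> carrier A) \<and> (\<forall>b. b \<notin> B \<longrightarrow> c b = \<zero>\<^bsub>A\<^esub>) \<and> finite {b. c b \<noteq> \<zero>\<^bsub>A\<^esub>}"

lemma lin_comb_iff: "lin_comb A P B c x \<longleftrightarrow> coeffs A B c \<and> x = lin_sum A P c (\<lambda>b. b)"
  by (auto simp: lin_comb_def coeffs_def lin_sum_def)

text \<open>\<open>twist A k a\<close> is $(-1)^{k |a|} a$ for homogeneous \<open>a\<close>; it describes how a map of degree \<open>k\<close> passes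
  an arbitrary, possibly inhomogeneous, scalar.\<close>

definition twist :: "('a, 'z) dg_scheme \<Rightarrow> int \<Rightarrow> 'a \<Rightarrow> 'a" where
  "twist A k a = (if even k then a else sign_aut A a)"

context dg_ring
begin

lemma twist_closed: "a \<in> carrier A \<Longrightarrow> twist A k a \<in> carrier A"
  by (simp add: twist_def sign_aut_closed)

lemma twist_zero [simp]: "twist A k \<zero> = \<zero>"
  by (simp add: twist_def)

lemma twist_add: "\<lbrakk>a \<in> carrier A; b \<in> carrier A\<rbrakk> \<Longrightarrow> twist A k (a \<oplus> b) = twist A k a \<oplus> twist A k b"
  by (simp add: twist_def sign_aut_add)

lemma twist_mult: "\<lbrakk>a \<in> carrier A; b \<in> carrier A\<rbrakk> \<Longrightarrow> twist A k (a \<otimes> b) = twist A k a \<otimes> twist A k b"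
  by (simp add: twist_def sign_aut_mult)

lemma twist_homog: "a \<in> gr A i \<Longrightarrow> twist A k a = signed A (k * i) a"
  by (auto simp: twist_def sign_aut_homog signed_def)

lemma twist_gr: "a \<in> gr A i \<Longrightarrow> twist A k a \<in> gr A i"
  by (simp add: twist_homog signed_gr)

lemma coeffs_carrier: "coeffs A B c \<Longrightarrow> c b \<in> carrier A"
  by (cases "b \<in> B") (auto simp: coeffs_def)

lemma coeffs_map:
  assumes "coeffs A B c" "f \<zero> = \<zero>" "\<And>a. a \<in> carrier A \<Longrightarrow> f a \<in> carrier A"
  shows "coeffs A B (\<lambda>b. f (c b))"
proof -
  have "{b. f (c b) \<noteq> \<zero>} \<subseteq> {b. c b \<noteq> \<zero>}" using assms(2) by auto
  then show ?thesis using assms finite_subset by (auto simp: coeffs_def)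
qed

lemma coeffs_add:
  assumes "coeffs A B c" "coeffs A B d"
  shows "coeffs A B (\<lambda>b. c b \<oplus> d b)"
proof -
  have "{b. c b \<oplus> d b \<noteq> \<zero>} \<subseteq> {b. c b \<noteq> \<zero>} \<union> {b. d b \<noteq> \<zero>}" by auto
  then show ?thesis using assms finite_subset[OF _ finite_UnI] by (auto simp: coeffs_def)
qed

lemma coeffs_single: "\<lbrakk>b \<in> B; r \<in> carrier A\<rbrakk> \<Longrightarrow> coeffs A B (\<lambda>b'. if b' = b then r else \<zero>)"
  by (auto simp: coeffs_def)

lemma coeffs_mono: "\<lbrakk>coeffs A B c; B \<subseteq> B'\<rbrakk> \<Longrightarrow> coeffs A B' c"
  unfolding coeffs_def by (metis subsetD zero_closed)

end

context pre_dg_mod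
begin

lemma lin_sum_superset:
  assumes "coeffs A B c" "\<And>b. b \<in> B \<Longrightarrow> e b \<in> carrier M" "finite T" "{b. c b \<noteq> \<zero>\<^bsub>A\<^esub>} \<subseteq> T" "T \<subseteq> B"
  shows "lin_sum A M c e = (\<Oplus>\<^bsub>M\<^esub>b \<in> T. act M (c b) (e b))"
proof -
  have "e b \<in> carrier M" if "b \<in> T" for b using that assms(2,5) by auto
  then show ?thesis
    unfolding lin_sum_def using assms(3,4) A.coeffs_carrier[OF assms(1)]
    by (intro M.add.finprod_mono_neutral_cong_left) (auto simp: act_zero_left act_carrier)
qed

lemma coeffs_support: "coeffs A B c \<Longrightarrow> {b. c b \<noteq> \<zero>\<^bsub>A\<^esub>} \<subseteq> B" "coeffs A B c \<Longrightarrow> finite {b. c b \<noteq> \<zero>\<^bsub>A\<^esub>}"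
  by (auto simp: coeffs_def)

lemma lin_sum_closed:
  assumes "coeffs A B c" "\<And>b. b \<in> B \<Longrightarrow> e b \<in> carrier M"
  shows "lin_sum A M c e \<in> carrier M"
  unfolding lin_sum_def using assms A.coeffs_carrier[OF assms(1)] coeffs_support(1)[OF assms(1)]
  by (intro M.finsum_closed) (auto intro!: act_carrier)

lemma lin_sum_add:
  assumes c: "coeffs A B c" and d: "coeffs A B d" and e: "\<And>b. b \<in> B \<Longrightarrow> e b \<in> carrier M"
  shows "lin_sum A M (\<lambda>b. c b \<oplus>\<^bsub>A\<^esub> d b) e = lin_sum A M c e \<oplus>\<^bsub>M\<^esub> lin_sum A M d e"
proof -
  let ?T = "{b. c b \<noteq> \<zero>\<^bsub>A\<^esub>} \<union> {b. d b \<noteq> \<zero>\<^bsub>A\<^esub>}"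
  have T: "finite ?T" "?T \<subseteq> B" using c d by (auto simp: coeffs_def)
  note cc = A.coeffs_carrier[OF c] A.coeffs_carrier[OF d]
  have e': "e b \<in> carrier M" if "b \<in> ?T" for b using that T(2) e by blast
  have "lin_sum A M (\<lambda>b. c b \<oplus>\<^bsub>A\<^esub> d b) e = (\<Oplus>\<^bsub>M\<^esub>b \<in> ?T. act M (c b \<oplus>\<^bsub>A\<^esub> d b) (e b))"
    by (rule lin_sum_superset[OF A.coeffs_add[OF c d] e T(1) _ T(2)]) auto
  also have "\<dots> = (\<Oplus>\<^bsub>M\<^esub>b \<in> ?T. act M (c b) (e b) \<oplus>\<^bsub>M\<^esub> act M (d b) (e b))"
    using cc e' by (intro M.finsum_cong') (auto simp: act_add_left act_carrier)
  also have "\<dots> = (\<Oplus>\<^bsub>M\<^esub>b \<in> ?T. act M (c b) (e b)) \<oplus>\<^bsub>M\<^esub> (\<Oplus>\<^bsub>M\<^esub>b \<in> ?T. act M (d b) (e b))"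
    using cc e' by (intro M.finsum_addf) (auto simp: act_carrier)
  also have "\<dots> = lin_sum A M c e \<oplus>\<^bsub>M\<^esub> lin_sum A M d e"
    using lin_sum_superset[OF c e T(1) _ T(2)] lin_sum_superset[OF d e T(1) _ T(2)] by auto
  finally show ?thesis .
qed

lemma act_finsum:
  assumes "finite T" "\<And>b. b \<in> T \<Longrightarrow> g b \<in> carrier M" "a \<in> carrier A"
  shows "act M a (\<Oplus>\<^bsub>M\<^esub>b \<in> T. g b) = (\<Oplus>\<^bsub>M\<^esub>b \<in> T. act M a (g b))"
  using assms(1,2)
proof (induction T rule: finite_induct)
  case empty
  then show ?case using assms(3) by (simp add: act_zero_right)
next
  case (insert t T)
  then show ?case using assms(3) by (simp add: Pi_def act_carrier act_add_right)
qed

lemma lin_sum_act: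
  assumes c: "coeffs A B c" and e: "\<And>b. b \<in> B \<Longrightarrow> e b \<in> carrier M" and a: "a \<in> carrier A"
  shows "lin_sum A M (\<lambda>b. a \<otimes>\<^bsub>A\<^esub> c b) e = act M a (lin_sum A M c e)"
proof -
  let ?T = "{b. c b \<noteq> \<zero>\<^bsub>A\<^esub>}"
  note T = coeffs_support[OF c]
  note cc = A.coeffs_carrier[OF c]
  have e': "e b \<in> carrier M" if "b \<in> ?T" for b using that T(1) e by blast
  have "lin_sum A M (\<lambda>b. a \<otimes>\<^bsub>A\<^esub> c b) e = (\<Oplus>\<^bsub>M\<^esub>b \<in> ?T. act M (a \<otimes>\<^bsub>A\<^esub> c b) (e b))"
    by (rule lin_sum_superset[OF A.coeffs_map[OF c] e T(2) _ T(1)]) (use a in auto)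
  also have "\<dots> = (\<Oplus>\<^bsub>M\<^esub>b \<in> ?T. act M a (act M (c b) (e b)))"
    using cc e' a by (intro M.finsum_cong') (auto simp: act_mult act_carrier)
  also have "\<dots> = act M a (\<Oplus>\<^bsub>M\<^esub>b \<in> ?T. act M (c b) (e b))"
    using cc e' a T(2) by (intro act_finsum[symmetric]) (auto simp: act_carrier)
  finally show ?thesis unfolding lin_sum_def .
qed

lemma lin_sum_single:
  assumes "b \<in> B" "r \<in> carrier A" "\<And>b. b \<in> B \<Longrightarrow> e b \<in> carrier M"
  shows "lin_sum A M (\<lambda>b'. if b' = b then r else \<zero>\<^bsub>A\<^esub>) e = act M r (e b)"
proof -
  have "lin_sum A M (\<lambda>b'. if b' = b then r else \<zero>\<^bsub>A\<^esub>) e = (\<Oplus>\<^bsub>M\<^esub>b' \<in> {b}. act M (if b' = b then r else \<zero>\<^bsub>A\<^esub>) (e b'))"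
    by (rule lin_sum_superset[OF A.coeffs_single[OF assms(1,2)] assms(3)]) (use assms(1) in auto)
  then show ?thesis using assms act_carrier by simp
qed

lemma lin_sum_cong:
  assumes "coeffs A B c" "\<And>b. b \<in> B \<Longrightarrow> e b = e' b" "\<And>b. b \<in> B \<Longrightarrow> e' b \<in> carrier M"
  shows "lin_sum A M c e = lin_sum A M c e'"
  unfolding lin_sum_def
  using assms coeffs_support(1)[OF assms(1)] A.coeffs_carrier[OF assms(1)]
  by (intro M.finsum_cong') (auto intro!: act_carrier simp: subset_iff)

end

text \<open>A DG-submodule is given by its homogeneous parts, so that the target of a map can be cut down or
  divided out without changing the module in which everything is computed.\<close>

definition graded_submodule :: "('a, 'z) dg_scheme \<Rightarrow> ('a, 'm, 'y) dg_module_scheme \<Rightarrow> (int \<Rightarrow> 'm set) \<Rightarrow> bool" where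
  "graded_submodule A M V \<longleftrightarrow> (\<forall>n. V n \<subseteq> gr M n \<and> \<zero>\<^bsub>M\<^esub> \<in> V n \<and> (\<forall>x \<in> V n. \<forall>y \<in> V n. x \<oplus>\<^bsub>M\<^esub> y \<in> V n)) \<and>
     (\<forall>i n. \<forall>a \<in> gr A i. \<forall>x \<in> V n. act M a x \<in> V (i + n))"

lemma graded_submoduleD:
  assumes "graded_submodule A M V"
  shows "x \<in> V n \<Longrightarrow> x \<in> gr M n" "\<zero>\<^bsub>M\<^esub> \<in> V n" "\<lbrakk>x \<in> V n; y \<in> V n\<rbrakk> \<Longrightarrow> x \<oplus>\<^bsub>M\<^esub> y \<in> V n"
    "\<lbrakk>a \<in> gr A i; x \<in> V n\<rbrakk> \<Longrightarrow> act M a x \<in> V (i + n)"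
  using assms by (auto simp: graded_submodule_def)

context pre_dg_mod
begin

lemma graded_submodule_gr: "graded_submodule A M (gr M)"
  by (auto simp: graded_submodule_def M.gr_add act_degree)

lemma graded_submodule_minus:
  assumes V: "graded_submodule A M V" and x: "x \<in> V n"
  shows "\<ominus>\<^bsub>M\<^esub> x \<in> V n"
proof -
  have xc: "x \<in> carrier M" using graded_submoduleD(1)[OF V x] M.gr_carrier by blast
  have "act M (\<ominus>\<^bsub>A\<^esub> \<one>\<^bsub>A\<^esub>) x \<in> V (0 + n)"
    by (rule graded_submoduleD(4)[OF V A.C.gr_minus[OF A.one_gr] x])
  then show ?thesis using xc by (simp add: act_minus_left act_unit)
qed

lemma graded_submodule_signed: "\<lbrakk>graded_submodule A M V; x \<in> V n\<rbrakk> \<Longrightarrow> signed M k x \<in> V n"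
  by (simp add: signed_def graded_submodule_minus)

lemma lin_sum_in_graded_submodule:
  assumes V: "graded_submodule A M V" and c: "coeffs A B c"
    and e: "\<And>b. b \<in> B \<Longrightarrow> c b \<noteq> \<zero>\<^bsub>A\<^esub> \<Longrightarrow> \<exists>i k. i + k = n \<and> c b \<in> gr A i \<and> e b \<in> V k"
  shows "lin_sum A M c e \<in> V n"
proof -
  have "(\<Oplus>\<^bsub>M\<^esub>b \<in> T. act M (c b) (e b)) \<in> V n" if "finite T" "T \<subseteq> {b. c b \<noteq> \<zero>\<^bsub>A\<^esub>}" for T
    using that
  proof (induction T rule: finite_induct)
    case empty
    then show ?case using graded_submoduleD(2)[OF V] by simp
  next
    case (insert t T)
    have t: "act M (c b) (e b) \<in> V n" if b: "b \<in> insert t T" for b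
    proof -
      have "b \<in> B" "c b \<noteq> \<zero>\<^bsub>A\<^esub>" using b insert(4) coeffs_support(1)[OF c] by auto
      then obtain i k where ik: "i + k = n" "c b \<in> gr A i" "e b \<in> V k" using e by metis
      then show ?thesis using graded_submoduleD(4)[OF V ik(2,3)] by simp
    qed
    then have "act M (c b) (e b) \<in> carrier M" if "b \<in> insert t T" for b
      using that graded_submoduleD(1)[OF V] M.gr_carrier by blast
    then have "(\<Oplus>\<^bsub>M\<^esub>b \<in> insert t T. act M (c b) (e b)) = act M (c t) (e t) \<oplus>\<^bsub>M\<^esub> (\<Oplus>\<^bsub>M\<^esub>b \<in> T. act M (c b) (e b))"
      using insert(1,2) by (intro M.finsum_insert) auto
    then show ?case using t insert graded_submoduleD(3)[OF V] by auto
  qed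
  then show ?thesis unfolding lin_sum_def using coeffs_support(2)[OF c] by blast
qed

end


section \<open>The Hom complex\<close>

lemma hom_grD:
  assumes "f \<in> hom_gr A P M n"
  shows "x \<in> carrier P \<Longrightarrow> f x \<in> carrier M"
    "\<lbrakk>x \<in> carrier P; y \<in> carrier P\<rbrakk> \<Longrightarrow> f (x \<oplus>\<^bsub>P\<^esub> y) = f x \<oplus>\<^bsub>M\<^esub> f y"
    "x \<in> gr P i \<Longrightarrow> f x \<in> gr M (i + n)"
    "\<lbrakk>a \<in> gr A i; x \<in> carrier P\<rbrakk> \<Longrightarrow> f (act P a x) = signed M (n * i) (act M a (f x))"
    "f \<in> extensional (carrier P)"
  using assms by (auto simp: hom_gr_def PiE_def)

locale hom_complex = P?: dg_mod A P + M?: pre_dg_mod A M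
  for A :: "('a, 'z) dg_scheme" and P :: "('a, 'p, 'x) dg_module_scheme"
    and M :: "('a, 'm, 'y) dg_module_scheme"
begin

lemma hom_zero:
  assumes f: "f \<in> hom_gr A P M n"
  shows "f \<zero>\<^bsub>P\<^esub> = \<zero>\<^bsub>M\<^esub>"
  using hom_grD(2)[OF f, of "\<zero>\<^bsub>P\<^esub>" "\<zero>\<^bsub>P\<^esub>"] hom_grD(1)[OF f, of "\<zero>\<^bsub>P\<^esub>"] M.M.add.r_cancel_one' by force

lemma hom_minus:
  assumes f: "f \<in> hom_gr A P M n" and x: "x \<in> carrier P"
  shows "f (\<ominus>\<^bsub>P\<^esub> x) = \<ominus>\<^bsub>M\<^esub> f x"
proof -
  have "f (\<ominus>\<^bsub>P\<^esub> x) \<oplus>\<^bsub>M\<^esub> f x = \<zero>\<^bsub>M\<^esub>"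
    using hom_grD(2)[OF f, of "\<ominus>\<^bsub>P\<^esub> x" x] x hom_zero[OF f] by (simp add: P.M.l_neg)
  then show ?thesis using x hom_grD(1)[OF f] by (simp add: M.M.minus_equality)
qed

lemma hom_diff: "\<lbrakk>f \<in> hom_gr A P M n; x \<in> carrier P; y \<in> carrier P\<rbrakk> \<Longrightarrow> f (x \<ominus>\<^bsub>P\<^esub> y) = f x \<ominus>\<^bsub>M\<^esub> f y"
  by (simp add: P.M.minus_eq M.M.minus_eq hom_grD(2) hom_minus)

lemma hom_signed: "\<lbrakk>f \<in> hom_gr A P M n; x \<in> carrier P\<rbrakk> \<Longrightarrow> f (signed P k x) = signed M k (f x)"
  by (simp add: signed_def hom_minus)

lemma hom_twist:
  assumes f: "f \<in> hom_gr A P M n" and a: "a \<in> carrier A" and x: "x \<in> carrier P"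
  shows "f (act P a x) = act M (twist A n a) (f x)"
  using a
proof (induction a rule: P.A.C.homogeneous_induct)
  case zero
  then show ?case using f x by (simp add: P.act_zero_left M.act_zero_left hom_zero hom_grD(1)[OF f])
next
  case (add a b)
  then show ?case
    using f x by (simp add: P.act_add_left M.act_add_left hom_grD(1,2)[OF f] P.act_carrier P.A.twist_add P.A.twist_closed)
next
  case (homogeneous i a)
  then show ?case
    using x hom_grD(1)[OF f] hom_grD(4)[OF f]
    by (simp add: P.A.twist_homog M.act_signed_left P.A.C.gr_carrier)
qed

lemma hom_lin_sum:
  assumes f: "f \<in> hom_gr A P M n" and c: "coeffs A B c" and B: "B \<subseteq> carrier P"
  shows "f (lin_sum A P c (\<lambda>b. b)) = lin_sum A M (\<lambda>b. twist A n (c b)) f"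
proof -
  have cc: "c b \<in> carrier A" for b by (rule P.A.coeffs_carrier[OF c])
  let ?S = "{b. c b \<noteq> \<zero>\<^bsub>A\<^esub>}"
  have S: "finite ?S" "?S \<subseteq> carrier P" using P.coeffs_support[OF c] B by auto
  have "f (\<Oplus>\<^bsub>P\<^esub>b \<in> T. act P (c b) b) = (\<Oplus>\<^bsub>M\<^esub>b \<in> T. act M (twist A n (c b)) (f b))"
    if "finite T" "T \<subseteq> carrier P" for T
    using that
  proof (induction T rule: finite_induct)
    case empty
    then show ?case using hom_zero[OF f] by simp
  next
    case (insert t T)
    have 1: "(\<Oplus>\<^bsub>P\<^esub>b \<in> insert t T. act P (c b) b) = act P (c t) t \<oplus>\<^bsub>P\<^esub> (\<Oplus>\<^bsub>P\<^esub>b \<in> T. act P (c b) b)"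
      using insert cc by (intro P.M.finsum_insert) (auto intro!: P.act_carrier)
    have 2: "(\<Oplus>\<^bsub>M\<^esub>b \<in> insert t T. act M (twist A n (c b)) (f b)) =
        act M (twist A n (c t)) (f t) \<oplus>\<^bsub>M\<^esub> (\<Oplus>\<^bsub>M\<^esub>b \<in> T. act M (twist A n (c b)) (f b))"
      using insert cc by (intro M.M.finsum_insert) (auto intro!: M.act_carrier P.A.twist_closed hom_grD(1)[OF f])
    have "(\<Oplus>\<^bsub>P\<^esub>b \<in> T. act P (c b) b) \<in> carrier P"
      using insert cc by (intro P.M.finsum_closed) (auto intro!: P.act_carrier)
    then show ?case
      unfolding 1 2 using insert cc by (simp add: hom_grD(2)[OF f] P.act_carrier hom_twist[OF f])
  qed
  from this[OF S] have "f (lin_sum A P c (\<lambda>b. b)) = (\<Oplus>\<^bsub>M\<^esub>b \<in> ?S. act M (twist A n (c b)) (f b))"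
    by (simp add: lin_sum_def)
  also have "\<dots> = lin_sum A M (\<lambda>b. twist A n (c b)) f"
    by (rule M.lin_sum_superset[OF P.A.coeffs_map[OF c], symmetric])
      (use P.coeffs_support[OF c] B hom_grD(1)[OF f] P.A.twist_closed in auto)
  finally show ?thesis .
qed

lemma hom_dif_apply: "x \<in> carrier P \<Longrightarrow> hom_dif P M n f x = dif M (f x) \<ominus>\<^bsub>M\<^esub> signed M n (f (dif P x))"
  by (simp add: hom_dif_def)

lemma hom_dif_closed:
  assumes f: "f \<in> hom_gr A P M n"
  shows "hom_dif P M n f \<in> hom_gr A P M (n + 1)"
  unfolding hom_gr_def
proof (intro CollectI conjI ballI allI)
  note fc = hom_grD(1)[OF f]
  show "hom_dif P M n f \<in> carrier P \<rightarrow>\<^sub>E carrier M"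
    by (auto simp: hom_dif_def fc P.M.dif_closed M.M.dif_closed)
  fix x y assume "x \<in> carrier P" "y \<in> carrier P"
  then show "hom_dif P M n f (x \<oplus>\<^bsub>P\<^esub> y) = hom_dif P M n f x \<oplus>\<^bsub>M\<^esub> hom_dif P M n f y"
    by (simp add: hom_dif_apply hom_grD(2)[OF f] P.M.dif_distrib M.M.dif_distrib P.M.dif_closed M.M.dif_closed
        fc M.M.signed_add M.M.minus_eq M.M.minus_add M.M.a_ac)
next
  fix i x assume x: "x \<in> gr P i"
  have "f (dif P x) \<in> gr M (i + (n + 1))" "dif M (f x) \<in> gr M (i + (n + 1))"
    using hom_grD(3)[OF f P.M.dif_degree[OF x]] M.M.dif_degree[OF hom_grD(3)[OF f x]]
    by (simp_all add: algebra_simps)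
  then show "hom_dif P M n f x \<in> gr M (i + (n + 1))"
    using x by (simp add: hom_dif_apply P.M.gr_carrier M.M.gr_diff M.M.signed_gr)
next
  note fc = hom_grD(1)[OF f]
  fix i a x assume a: "a \<in> gr A i" and x: "x \<in> carrier P"
  have ac: "a \<in> carrier A" "dif A a \<in> carrier A" using a P.A.C.gr_carrier P.A.C.dif_closed by auto
  have dx: "dif P x \<in> carrier P" using x by (rule P.M.dif_closed)
  let ?u = "act M (dif A a) (f x)" and ?v = "act M a (dif M (f x))" and ?w = "act M a (f (dif P x))"
  have c: "?u \<in> carrier M" "?v \<in> carrier M" "?w \<in> carrier M"
    using ac x dx fc M.M.dif_closed by (auto intro!: M.act_carrier)
  have 1: "dif M (f (act P a x)) = signed M (n * i) (?u \<oplus>\<^bsub>M\<^esub> signed M i ?v)"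
    using a x ac fc by (simp add: hom_grD(4)[OF f a] M.M.dif_signed M.act_carrier M.dif_act[OF a])
  have 2: "f (dif P (act P a x)) = signed M (n * (i + 1)) ?u \<oplus>\<^bsub>M\<^esub> signed M i (signed M (n * i) ?w)"
    using a x ac dx
    by (simp add: P.dif_act[OF a] hom_grD(2)[OF f] hom_grD(4)[OF f P.A.C.dif_degree[OF a]] P.act_carrier
        hom_signed[OF f] hom_grD(4)[OF f a])
  have 3: "act M a (hom_dif P M n f x) = ?v \<ominus>\<^bsub>M\<^esub> signed M n ?w"
    using a x ac dx fc by (simp add: hom_dif_apply M.act_diff_right M.act_signed_right M.M.dif_closed)
  have "hom_dif P M n f (act P a x) = signed M (n * i) (?u \<oplus>\<^bsub>M\<^esub> signed M i ?v) \<ominus>\<^bsub>M\<^esub>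
      signed M n (signed M (n * (i + 1)) ?u \<oplus>\<^bsub>M\<^esub> signed M i (signed M (n * i) ?w))"
    using ac x by (simp add: hom_dif_apply P.act_carrier 1 2)
  also have "\<dots> = signed M ((n + 1) * i) (?v \<ominus>\<^bsub>M\<^esub> signed M n ?w)"
    using c by (cases "even n"; cases "even i")
      (simp_all add: signed_def M.M.minus_eq M.M.minus_add M.M.a_ac M.M.r_neg M.M.add_minus_self)
  finally show "hom_dif P M n f (act P a x) = signed M ((n + 1) * i) (act M a (hom_dif P M n f x))"
    unfolding 3 .
qed

lemma hom_dif_square:
  assumes f: "f \<in> hom_gr A P M n" and x: "x \<in> carrier P"
  shows "hom_dif P M (n + 1) (hom_dif P M n f) x = \<zero>\<^bsub>M\<^esub>"
proof -
  note fc = hom_grD(1)[OF f]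
  have c: "dif P x \<in> carrier P" "f (dif P x) \<in> carrier M" "dif M (f (dif P x)) \<in> carrier M"
    "dif M (f x) \<in> carrier M" using x fc P.M.dif_closed M.M.dif_closed by auto
  show ?thesis
    using c x fc
    by (simp add: hom_dif_apply P.M.dif_square M.M.dif_square hom_zero[OF f] M.M.dif_diff M.M.dif_signed)
      (simp add: signed_def M.M.minus_eq M.M.l_neg M.M.r_neg)
qed

lemma hom_cobounds_subset_cocycles: "hom_cobounds A P M n \<subseteq> hom_cocycles A P M n"
proof
  fix g assume "g \<in> hom_cobounds A P M n"
  then obtain f where f: "f \<in> hom_gr A P M (n - 1)" "g = hom_dif P M (n - 1) f" by (auto simp: hom_cobounds_def)
  have "g \<in> hom_gr A P M n" using hom_dif_closed[OF f(1)] f(2) by simp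
  moreover have "hom_dif P M n g = (\<lambda>x \<in> carrier P. \<zero>\<^bsub>M\<^esub>)"
    using hom_dif_square[OF f(1)] f(2) by (intro extensionalityI[of _ "carrier P"]) (auto simp: hom_dif_def)
  ultimately show "g \<in> hom_cocycles A P M n" by (simp add: hom_cocycles_def)
qed

lemma hom_cocycleD:
  assumes f: "f \<in> hom_cocycles A P M n"
  shows "f \<in> hom_gr A P M n" "x \<in> carrier P \<Longrightarrow> dif M (f x) = signed M n (f (dif P x))"
proof -
  show fg: "f \<in> hom_gr A P M n" using f by (simp add: hom_cocycles_def)
  show "dif M (f x) = signed M n (f (dif P x))" if x: "x \<in> carrier P"
  proof -
    have "hom_dif P M n f x = \<zero>\<^bsub>M\<^esub>" using f x by (simp add: hom_cocycles_def)
    then show ?thesis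
      using x hom_grD(1)[OF fg] by (simp add: hom_dif_apply P.M.dif_closed M.M.dif_closed M.M.diff_eq_zero_iff)
  qed
qed

lemma hom_add_closed:
  assumes f: "f \<in> hom_gr A P M n" and g: "g \<in> hom_gr A P M n"
  shows "(\<lambda>x \<in> carrier P. f x \<oplus>\<^bsub>M\<^esub> g x) \<in> hom_gr A P M n"
  unfolding hom_gr_def
  using hom_grD[OF f] hom_grD[OF g]
  by (auto simp: P.act_carrier P.M.gr_carrier M.M.gr_add M.M.a_ac M.M.signed_add M.act_add_right
      M.act_carrier P.A.C.gr_carrier)

lemma hom_signed_closed:
  assumes f: "f \<in> hom_gr A P M n"
  shows "(\<lambda>x \<in> carrier P. signed M k (f x)) \<in> hom_gr A P M n"
  unfolding hom_gr_def
  using hom_grD[OF f]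
  by (auto simp: P.act_carrier P.M.gr_carrier M.M.signed_gr M.M.signed_add M.act_signed_right
      M.act_carrier P.A.C.gr_carrier M.M.signed_signed add.commute)

end


lemma hom_compose:
  assumes f: "f \<in> hom_gr A N M n" and g: "g \<in> hom_gr A P N k"
    and P: "dg_mod A P" and N: "dg_mod A N" and M: "pre_dg_mod A M"
  shows "(\<lambda>x \<in> carrier P. f (g x)) \<in> hom_gr A P M (k + n)"
proof -
  interpret P: dg_mod A P by fact
  interpret M: pre_dg_mod A M by fact
  interpret N: hom_complex A N M using N M by (simp add: hom_complex_def)
  show ?thesis
    unfolding hom_gr_def
  proof (intro CollectI conjI ballI allI)
    fix i x assume "x \<in> gr P i"
    then show "(\<lambda>x \<in> carrier P. f (g x)) x \<in> gr M (i + (k + n))"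
      using hom_grD(3)[OF f hom_grD(3)[OF g]] P.M.gr_carrier by (simp add: add.assoc)
  next
    fix i a x assume "a \<in> gr A i" "x \<in> carrier P"
    then show "(\<lambda>x \<in> carrier P. f (g x)) (act P a x) = signed M ((k + n) * i) (act M a ((\<lambda>x \<in> carrier P. f (g x)) x))"
      using hom_grD(1)[OF f] hom_grD(1)[OF g]
      by (simp add: P.act_carrier P.A.C.gr_carrier hom_grD(4)[OF g] hom_grD(4)[OF f] N.hom_signed[OF f] N.P.act_carrier
          M.M.signed_signed M.act_carrier algebra_simps)
  qed (use hom_grD(1,2)[OF f] hom_grD(1,2)[OF g] in auto)
qed


section \<open>Lifting along semi-free modules\<close>

locale semifree_basis = dg_mod A P
  for A :: "('a, 'z) dg_scheme" and P :: "('a, 'p, 'x) dg_module_scheme" +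
  fixes B :: "nat \<Rightarrow> 'p set"
  assumes basis_homogeneous: "B j \<subseteq> (\<Union>n. gr P n)"
    and basis_disjoint: "i \<noteq> j \<Longrightarrow> B i \<inter> B j = {}"
    and basis_unique: "x \<in> carrier P \<Longrightarrow> \<exists>!c. lin_comb A P (\<Union>j. B j) c x"
    and basis_filtered: "b \<in> B j \<Longrightarrow> \<exists>c. lin_comb A P (\<Union>i<j. B i) c (dif P b)"
begin

abbreviation basis where "basis \<equiv> \<Union>j. B j"

definition deg :: "'p \<Rightarrow> int" where "deg b = (SOME n. b \<in> gr P n)"

definition coord :: "'p \<Rightarrow> 'p \<Rightarrow> 'a" where "coord x = (THE c. lin_comb A P basis c x)"

lemma basis_gr: "b \<in> basis \<Longrightarrow> b \<in> gr P (deg b)"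
  using basis_homogeneous unfolding deg_def by (metis UN_E someI subsetD)

lemma basis_carrier: "b \<in> basis \<Longrightarrow> b \<in> carrier P"
  using basis_gr M.gr_carrier by blast

lemma coord:
  assumes "x \<in> carrier P"
  shows "coeffs A basis (coord x)" "x = lin_sum A P (coord x) (\<lambda>b. b)"
  using theI'[OF basis_unique[OF assms]] unfolding coord_def lin_comb_iff by auto

lemma coord_eqI:
  assumes "coeffs A basis c" "x = lin_sum A P c (\<lambda>b. b)"
  shows "coord x = c"
proof -
  have "x \<in> carrier P" unfolding assms(2) by (rule lin_sum_closed[OF assms(1)]) (rule basis_carrier)
  then show ?thesis
    unfolding coord_def using assms by (intro the1_equality basis_unique) (auto simp: lin_comb_iff)
qed

lemma coord_add:
  assumes "x \<in> carrier P" "y \<in> carrier P"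
  shows "coord (x \<oplus>\<^bsub>P\<^esub> y) = (\<lambda>b. coord x b \<oplus>\<^bsub>A\<^esub> coord y b)"
proof (rule coord_eqI[OF A.coeffs_add[OF coord(1)[OF assms(1)] coord(1)[OF assms(2)]]])
  show "x \<oplus>\<^bsub>P\<^esub> y = lin_sum A P (\<lambda>b. coord x b \<oplus>\<^bsub>A\<^esub> coord y b) (\<lambda>b. b)"
    by (simp only: lin_sum_add[OF coord(1)[OF assms(1)] coord(1)[OF assms(2)], of "\<lambda>b. b", OF basis_carrier]
      coord(2)[OF assms(1), symmetric] coord(2)[OF assms(2), symmetric])
qed

lemma coord_act:
  assumes "a \<in> carrier A" "x \<in> carrier P"
  shows "coord (act P a x) = (\<lambda>b. a \<otimes>\<^bsub>A\<^esub> coord x b)"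
proof (rule coord_eqI[OF A.coeffs_map[OF coord(1)[OF assms(2)]]])
  show "act P a x = lin_sum A P (\<lambda>b. a \<otimes>\<^bsub>A\<^esub> coord x b) (\<lambda>b. b)"
    by (simp only: lin_sum_act[OF coord(1)[OF assms(2)], of "\<lambda>b. b", OF basis_carrier assms(1)]
      coord(2)[OF assms(2), symmetric])
qed (use assms(1) in simp_all)

lemma coord_basis:
  assumes "b \<in> basis"
  shows "coord b = (\<lambda>b'. if b' = b then \<one>\<^bsub>A\<^esub> else \<zero>\<^bsub>A\<^esub>)"
  using assms basis_carrier lin_sum_single[of b basis "\<one>\<^bsub>A\<^esub>" "\<lambda>b. b"]
  by (intro coord_eqI A.coeffs_single) (auto simp: act_unit)

lemma hpart_act_basis:
  assumes b: "b \<in> gr P d" and a: "a \<in> carrier A"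
  shows "hpart P n (act P a b) = act P (hpart A (n - d) a) b"
  using a
proof (induction a rule: A.C.homogeneous_induct)
  case zero
  then show ?case
    using M.gr_carrier[OF b] by (simp add: act_zero_left M.hpart_homog[OF M.gr_zero[of n]] A.C.hpart_homog[OF A.C.gr_zero[of "n - d"]])
next
  case (add x y)
  then show ?case
    using M.gr_carrier[OF b] by (simp add: act_add_left M.hpart_add A.C.hpart_add act_carrier A.C.hpart_carrier)
next
  case (homogeneous i x)
  then show ?case
    using M.hpart_homog[OF act_degree[OF homogeneous b], of n] A.C.hpart_homog[OF homogeneous, of "n - d"] M.gr_carrier[OF b]
    by (auto simp: act_zero_left)
qed

text \<open>Comparing components of degree \<open>n\<close> in the expansion of \<open>x\<close> gives an expansion with homogeneous
  coefficients, which must be the given one.\<close>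

lemma coord_degree:
  assumes x: "x \<in> gr P n" and b: "b \<in> basis"
  shows "coord x b \<in> gr A (n - deg b)"
proof -
  have xc: "x \<in> carrier P" using x by (rule M.gr_carrier)
  note cx = coord[OF xc]
  note cc = A.coeffs_carrier[OF cx(1)]
  define c where "c b = hpart A (n - deg b) (coord x b)" for b
  have c0: "c b = \<zero>\<^bsub>A\<^esub>" if "coord x b = \<zero>\<^bsub>A\<^esub>" for b
    unfolding c_def that using A.C.hpart_homog[OF A.C.gr_zero] by simp
  let ?S = "{b. coord x b \<noteq> \<zero>\<^bsub>A\<^esub>}"
  note S = coeffs_support[OF cx(1)]
  have c: "coeffs A basis c"
    unfolding coeffs_def
  proof (intro conjI ballI allI impI)
    show "c b \<in> carrier A" for b unfolding c_def by (rule A.C.hpart_carrier[OF cc])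
    show "c b = \<zero>\<^bsub>A\<^esub>" if "b \<notin> basis" for b using that S(1) c0 by blast
    show "finite {b. c b \<noteq> \<zero>\<^bsub>A\<^esub>}" by (rule finite_subset[OF _ S(2)]) (use c0 in auto)
  qed
  have "hpart P n (\<Oplus>\<^bsub>P\<^esub>b \<in> T. act P (coord x b) b) = (\<Oplus>\<^bsub>P\<^esub>b \<in> T. act P (c b) b)"
    if "finite T" "T \<subseteq> basis" for T
    using that
  proof (induction T rule: finite_induct)
    case empty
    then show ?case using M.hpart_homog[OF M.gr_zero] by simp
  next
    case (insert t T)
    have t: "t \<in> basis" "\<And>b. b \<in> T \<Longrightarrow> b \<in> carrier P" "t \<in> carrier P" using insert basis_carrier by auto
    have cT: "\<And>b. c b \<in> carrier A" unfolding c_def by (rule A.C.hpart_carrier[OF cc])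
    have 1: "(\<Oplus>\<^bsub>P\<^esub>b \<in> insert t T. act P (coord x b) b) = act P (coord x t) t \<oplus>\<^bsub>P\<^esub> (\<Oplus>\<^bsub>P\<^esub>b \<in> T. act P (coord x b) b)"
      using insert(1,2) t cc by (intro M.finsum_insert) (auto simp: act_carrier)
    have 2: "(\<Oplus>\<^bsub>P\<^esub>b \<in> insert t T. act P (c b) b) = act P (c t) t \<oplus>\<^bsub>P\<^esub> (\<Oplus>\<^bsub>P\<^esub>b \<in> T. act P (c b) b)"
      using insert(1,2) t cT by (intro M.finsum_insert) (auto simp: act_carrier)
    have 3: "(\<Oplus>\<^bsub>P\<^esub>b \<in> T. act P (coord x b) b) \<in> carrier P"
      using t cc by (intro M.finsum_closed) (auto simp: act_carrier)
    have 4: "hpart P n (act P (coord x t) t) = act P (c t) t"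
      unfolding c_def by (rule hpart_act_basis[OF basis_gr[OF t(1)] cc])
    show ?case unfolding 1 2 using M.hpart_add[OF act_carrier[OF cc t(3)] 3] 4 insert by simp
  qed
  from this[OF S(2,1)] have 1: "(\<Oplus>\<^bsub>P\<^esub>b \<in> ?S. act P (c b) b) = hpart P n x"
    unfolding lin_sum_def[symmetric] cx(2)[symmetric] by (rule sym)
  have 2: "hpart P n x = x" using M.hpart_homog[OF x] by simp
  have 3: "lin_sum A P c (\<lambda>b. b) = (\<Oplus>\<^bsub>P\<^esub>b \<in> ?S. act P (c b) b)"
    by (rule lin_sum_superset[OF c basis_carrier S(2) _ S(1)]) (use c0 in auto)
  have "coord x = c" by (rule coord_eqI[OF c]) (simp only: 3 1 2)
  moreover have "c b \<in> gr A (n - deg b)" unfolding c_def by (rule A.C.hpart_gr[OF cc])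
  ultimately show ?thesis by simp
qed

definition extend :: "('a, 'm, 'y) dg_module_scheme \<Rightarrow> int \<Rightarrow> ('p \<Rightarrow> 'm) \<Rightarrow> 'p \<Rightarrow> 'm" where
  "extend M k e = (\<lambda>x \<in> carrier P. lin_sum A M (\<lambda>b. twist A k (coord x b)) e)"

end

locale semifree_target = P?: semifree_basis A P B + H?: hom_complex A P M
  for A :: "('a, 'z) dg_scheme" and P :: "('a, 'p, 'x) dg_module_scheme" and B :: "nat \<Rightarrow> 'p set"
    and M :: "('a, 'm, 'y) dg_module_scheme"
begin

lemma twist_coord: "x \<in> carrier P \<Longrightarrow> coeffs A basis (\<lambda>b. twist A k (coord x b))"
  by (rule P.A.coeffs_map[OF coord(1)]) (simp_all add: P.A.twist_closed)

lemma extend_in_submodule: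
  assumes V: "graded_submodule A M V" and e: "\<And>b. b \<in> basis \<Longrightarrow> e b \<in> V (deg b + k)" and x: "x \<in> gr P n"
  shows "extend M k e x \<in> V (n + k)"
proof -
  have xc: "x \<in> carrier P" using x by (rule P.M.gr_carrier)
  have "lin_sum A M (\<lambda>b. twist A k (coord x b)) e \<in> V (n + k)"
  proof (rule H.M.lin_sum_in_graded_submodule[OF V twist_coord[OF xc]])
    fix b assume b: "b \<in> basis"
    have "twist A k (coord x b) \<in> gr A (n - deg b)" by (rule P.A.twist_gr[OF coord_degree[OF x b]])
    then show "\<exists>i j. i + j = n + k \<and> twist A k (coord x b) \<in> gr A i \<and> e b \<in> V j"
      using e[OF b] by (intro exI[of _ "n - deg b"] exI[of _ "deg b + k"]) simp
  qed
  then show ?thesis using xc by (simp add: extend_def)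
qed

lemma extend_hom:
  assumes e: "\<And>b. b \<in> basis \<Longrightarrow> e b \<in> gr M (deg b + k)"
  shows "extend M k e \<in> hom_gr A P M k"
proof -
  have ec: "e b \<in> carrier M" if "b \<in> basis" for b using e[OF that] H.M.M.gr_carrier by blast
  have cc: "coord x b \<in> carrier A" if "x \<in> carrier P" for x b using P.A.coeffs_carrier[OF coord(1)[OF that]] .
  show ?thesis
    unfolding hom_gr_def
  proof (intro CollectI conjI ballI allI)
    show "extend M k e \<in> carrier P \<rightarrow>\<^sub>E carrier M"
      unfolding extend_def using H.M.lin_sum_closed[OF twist_coord ec] by auto
    fix x y assume xy: "x \<in> carrier P" "y \<in> carrier P"
    then show "extend M k e (x \<oplus>\<^bsub>P\<^esub> y) = extend M k e x \<oplus>\<^bsub>M\<^esub> extend M k e y"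
      using H.M.lin_sum_add[OF twist_coord[OF xy(1), of k] twist_coord[OF xy(2), of k], of e, OF ec] cc
      by (simp add: extend_def coord_add P.A.twist_add)
  next
    fix i x assume x: "x \<in> gr P i"
    show "extend M k e x \<in> gr M (i + k)"
      by (rule extend_in_submodule[OF H.M.graded_submodule_gr _ x]) (rule e)
  next
    fix i a x assume a: "a \<in> gr A i" and x: "x \<in> carrier P"
    have ac: "a \<in> carrier A" using a by (rule P.A.C.gr_carrier)
    have "extend M k e (act P a x) = act M (twist A k a) (lin_sum A M (\<lambda>b. twist A k (coord x b)) e)"
      using H.M.lin_sum_act[OF twist_coord[OF x, of k], of e, OF ec P.A.twist_closed[OF ac, of k]] cc[OF x] x ac
      by (simp add: extend_def coord_act P.A.twist_mult P.act_carrier)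
    then show "extend M k e (act P a x) = signed M (k * i) (act M a (extend M k e x))"
      using x ac H.M.lin_sum_closed[OF twist_coord[OF x] ec]
      by (simp add: extend_def P.A.twist_homog[OF a] H.M.act_signed_left)
  qed
qed

lemma extend_basis:
  assumes "\<And>b. b \<in> basis \<Longrightarrow> e b \<in> carrier M" "b \<in> basis"
  shows "extend M k e b = e b"
proof -
  have "twist A k \<one>\<^bsub>A\<^esub> = \<one>\<^bsub>A\<^esub>" using P.A.twist_homog[OF P.A.one_gr] by (simp add: signed_def)
  then have "(\<lambda>b'. twist A k (coord b b')) = (\<lambda>b'. if b' = b then \<one>\<^bsub>A\<^esub> else \<zero>\<^bsub>A\<^esub>)"
    using coord_basis[OF assms(2)] by auto
  then show ?thesis
    using H.M.lin_sum_single[OF assms(2) P.A.R.one_closed assms(1)] assms basis_carrier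
    by (simp add: extend_def H.M.act_unit)
qed

lemma hom_in_submodule_on_span:
  assumes g: "g \<in> hom_gr A P M k" and U: "graded_submodule A M U"
    and D: "D \<subseteq> basis" and gU: "\<And>b. b \<in> D \<Longrightarrow> g b \<in> U (deg b + k)"
    and x: "x \<in> gr P n" "lin_comb A P D c x"
  shows "g x \<in> U (n + k)"
proof -
  have c: "coeffs A D c" "x = lin_sum A P c (\<lambda>b. b)" using x(2) by (auto simp: lin_comb_iff)
  have cx: "coord x = c" by (rule coord_eqI[OF P.A.coeffs_mono[OF c(1) D] c(2)])
  have Dc: "D \<subseteq> carrier P" using D basis_carrier by blast
  have "lin_sum A M (\<lambda>b. twist A k (c b)) g \<in> U (n + k)"
  proof (rule H.M.lin_sum_in_graded_submodule[OF U])
    show "coeffs A D (\<lambda>b. twist A k (c b))" by (rule P.A.coeffs_map[OF c(1)]) (simp_all add: P.A.twist_closed)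
    fix b assume b: "b \<in> D"
    have "b \<in> basis" using b D by blast
    then have "twist A k (c b) \<in> gr A (n - deg b)"
      using P.A.twist_gr[OF coord_degree[OF x(1)], of b k] cx by simp
    then show "\<exists>i j. i + j = n + k \<and> twist A k (c b) \<in> gr A i \<and> g b \<in> U j"
      using gU[OF b] by (intro exI[of _ "n - deg b"] exI[of _ "deg b + k"]) simp
  qed
  then show ?thesis using H.hom_lin_sum[OF g c(1) Dc] c(2) by simp
qed

lemma hom_eq_on_span:
  assumes g: "g \<in> hom_gr A P M k" "g' \<in> hom_gr A P M k" and D: "D \<subseteq> basis"
    and eq: "\<And>b. b \<in> D \<Longrightarrow> g b = g' b" and x: "lin_comb A P D c x"
  shows "g x = g' x"
proof -
  have c: "coeffs A D c" "x = lin_sum A P c (\<lambda>b. b)" using x by (auto simp: lin_comb_iff)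
  have Dc: "D \<subseteq> carrier P" using D basis_carrier by blast
  have "lin_sum A M (\<lambda>b. twist A k (c b)) g = lin_sum A M (\<lambda>b. twist A k (c b)) g'"
    by (rule H.M.lin_sum_cong[OF P.A.coeffs_map[OF c(1)]])
      (use eq Dc hom_grD(1)[OF g(2)] P.A.twist_closed in auto)
  then show ?thesis using H.hom_lin_sum[OF g(1) c(1) Dc] H.hom_lin_sum[OF g(2) c(1) Dc] c(2) by simp
qed

text \<open>What is left of \<open>f\<close> after subtracting the coboundary of \<open>h\<close>. The difference is written as a sum
  with \<open>signed M 1\<close>, which is negation, to apply the closure properties of homogeneous maps.\<close>

definition residual :: "int \<Rightarrow> ('p \<Rightarrow> 'm) \<Rightarrow> ('p \<Rightarrow> 'm) \<Rightarrow> 'p \<Rightarrow> 'm" where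
  "residual n f h = (\<lambda>x \<in> carrier P. f x \<oplus>\<^bsub>M\<^esub> signed M 1 (hom_dif P M (n - 1) h x))"

lemma residual_apply:
  assumes f: "f \<in> hom_gr A P M n" and h: "h \<in> hom_gr A P M (n - 1)" and x: "x \<in> carrier P"
  shows "residual n f h x = (f x \<oplus>\<^bsub>M\<^esub> signed M (n - 1) (h (dif P x))) \<ominus>\<^bsub>M\<^esub> dif M (h x)"
  using x hom_grD(1)[OF f] hom_grD(1)[OF h] P.M.dif_closed H.M.M.dif_closed
  by (simp add: residual_def H.hom_dif_apply signed_def H.M.M.minus_eq H.M.M.minus_add H.M.M.a_ac)

lemma residual_hom:
  assumes f: "f \<in> hom_gr A P M n" and h: "h \<in> hom_gr A P M (n - 1)"
  shows "residual n f h \<in> hom_gr A P M n"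
proof -
  have "hom_dif P M (n - 1) h \<in> hom_gr A P M n" using H.hom_dif_closed[OF h] by simp
  from H.hom_add_closed[OF f H.hom_signed_closed[OF this, of 1]]
  have "(\<lambda>x \<in> carrier P. f x \<oplus>\<^bsub>M\<^esub> (\<lambda>x \<in> carrier P. signed M 1 (hom_dif P M (n - 1) h x)) x) \<in> hom_gr A P M n" .
  also have "(\<lambda>x \<in> carrier P. f x \<oplus>\<^bsub>M\<^esub> (\<lambda>x \<in> carrier P. signed M 1 (hom_dif P M (n - 1) h x)) x) = residual n f h"
    unfolding residual_def by (rule restrict_ext) simp
  finally show ?thesis .
qed

text \<open>A cocycle from a semi-free module into \<open>V\<close> is null-homotopic modulo \<open>U\<close> if \<open>V/U\<close> is acyclic. The
  homotopy is built along the filtration of the basis. For \<open>b\<close> in \<open>B j\<close> the earlier values determine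
  \<open>f b\<close> plus the signed value of the homotopy at \<open>dif P b\<close>; up to sign, the differential of this element is
  the residual at \<open>dif P b\<close>, hence lies in \<open>U\<close>, and acyclicity provides a value at \<open>b\<close>.\<close>

lemma semifree_lift:
  assumes f: "f \<in> hom_cocycles A P M n"
    and V: "graded_submodule A M V" and U: "graded_submodule A M U"
    and fV: "\<And>j x. x \<in> gr P j \<Longrightarrow> f x \<in> V (j + n)"
    and acyclic: "\<And>j x. \<lbrakk>x \<in> V j; dif M x \<in> U (j + 1)\<rbrakk> \<Longrightarrow> \<exists>y \<in> V (j - 1). x \<ominus>\<^bsub>M\<^esub> dif M y \<in> U j"
  obtains h where "h \<in> hom_gr A P M (n - 1)" "\<And>j x. x \<in> gr P j \<Longrightarrow> residual n f h x \<in> U (j + n)"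
proof -
  note fg = H.hom_cocycleD(1)[OF f]
  let ?ok = "\<lambda>e. \<forall>b \<in> basis. e b \<in> V (deg b + (n - 1))"
  let ?low = "\<lambda>j. \<Union>i<j. B i"
  let ?r = "\<lambda>e. residual n f (extend M (n - 1) e)"
  have low: "?low j \<subseteq> basis" for j by auto
  have ok_gr: "e b \<in> gr M (deg b + (n - 1))" if "?ok e" "b \<in> basis" for e b
    using that graded_submoduleD(1)[OF V] by blast
  have hom: "extend M (n - 1) e \<in> hom_gr A P M (n - 1)" if "?ok e" for e
    by (rule extend_hom[OF ok_gr[OF that]])
  have val: "extend M (n - 1) e b = e b" if "?ok e" "b \<in> basis" for e b
    by (rule extend_basis[OF _ that(2)]) (use ok_gr[OF that(1)] H.M.M.gr_carrier in blast)
  have val_eq: "extend M (n - 1) e b = extend M (n - 1) e' b"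
    if "?ok e" "?ok e'" "b \<in> basis" "e b = e' b" for e e' b
    by (simp only: val[OF that(1,3)] val[OF that(2,3)] that(4))
  \<comment> \<open>The residual at \<open>b\<close> depends only on the values at \<open>b\<close> and below, so it survives later choices.\<close>
  have agree: "?r e b = ?r e' b"
    if e: "?ok e" "?ok e'" and eq: "\<And>b. b \<in> ?low j \<Longrightarrow> e b = e' b" "e b = e' b" and b: "b \<in> B j" for e e' j b
  proof -
    have bb: "b \<in> basis" using b by blast
    obtain c where c: "lin_comb A P (?low j) c (dif P b)" using basis_filtered[OF b] by blast
    have "extend M (n - 1) e (dif P b) = extend M (n - 1) e' (dif P b)"
      by (rule hom_eq_on_span[OF hom[OF e(1)] hom[OF e(2)] low _ c], rule val_eq[OF e subsetD[OF low] eq(1)])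
    then show ?thesis
      using residual_apply[OF fg hom[OF e(1)] basis_carrier[OF bb]] residual_apply[OF fg hom[OF e(2)] basis_carrier[OF bb]]
        val[OF e(1) bb] val[OF e(2) bb] eq(2) by simp
  qed
  have step: "\<exists>y \<in> V (deg b + (n - 1)). (f b \<oplus>\<^bsub>M\<^esub> signed M (n - 1) (extend M (n - 1) e (dif P b))) \<ominus>\<^bsub>M\<^esub> dif M y \<in> U (deg b + n)"
    if e: "?ok e" "\<And>b. b \<in> ?low j \<Longrightarrow> ?r e b \<in> U (deg b + n)" and b: "b \<in> B j" for e j b
  proof -
    let ?h = "extend M (n - 1) e"
    have bb: "b \<in> basis" using b by blast
    note bg = basis_gr[OF bb]
    note bc = basis_carrier[OF bb]
    obtain c where c: "lin_comb A P (?low j) c (dif P b)" using basis_filtered[OF b] by blast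
    have d: "dif P b \<in> gr P (deg b + 1)" by (rule P.M.dif_degree[OF bg])
    have dc: "dif P b \<in> carrier P" by (rule P.M.gr_carrier[OF d])
    let ?x = "f b \<oplus>\<^bsub>M\<^esub> signed M (n - 1) (?h (dif P b))"
    have "?h (dif P b) \<in> V (deg b + 1 + (n - 1))"
      by (rule extend_in_submodule[OF V _ d]) (use e(1) in blast)
    then have xV: "?x \<in> V (deg b + n)"
      using fV[OF bg] H.M.graded_submodule_signed[OF V] graded_submoduleD(3)[OF V] by simp
    have "?r e (dif P b) \<in> U (deg b + 1 + n)"
      by (rule hom_in_submodule_on_span[OF residual_hom[OF fg hom[OF e(1)]] U low _ d c]) (rule e(2))
    moreover have "?r e (dif P b) = f (dif P b) \<ominus>\<^bsub>M\<^esub> dif M (?h (dif P b))"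
      using residual_apply[OF fg hom[OF e(1)] dc] hom_grD(1)[OF fg dc] bc
      by (simp add: P.M.dif_square H.hom_zero[OF hom[OF e(1)]])
    moreover have "dif M ?x = signed M n (f (dif P b) \<ominus>\<^bsub>M\<^esub> dif M (?h (dif P b)))"
      using hom_grD(1)[OF fg bc] hom_grD(1)[OF fg dc] hom_grD(1)[OF hom[OF e(1)] dc] H.hom_cocycleD(2)[OF f bc] H.M.M.dif_closed
      by (simp add: H.M.M.dif_distrib H.M.M.dif_signed) (simp add: signed_def H.M.M.minus_eq H.M.M.minus_add)
    ultimately have "dif M ?x \<in> U (deg b + n + 1)"
      using H.M.graded_submodule_signed[OF U] by (simp add: algebra_simps)
    from acyclic[OF xV this] show ?thesis by (simp add: algebra_simps)
  qed
  have "\<exists>E. \<forall>j. (?ok (E j) \<and> (\<forall>b \<in> ?low j. ?r (E j) b \<in> U (deg b + n))) \<and> (\<forall>b \<in> ?low j. E (Suc j) b = E j b)"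
  proof (rule dependent_nat_choice)
    show "\<exists>e. ?ok e \<and> (\<forall>b \<in> ?low 0. ?r e b \<in> U (deg b + n))"
      using graded_submoduleD(2)[OF V] by (intro exI[of _ "\<lambda>_. \<zero>\<^bsub>M\<^esub>"]) simp
  next
    fix e j assume "?ok e \<and> (\<forall>b \<in> ?low j. ?r e b \<in> U (deg b + n))"
    then have e: "?ok e" "\<And>b. b \<in> ?low j \<Longrightarrow> ?r e b \<in> U (deg b + n)" by blast+
    let ?x = "\<lambda>b. f b \<oplus>\<^bsub>M\<^esub> signed M (n - 1) (extend M (n - 1) e (dif P b))"
    from step[OF e] have "\<forall>b \<in> B j. \<exists>y. y \<in> V (deg b + (n - 1)) \<and> ?x b \<ominus>\<^bsub>M\<^esub> dif M y \<in> U (deg b + n)"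
      by blast
    from bchoice[OF this] obtain y
      where y: "\<And>b. b \<in> B j \<Longrightarrow> y b \<in> V (deg b + (n - 1)) \<and> ?x b \<ominus>\<^bsub>M\<^esub> dif M (y b) \<in> U (deg b + n)"
      by blast
    define e' where "e' b = (if b \<in> B j then y b else e b)" for b
    have ok': "?ok e'" using e(1) y by (simp add: e'_def)
    have old: "e' b = e b" if b: "b \<in> ?low j" for b
    proof -
      obtain i where "i < j" "b \<in> B i" using b by blast
      then have "b \<notin> B j" using basis_disjoint[of i j] by auto
      then show ?thesis by (simp add: e'_def)
    qed
    have "?r e' b \<in> U (deg b + n)" if b: "b \<in> ?low (Suc j)" for b
    proof (cases "b \<in> ?low j")
      case True
      then obtain i where i: "i < j" "b \<in> B i" by blast
      have lowi: "?low i \<subseteq> ?low j" using i(1) by (intro UN_mono) auto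
      have "?r e' b = ?r e b"
        by (rule agree[OF ok' e(1) _ old[OF True] i(2)], rule old[OF subsetD[OF lowi]])
      then show ?thesis using e(2)[OF True] by simp
    next
      case False
      then have bj: "b \<in> B j" using b less_Suc_eq by auto
      then have bb: "b \<in> basis" by blast
      have e'b: "e' b = y b" using bj by (simp add: e'_def)
      obtain c where c: "lin_comb A P (?low j) c (dif P b)" using basis_filtered[OF bj] by blast
      have "extend M (n - 1) e' (dif P b) = extend M (n - 1) e (dif P b)"
        by (rule hom_eq_on_span[OF hom[OF ok'] hom[OF e(1)] low _ c], rule val_eq[OF ok' e(1) subsetD[OF low] old])
      then have "?r e' b = ?x b \<ominus>\<^bsub>M\<^esub> dif M (y b)"
        using residual_apply[OF fg hom[OF ok'] basis_carrier[OF bb]] val[OF ok' bb] e'b by simp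
      then show ?thesis using y[OF bj] by simp
    qed
    then show "\<exists>e'. (?ok e' \<and> (\<forall>b \<in> ?low (Suc j). ?r e' b \<in> U (deg b + n))) \<and> (\<forall>b \<in> ?low j. e' b = e b)"
      using ok' old by (intro exI[of _ e']) blast
  qed
  then obtain E where "\<forall>j. (?ok (E j) \<and> (\<forall>b \<in> ?low j. ?r (E j) b \<in> U (deg b + n))) \<and> (\<forall>b \<in> ?low j. E (Suc j) b = E j b)" ..
  note this [THEN spec]
  note E = this[THEN conjunct1, THEN conjunct1] this[THEN conjunct1, THEN conjunct2, THEN bspec] this[THEN conjunct2, THEN bspec]
  have stable: "E k b = E j b" if "b \<in> ?low j" "j \<le> k" for j k b
    using that(2)
  proof (induction k rule: dec_induct)
    case (step k)
    have "b \<in> ?low k" using that(1) step(1) by auto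
    then show ?case using E(3) step by simp
  qed simp
  \<comment> \<open>The stage after the one that contains \<open>b\<close> is the first at which the value at \<open>b\<close> has been chosen.\<close>
  define e where "e b = E (Suc (LEAST j. b \<in> B j)) b" for b
  have eE: "e b = E j b" if b: "b \<in> ?low j" for b j
  proof -
    obtain i where i: "i < j" "b \<in> B i" using b by blast
    have *: "b \<in> B (LEAST j. b \<in> B j)" "(LEAST j. b \<in> B j) \<le> i" using i(2) by (auto intro: LeastI Least_le)
    then have "b \<in> ?low (Suc (LEAST j. b \<in> B j))" by blast
    from stable[OF this, of j] show ?thesis using * i(1) by (simp add: e_def)
  qed
  have e: "?ok e"
  proof
    fix b assume "b \<in> basis"
    then obtain j where "b \<in> B j" by blast
    then have "b \<in> ?low (Suc j)" by blast
    have "E (Suc j) b \<in> V (deg b + (n - 1))" by (rule bspec[OF E(1) \<open>b \<in> basis\<close>])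
    then show "e b \<in> V (deg b + (n - 1))" by (simp only: eE[OF \<open>b \<in> ?low (Suc j)\<close>])
  qed
  have rU: "?r e b \<in> U (deg b + n)" if b: "b \<in> basis" for b
  proof -
    obtain j where j: "b \<in> B j" using b by blast
    have lowj: "?low j \<subseteq> ?low (Suc j)" by (intro UN_mono) auto
    have bj: "b \<in> ?low (Suc j)" using j by blast
    have "?r e b = ?r (E (Suc j)) b"
      by (rule agree[OF e E(1) _ eE[OF bj] j], rule eE[OF subsetD[OF lowj]])
    then show ?thesis using E(2)[OF bj] by (simp only:)
  qed
  show thesis
  proof (rule that[OF hom[OF e]])
    fix j x assume x: "x \<in> gr P j"
    have "lin_comb A P basis (coord x) x" using coord[OF P.M.gr_carrier[OF x]] by (simp add: lin_comb_iff)
    from hom_in_submodule_on_span[OF residual_hom[OF fg hom[OF e]] U _ rU x this]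
    show "?r e x \<in> U (j + n)" by simp
  qed
qed

end


section \<open>Maps that vanish on the bottom cohomology\<close>

definition cut_at :: "('m, 'z) dg_scheme \<Rightarrow> int \<Rightarrow> 'm set \<Rightarrow> int \<Rightarrow> 'm set" where
  "cut_at M i Z n = (if n < i then gr M n else if n = i then Z else {\<zero>\<^bsub>M\<^esub>})"

text \<open>The smart truncation of \<open>P\<close> to degrees at most 0: if the cohomology of \<open>P\<close> vanishes in positive
  degrees, then \<open>P\<close> modulo it is acyclic.\<close>

abbreviation truncation :: "('m, 'z) dg_scheme \<Rightarrow> int \<Rightarrow> 'm set" where
  "truncation P \<equiv> cut_at P 0 (cocycles P 0)"

text \<open>The kernel of \<open>M\<close> onto its smart truncation to degrees at least \<open>i\<close>: if the cohomology of \<open>M\<close> vanishes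
  below \<open>i\<close>, then this is acyclic.\<close>

abbreviation acyclic_bottom :: "('m, 'z) dg_scheme \<Rightarrow> int \<Rightarrow> int \<Rightarrow> 'm set" where
  "acyclic_bottom M i \<equiv> cut_at M i (cobounds M i)"

context pre_dg_mod
begin

lemma graded_submodule_zero: "graded_submodule A M (\<lambda>_. {\<zero>\<^bsub>M\<^esub>})"
  by (auto simp: graded_submodule_def act_zero_right A.C.gr_carrier)

text \<open>Scalars never raise the degree, as \<open>A\<close> is non-positive.\<close>

lemma graded_submodule_cut_at:
  assumes Z: "Z \<subseteq> gr M i" "\<zero>\<^bsub>M\<^esub> \<in> Z" "\<And>x y. \<lbrakk>x \<in> Z; y \<in> Z\<rbrakk> \<Longrightarrow> x \<oplus>\<^bsub>M\<^esub> y \<in> Z"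
    "\<And>a x. \<lbrakk>a \<in> gr A 0; x \<in> Z\<rbrakk> \<Longrightarrow> act M a x \<in> Z"
  shows "graded_submodule A M (cut_at M i Z)"
  unfolding graded_submodule_def
proof (intro conjI allI ballI)
  fix n show "cut_at M i Z n \<subseteq> gr M n" using Z(1) by (auto simp: cut_at_def)
  show "\<zero>\<^bsub>M\<^esub> \<in> cut_at M i Z n" using Z(2) by (simp add: cut_at_def)
  fix x y assume "x \<in> cut_at M i Z n" "y \<in> cut_at M i Z n"
  then show "x \<oplus>\<^bsub>M\<^esub> y \<in> cut_at M i Z n"
    by (auto simp: cut_at_def M.gr_add Z(3) split: if_splits)
next
  fix j n a x assume a: "a \<in> gr A j" and x: "x \<in> cut_at M i Z n"
  have xg: "x \<in> gr M n" using x Z(1) by (auto simp: cut_at_def split: if_splits)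
  note xc = M.gr_carrier[OF xg] and ac = A.C.gr_carrier[OF a]
  have null: "\<zero>\<^bsub>M\<^esub> \<in> cut_at M i Z k" for k using Z(2) by (simp add: cut_at_def)
  consider "0 < j" | "i < n" | "j = 0" "n \<le> i" | "j < 0" "n \<le> i" by linarith
  then show "act M a x \<in> cut_at M i Z (j + n)"
  proof cases
    case 1
    then have "act M a x = \<zero>\<^bsub>M\<^esub>" using a xc A.nonpos act_zero_left by auto
    then show ?thesis using null by simp
  next
    case 2
    then have "act M a x = \<zero>\<^bsub>M\<^esub>" using x ac by (simp add: cut_at_def act_zero_right)
    then show ?thesis using null by simp
  next
    case 3
    then show ?thesis using x a Z(4) by (auto simp: cut_at_def act_gr0_degree split: if_splits)
  next
    case 4
    then show ?thesis using act_degree[OF a xg] by (simp add: cut_at_def)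
  qed
qed

lemma graded_submodule_truncation: "graded_submodule A M (truncation M)"
  by (rule graded_submodule_cut_at) (auto simp: cocycles_def[of M 0] M.cocycles_add act0_cocycles
    intro: M.gr_add act_gr0_degree simp: M.dif_distrib M.gr_carrier dif_act0 act_zero_right A.C.gr_carrier)

lemma graded_submodule_acyclic_bottom: "graded_submodule A M (acyclic_bottom M i)"
  by (rule graded_submodule_cut_at)
    (use M.cobounds_subset_cocycles in \<open>auto simp: M.cobounds_add act0_cobounds cocycles_def\<close>)

end

lemma semifree_has_basis:
  assumes "semifree A P"
  obtains B where "semifree_basis A P B"
proof -
  have P: "dg_mod A P" using assms by (simp add: semifree_def)
  have "\<exists>B :: nat \<Rightarrow> _ set. (\<forall>j. B j \<subseteq> (\<Union>n. gr P n)) \<and> (\<forall>i j. i \<noteq> j \<longrightarrow> B i \<inter> B j = {}) \<and>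
     (\<forall>x \<in> carrier P. \<exists>!c. lin_comb A P (\<Union>j. B j) c x) \<and>
     (\<forall>j. \<forall>b \<in> B j. \<exists>c. lin_comb A P (\<Union>i<j. B i) c (dif P b))"
    using assms unfolding semifree_def by (rule conjunct2)
  then obtain B :: "nat \<Rightarrow> _ set" where B: "(\<forall>j. B j \<subseteq> (\<Union>n. gr P n)) \<and> (\<forall>i j. i \<noteq> j \<longrightarrow> B i \<inter> B j = {}) \<and>
     (\<forall>x \<in> carrier P. \<exists>!c. lin_comb A P (\<Union>j. B j) c x) \<and>
     (\<forall>j. \<forall>b \<in> B j. \<exists>c. lin_comb A P (\<Union>i<j. B i) c (dif P b))" by (rule exE)
  show thesis
  proof (rule that, intro semifree_basis.intro semifree_basis_axioms.intro P)
    show "B j \<subseteq> (\<Union>n. gr P n)" for j using conjunct1[OF B] by (rule spec)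
    show "B i \<inter> B j = {}" if "i \<noteq> j" for i j using conjunct1[OF conjunct2[OF B]] that by (elim allE impE)
    show "\<exists>!c. lin_comb A P (\<Union>j. B j) c x" if "x \<in> carrier P" for x
      using conjunct1[OF conjunct2[OF conjunct2[OF B]]] that by (rule bspec)
    show "\<exists>c. lin_comb A P (\<Union>i<j. B i) c (dif P b)" if "b \<in> B j" for b j
      using conjunct2[OF conjunct2[OF conjunct2[OF B]], THEN spec] that by (rule bspec)
  qed
qed

text \<open>A semi-free \<open>P\<close> may have generators in positive degrees, but if its cohomology lives in degrees at most 0
  then its identity is homotopic to some \<open>g\<close> with image in the truncation to degrees at most 0. On that truncation \<open>f\<close>
  takes values in degrees at most \<open>i\<close>, and the hypothesis on \<open>cocycles P 0\<close> puts them into the acyclic part of \<open>M\<close>.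
  So \<open>f\<close> composed with \<open>g\<close>, and with it \<open>f\<close>, is null-homotopic.\<close>

lemma semifree_hom_vanishing_on_bottom:
  assumes P: "semifree A P" and M: "pre_dg_mod A M"
    and Ppos: "\<And>n. 0 < n \<Longrightarrow> cocycles P n \<subseteq> cobounds P n"
    and Mlow: "\<And>n. n < i \<Longrightarrow> cocycles M n \<subseteq> cobounds M n"
    and f: "f \<in> hom_cocycles A P M i"
    and fbot: "\<And>y. y \<in> cocycles P 0 \<Longrightarrow> f y \<in> cobounds M i"
  shows "f \<in> hom_cobounds A P M i"
proof -
  interpret P: dg_mod A P using P by (simp add: semifree_def)
  interpret M: pre_dg_mod A M by (rule M)
  obtain B where "semifree_basis A P B" using P by (rule semifree_has_basis)
  then interpret sb: semifree_basis A P B .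
  interpret PP: semifree_target A P B P
    by (intro semifree_target.intro hom_complex.intro sb.semifree_basis_axioms P.dg_mod_axioms P.pre_dg_mod_axioms)
  interpret PM: semifree_target A P B M
    by (intro semifree_target.intro hom_complex.intro sb.semifree_basis_axioms P.dg_mod_axioms M.pre_dg_mod_axioms)
  note fg = PM.H.hom_cocycleD(1)[OF f]
  note fd = PM.H.hom_cocycleD(2)[OF f]
  let ?id = "\<lambda>x \<in> carrier P. x"
  have id_gr: "?id \<in> hom_gr A P P 0"
    by (auto simp: hom_gr_def P.act_carrier P.A.C.gr_carrier P.M.gr_carrier signed_def)
  have id: "?id \<in> hom_cocycles A P P 0"
    using id_gr by (auto simp: hom_cocycles_def hom_dif_def signed_def P.M.dif_closed P.M.minus_eq P.M.r_neg intro!: restrict_ext)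
  obtain s where s: "s \<in> hom_gr A P P (0 - 1)"
    "\<And>j x. x \<in> gr P j \<Longrightarrow> PP.residual 0 ?id s x \<in> truncation P (j + 0)"
  proof (rule PP.semifree_lift[OF id P.graded_submodule_gr P.graded_submodule_truncation])
    fix j x assume x: "x \<in> gr P j" and dx: "dif P x \<in> truncation P (j + 1)"
    note xc = P.M.gr_carrier[OF x]
    have z: "x \<ominus>\<^bsub>P\<^esub> dif P \<zero>\<^bsub>P\<^esub> = x" using xc by (simp add: P.M.minus_eq)
    consider "j < 0" | "j = 0" | "0 < j" by linarith
    then show "\<exists>y \<in> gr P (j - 1). x \<ominus>\<^bsub>P\<^esub> dif P y \<in> truncation P j"
    proof cases
      case 1
      then show ?thesis using x z by (intro bexI[of _ "\<zero>\<^bsub>P\<^esub>"]) (auto simp: cut_at_def)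
    next
      case 2
      then show ?thesis using x z dx by (intro bexI[of _ "\<zero>\<^bsub>P\<^esub>"]) (auto simp: cut_at_def cocycles_def)
    next
      case 3
      then have "x \<in> cocycles P j" using x dx by (simp add: cut_at_def cocycles_def)
      then obtain y where "y \<in> gr P (j - 1)" "x = dif P y" using Ppos[OF 3] by (auto simp: cobounds_def)
      then show ?thesis using xc 3 by (intro bexI[of _ y]) (auto simp: cut_at_def P.M.minus_eq P.M.r_neg)
    qed
  qed (auto simp: P.M.gr_carrier)
  define g where "g = PP.residual 0 ?id s"
  have s1: "s \<in> hom_gr A P P (-1)" using s(1) by simp
  note sc = hom_grD(1)[OF s(1)]
  have g: "g x = (x \<ominus>\<^bsub>P\<^esub> s (dif P x)) \<ominus>\<^bsub>P\<^esub> dif P (s x)" if x: "x \<in> carrier P" for x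
    unfolding g_def using PP.residual_apply[OF id_gr s(1) x] x by (simp add: signed_def P.M.minus_eq)
  have gg: "g \<in> hom_gr A P P 0" unfolding g_def by (rule PP.residual_hom[OF id_gr s(1)])
  note gc = hom_grD(1)[OF gg]
  have gdif: "g (dif P x) = dif P (g x)" if x: "x \<in> carrier P" for x
    using x sc P.M.dif_closed
    by (simp add: g P.M.minus_eq P.M.dif_distrib P.M.dif_minus P.M.dif_square PP.H.hom_zero[OF s(1)])
  define e where "e = (\<lambda>x \<in> carrier P. f (g x))"
  have eg: "e \<in> hom_gr A P M i"
    unfolding e_def using hom_compose[OF fg gg P.dg_mod_axioms P.dg_mod_axioms M] by simp
  have ecoc: "e \<in> hom_cocycles A P M i"
    using eg gc fd hom_grD(1)[OF fg] P.M.dif_closed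
    by (auto simp: hom_cocycles_def hom_dif_def e_def gdif M.M.diff_eq_zero_iff M.M.dif_closed intro!: restrict_ext)
  obtain h where h: "h \<in> hom_gr A P M (i - 1)" "\<And>j x. x \<in> gr P j \<Longrightarrow> PM.residual i e h x \<in> {\<zero>\<^bsub>M\<^esub>}"
  proof (rule PM.semifree_lift[OF ecoc M.graded_submodule_acyclic_bottom[of i] M.graded_submodule_zero])
    fix j x assume x: "x \<in> gr P j"
    have gx: "g x \<in> truncation P j" using s(2)[OF x] by (simp add: g_def)
    consider "j < 0" | "j = 0" | "0 < j" by linarith
    then show "e x \<in> acyclic_bottom M i (j + i)"
    proof cases
      case 1
      then show ?thesis using hom_grD(3)[OF eg x] by (simp add: cut_at_def)
    next
      case 2
      then show ?thesis using gx fbot P.M.gr_carrier[OF x] by (simp add: cut_at_def e_def)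
    next
      case 3
      then show ?thesis using gx P.M.gr_carrier[OF x] PM.H.hom_zero[OF fg]
        by (simp add: cut_at_def e_def)
    qed
  next
    fix j x assume x: "x \<in> acyclic_bottom M i j" and dx: "dif M x \<in> {\<zero>\<^bsub>M\<^esub>}"
    consider "j \<le> i" | "i < j" by linarith
    then show "\<exists>y \<in> acyclic_bottom M i (j - 1). x \<ominus>\<^bsub>M\<^esub> dif M y \<in> {\<zero>\<^bsub>M\<^esub>}"
    proof cases
      case 1
      have "x \<in> cobounds M j"
      proof (cases "j = i")
        case False
        then show ?thesis using x dx 1 Mlow[of j] by (auto simp: cut_at_def cocycles_def)
      qed (use x in \<open>simp add: cut_at_def\<close>)
      then obtain y where "y \<in> gr M (j - 1)" "x = dif M y" by (auto simp: cobounds_def)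
      then show ?thesis
        using 1 by (intro bexI[of _ y]) (auto simp: cut_at_def M.M.diff_eq_zero_iff M.M.dif_closed M.M.gr_carrier)
    next
      case 2
      then show ?thesis using x
        by (intro bexI[of _ "\<zero>\<^bsub>M\<^esub>"]) (auto simp: cut_at_def M.M.diff_eq_zero_iff)
    qed
  qed (erule that, blast)
  have eh: "e x = hom_dif P M (i - 1) h x" if x: "x \<in> carrier P" for x
  proof -
    have rg: "PM.residual i e h \<in> hom_gr A P M i" by (rule PM.residual_hom[OF eg h(1)])
    have "PM.residual i e h x = \<zero>\<^bsub>M\<^esub>"
      using x
    proof (induction x rule: P.M.homogeneous_induct)
      case zero
      show ?case by (rule PM.H.hom_zero[OF rg])
    next
      case (add x y)
      then show ?case using hom_grD(2)[OF rg] by simp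
    next
      case (homogeneous n x)
      then show ?case using h(2) by blast
    qed
    moreover have "hom_dif P M (i - 1) h x \<in> carrier M" "e x \<in> carrier M"
      using hom_grD(1)[OF PM.H.hom_dif_closed[OF h(1)] x] hom_grD(1)[OF eg x] by auto
    ultimately show ?thesis
      using x M.M.diff_eq_zero_iff[of "e x" "hom_dif P M (i - 1) h x"]
      by (simp add: PM.residual_def signed_def M.M.minus_eq)
  qed
  \<comment> \<open>As \<open>f\<close> is a cocycle, its composition with the coboundary of \<open>s\<close> is, up to the sign of degree \<open>i\<close>,
    the coboundary of its composition with \<open>s\<close>.\<close>
  let ?fs = "\<lambda>x \<in> carrier P. f (s x)"
  have fs: "?fs \<in> hom_gr A P M (i - 1)"
    using hom_compose[OF fg s1 P.dg_mod_axioms P.dg_mod_axioms M] by (simp add: algebra_simps)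
  let ?k = "\<lambda>x \<in> carrier P. h x \<oplus>\<^bsub>M\<^esub> (\<lambda>x \<in> carrier P. signed M i (?fs x)) x"
  have k: "?k \<in> hom_gr A P M (i - 1)"
    by (rule PM.H.hom_add_closed[OF h(1) PM.H.hom_signed_closed[OF fs]])
  have "f x = hom_dif P M (i - 1) ?k x" if x: "x \<in> carrier P" for x
  proof -
    have dx: "dif P x \<in> carrier P" using x by (rule P.M.dif_closed)
    note c = sc[OF x] sc[OF dx] P.M.dif_closed[OF sc[OF x]] dx
    note fc = hom_grD(1)[OF fg x] hom_grD(1)[OF fg c(1)] hom_grD(1)[OF fg c(2)] hom_grD(1)[OF fg c(3)]
      hom_grD(1)[OF h(1) x] hom_grD(1)[OF h(1) dx]
    have "f (g x) = f x \<ominus>\<^bsub>M\<^esub> f (s (dif P x)) \<ominus>\<^bsub>M\<^esub> f (dif P (s x))"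
      using x c by (simp add: g PM.H.hom_diff[OF fg])
    then have "f x = f (g x) \<oplus>\<^bsub>M\<^esub> (f (s (dif P x)) \<oplus>\<^bsub>M\<^esub> f (dif P (s x)))"
      using fc by (simp add: M.M.minus_eq M.M.a_ac M.M.r_neg M.M.add_minus_self M.M.minus_add)
    also have "f (g x) = dif M (h x) \<ominus>\<^bsub>M\<^esub> signed M (i - 1) (h (dif P x))"
      using eh[OF x] x by (simp add: e_def PM.H.hom_dif_apply)
    finally have fx: "f x = (dif M (h x) \<ominus>\<^bsub>M\<^esub> signed M (i - 1) (h (dif P x))) \<oplus>\<^bsub>M\<^esub> (f (s (dif P x)) \<oplus>\<^bsub>M\<^esub> f (dif P (s x)))" .
    have kx: "hom_dif P M (i - 1) ?k x = dif M (h x \<oplus>\<^bsub>M\<^esub> signed M i (f (s x)))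
        \<ominus>\<^bsub>M\<^esub> signed M (i - 1) (h (dif P x) \<oplus>\<^bsub>M\<^esub> signed M i (f (s (dif P x))))"
      using x dx by (simp add: PM.H.hom_dif_apply)
    show ?thesis
      unfolding fx kx using fc M.M.dif_closed fd[OF c(1)]
      by (simp add: M.M.dif_distrib M.M.dif_signed M.M.signed_add M.M.signed_signed)
        (simp add: signed_def M.M.minus_eq M.M.minus_add M.M.a_ac)
  qed
  then have "f = hom_dif P M (i - 1) ?k"
    using hom_grD(5)[OF fg] by (intro extensionalityI[of _ "carrier P"]) (auto simp: hom_dif_def)
  then show ?thesis unfolding hom_cobounds_def using k by (rule image_eqI)
qed


section \<open>Resolutions of the residue field\<close>

text \<open>On cohomology \<open>q\<close> is injective, and its target is the residue field, which is concentrated in degree 0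
  and killed by \<open>m\<close>.\<close>

lemma residue_resolution:
  assumes P: "dg_mod A P" and m: "ideal m (H0 A)" and q: "quasi_iso A P (residue_mod A m) q"
  shows "0 < n \<Longrightarrow> cocycles P n \<subseteq> cobounds P n"
    and "\<lbrakk>a \<in> gr A 0; coh_class A 0 a \<in> m; y \<in> cocycles P 0\<rbrakk> \<Longrightarrow> act P a y \<in> cobounds P 0"
proof -
  interpret P: dg_mod A P by fact
  interpret H: cring "H0 A" by (rule P.A.H0_cring)
  interpret m: ideal m "H0 A" by fact
  let ?k = "H0 A Quot m" and ?K = "residue_mod A m"
  interpret k: ring ?k by (rule m.quotient_is_ring)
  have K: "carrier ?K = carrier ?k" "\<zero>\<^bsub>?K\<^esub> = \<zero>\<^bsub>?k\<^esub>" "\<And>x y. x \<oplus>\<^bsub>?K\<^esub> y = x \<oplus>\<^bsub>?k\<^esub> y"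
    "\<And>n. gr ?K n = (if n = 0 then carrier ?k else {\<zero>\<^bsub>?k\<^esub>})" "\<And>x. dif ?K x = \<zero>\<^bsub>?k\<^esub>"
    "\<And>a x. act ?K a x = (m +>\<^bsub>H0 A\<^esub> coh_class A 0 (hpart A 0 a)) \<otimes>\<^bsub>?k\<^esub> x"
    by (simp_all add: residue_mod_def Let_def)
  have Kab: "abelian_group ?K"
  proof (rule abelian_groupI)
    fix x assume "x \<in> carrier ?K"
    then show "\<exists>y\<in>carrier ?K. y \<oplus>\<^bsub>?K\<^esub> x = \<zero>\<^bsub>?K\<^esub>" unfolding K by (intro bexI[of _ "\<ominus>\<^bsub>?k\<^esub> x"]) (auto simp: k.l_neg)
  qed (simp_all add: K k.a_ac)
  interpret Ka: abelian_group ?K by (rule Kab)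
  have Kminus: "\<ominus>\<^bsub>?K\<^esub> x = \<ominus>\<^bsub>?k\<^esub> x" if "x \<in> carrier ?k" for x
    by (rule Ka.minus_equality) (use that in \<open>simp_all add: K k.l_neg\<close>)
  have Kc: "pre_complex ?K"
  proof (intro pre_complex.intro Kab pre_complex_axioms.intro)
    fix n show "additive_subgroup (gr ?K n) ?K"
      by (rule additive_subgroupI, rule Ka.add.subgroupI) (auto simp: K Kminus)
  qed (auto simp: K)
  interpret K: pre_complex ?K by (rule Kc)
  have qc: "q \<in> hom_cocycles A P ?K 0" and bij: "\<And>n. bij_betw (coh_map ?K n q) (carrier (coh P n)) (carrier (coh ?K n))"
    using q by (simp_all add: quasi_iso_def coh_map_def[abs_def])
  have qg: "q \<in> hom_gr A P ?K 0" using qc by (simp add: hom_cocycles_def)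
  note qcar = hom_grD(1)[OF qg]
  have qd: "q (dif P x) = \<zero>\<^bsub>?K\<^esub>" if x: "x \<in> carrier P" for x
  proof -
    have "hom_dif P ?K 0 q x = \<zero>\<^bsub>?K\<^esub>" using qc x by (simp add: hom_cocycles_def)
    then have "\<zero>\<^bsub>?K\<^esub> \<ominus>\<^bsub>?K\<^esub> q (dif P x) = \<zero>\<^bsub>?K\<^esub>"
      using x by (simp add: hom_dif_def signed_def K)
    then show ?thesis
      using Ka.diff_eq_zero_iff[OF Ka.zero_closed qcar[OF P.M.dif_closed[OF x]]] by simp
  qed
  have qcoc: "q x \<in> cocycles ?K n" if "x \<in> cocycles P n" for x n
    using hom_grD(3)[OF qg, of x n] that by (simp add: cocycles_def K)
  have cl: "coh_map ?K n q (coh_class P n x) = coh_class ?K n (q x)" if "x \<in> cocycles P n" for x n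
  proof (rule coh_map_class[OF P.M.pre_complex_axioms Kc qcoc _ _ that])
    show "q (x \<oplus>\<^bsub>P\<^esub> y) = q x \<oplus>\<^bsub>?K\<^esub> q y" if "x \<in> cocycles P n" "y \<in> cocycles P n" for x y
      using that hom_grD(2)[OF qg] P.M.cocycles_carrier by blast
    show "q x \<in> cobounds ?K n" if "x \<in> cobounds P n" for x
      using that qd P.M.gr_carrier by (auto simp: cobounds_def[of P])
  qed
  have q0: "q \<zero>\<^bsub>P\<^esub> = \<zero>\<^bsub>?K\<^esub>" using qd[of "\<zero>\<^bsub>P\<^esub>"] by simp
  have key: "x \<in> cobounds P n" if x: "x \<in> cocycles P n" "q x = \<zero>\<^bsub>?K\<^esub>" for x n
  proof -
    have "coh_map ?K n q (coh_class P n x) = coh_map ?K n q (coh_class P n \<zero>\<^bsub>P\<^esub>)"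
      using cl[OF x(1)] cl[OF P.M.cocycles_zero] x(2) q0 by simp
    then have "coh_class P n x = coh_class P n \<zero>\<^bsub>P\<^esub>"
      by (rule inj_onD[OF bij_betw_imp_inj_on[OF bij]]) (use x(1) P.coh_carrier in auto)
    then show ?thesis using P.M.coh_class_zero P.M.coh_class_eq_zero_iff[OF P.M.cocycles_carrier[OF x(1)]] by simp
  qed
  show "cocycles P n \<subseteq> cobounds P n" if n: "0 < n"
    using key qcoc n by (fastforce simp: cocycles_def[of ?K] K)
  show "act P a y \<in> cobounds P 0" if a: "a \<in> gr A 0" "coh_class A 0 a \<in> m" and y: "y \<in> cocycles P 0"
  proof (rule key[OF P.act0_cocycles[OF a(1) y]])
    have yc: "y \<in> carrier P" using y by (rule P.M.cocycles_carrier)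
    have "m +>\<^bsub>H0 A\<^esub> coh_class A 0 a = \<zero>\<^bsub>?k\<^esub>"
      using H.a_rcos_zero[OF m a(2)] by (simp add: FactRing_def)
    moreover have "q y \<in> carrier ?k" using qcar[OF yc] K by simp
    ultimately have "act ?K a (q y) = \<zero>\<^bsub>?K\<^esub>"
      using P.A.C.hpart_homog[OF a(1)] by (simp add: K)
    then show "q (act P a y) = \<zero>\<^bsub>?K\<^esub>"
      using hom_grD(4)[OF qg a(1) yc] by (simp add: signed_def)
  qed
qed

text \<open>A class of degree \<open>i\<close> is represented by a map that is not null-homotopic, so it is nonzero on some
  class of degree 0 of the resolution; as \<open>m\<close> kills this class, it kills its image \<open>z\<close>.\<close>

lemma RHom_residue_bottom:
  assumes M: "pre_dg_mod A M" and m: "ideal m (H0 A)"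
    and low: "\<And>n. n < i \<Longrightarrow> \<not> coh_nonzero M n"
    and R: "RHom_nonzero A (residue_mod A m) M i"
  obtains z where "z \<in> cocycles M i" "z \<notin> cobounds M i"
    "\<And>a. \<lbrakk>a \<in> gr A 0; coh_class A 0 a \<in> m\<rbrakk> \<Longrightarrow> act M a z \<in> cobounds M i"
proof -
  interpret M: pre_dg_mod A M by fact
  obtain P :: "('a, ('a + 'a set set) list) dg_module" and q where P: "semifree A P" "quasi_iso A P (residue_mod A m) q"
    and ne: "hom_cocycles A P M i \<noteq> hom_cobounds A P M i"
    using R unfolding RHom_nonzero_def by blast
  interpret P: dg_mod A P using P by (simp add: semifree_def)
  interpret H: hom_complex A P M by (intro hom_complex.intro P.dg_mod_axioms M)
  obtain f where f: "f \<in> hom_cocycles A P M i" "f \<notin> hom_cobounds A P M i"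
    using ne H.hom_cobounds_subset_cocycles by blast
  note fg = H.hom_cocycleD(1)[OF f(1)] and fd = H.hom_cocycleD(2)[OF f(1)]
  note r = residue_resolution[OF P.dg_mod_axioms m P(2)]
  have Mlow: "cocycles M n \<subseteq> cobounds M n" if "n < i" for n
    using low[OF that] M.coh_nonzero_iff by blast
  obtain y where y: "y \<in> cocycles P 0" "f y \<notin> cobounds M i"
    using semifree_hom_vanishing_on_bottom[OF P(1) M r(1) Mlow f(1)] f(2) by blast
  have bd: "f x \<in> cobounds M i" if "x \<in> cobounds P 0" for x
  proof -
    obtain w where w: "w \<in> gr P (-1)" "x = dif P w" using \<open>x \<in> cobounds P 0\<close> by (auto simp: cobounds_def)
    note wc = P.M.gr_carrier[OF w(1)]
    have "f x = signed M i (dif M (f w))"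
      using fd[OF wc] w(2) hom_grD(1)[OF fg P.M.dif_closed[OF wc]] by (simp add: M.M.signed_signed) (simp add: signed_def)
    also have "\<dots> = dif M (signed M i (f w))" using hom_grD(1)[OF fg wc] by (simp add: M.M.dif_signed)
    also have "\<dots> \<in> cobounds M i"
      using M.M.dif_in_cobounds[OF M.M.signed_gr[OF hom_grD(3)[OF fg w(1)]]] by simp
    finally show ?thesis .
  qed
  show thesis
  proof (rule that[OF _ y(2)])
    have "f y \<in> gr M i" using hom_grD(3)[OF fg, of y 0] y(1) by (simp add: cocycles_def)
    moreover have "dif M (f y) = \<zero>\<^bsub>M\<^esub>"
      using fd[OF P.M.cocycles_carrier[OF y(1)]] y(1) H.hom_zero[OF fg] by (simp add: cocycles_def)
    ultimately show "f y \<in> cocycles M i" by (simp add: cocycles_def)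
  next
    fix a assume a: "a \<in> gr A 0" "coh_class A 0 a \<in> m"
    have "f (act P a y) = act M a (f y)"
      using hom_grD(4)[OF fg a(1) P.M.cocycles_carrier[OF y(1)]] by (simp add: signed_def)
    then show "act M a (f y) \<in> cobounds M i" using bd[OF r(2)[OF a y(1)]] by simp
  qed
qed


section \<open>Modules of fractions\<close>

locale fractions = pre_dg_mod A M
  for A :: "('a, 'z) dg_scheme" and M :: "('a, 'm, 'y) dg_module_scheme" +
  fixes S :: "'a set"
  assumes denom_gr0: "s \<in> S \<Longrightarrow> s \<in> gr A 0"
    and denom_one: "\<one>\<^bsub>A\<^esub> \<in> S"
    and denom_mult: "\<lbrakk>s \<in> S; t \<in> S\<rbrakk> \<Longrightarrow> s \<otimes>\<^bsub>A\<^esub> t \<in> S"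
begin

abbreviation F where "F \<equiv> frac S (carrier M) (act M)"

lemma denom_carrier: "s \<in> S \<Longrightarrow> s \<in> carrier A"
  using denom_gr0 A.C.gr_carrier by blast

lemma denom_act: "\<lbrakk>s \<in> S; x \<in> carrier M\<rbrakk> \<Longrightarrow> act M s x \<in> carrier M"
  by (simp add: act_carrier denom_carrier)

lemma denom_comm: "\<lbrakk>s \<in> S; a \<in> carrier A\<rbrakk> \<Longrightarrow> a \<otimes>\<^bsub>A\<^esub> s = s \<otimes>\<^bsub>A\<^esub> a"
  by (rule A.gr0_commute[OF denom_gr0])

lemma denom_act_mult: "\<lbrakk>s \<in> S; t \<in> S; x \<in> carrier M\<rbrakk> \<Longrightarrow> act M (s \<otimes>\<^bsub>A\<^esub> t) x = act M s (act M t x)"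
  by (simp add: act_mult denom_carrier)

lemma denom_act_commute: "\<lbrakk>s \<in> S; t \<in> S; x \<in> carrier M\<rbrakk> \<Longrightarrow> act M s (act M t x) = act M t (act M s x)"
  by (simp add: act0_commute denom_gr0 denom_carrier)

lemma mem_F: "(y, t) \<in> F x s \<longleftrightarrow> x \<in> carrier M \<and> y \<in> carrier M \<and> s \<in> S \<and> t \<in> S \<and>
    (\<exists>u \<in> S. act M u (act M t x) = act M u (act M s y))"
  by (auto simp: frac_def frac_rel_def)

lemma F_sym: "(y, t) \<in> F x s \<Longrightarrow> (x, s) \<in> F y t"
  by (auto simp: mem_F) metis

lemma F_trans:
  assumes xy: "(y, t) \<in> F x s" and yz: "(z, r) \<in> F y t"
  shows "(z, r) \<in> F x s"
proof -
  obtain u v where u: "u \<in> S" "act M u (act M t x) = act M u (act M s y)"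
    and v: "v \<in> S" "act M v (act M r y) = act M v (act M t z)" using xy yz by (auto simp: mem_F)
  have c: "x \<in> carrier M" "y \<in> carrier M" "z \<in> carrier M" "s \<in> S" "t \<in> S" "r \<in> S"
    using xy yz by (auto simp: mem_F)
  let ?w = "u \<otimes>\<^bsub>A\<^esub> (v \<otimes>\<^bsub>A\<^esub> t)"
  have "act M ?w (act M r x) = act M v (act M r (act M u (act M t x)))"
    using c u(1) v(1) by (simp add: denom_act_mult denom_mult denom_act denom_act_commute)
  also have "\<dots> = act M v (act M r (act M u (act M s y)))" by (simp only: u(2))
  also have "\<dots> = act M u (act M s (act M v (act M r y)))"
    using c u(1) v(1) by (simp add: denom_act denom_act_commute)
  also have "\<dots> = act M u (act M s (act M v (act M t z)))" by (simp only: v(2))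
  also have "\<dots> = act M ?w (act M s z)"
    using c u(1) v(1) by (simp add: denom_act_mult denom_mult denom_act denom_act_commute)
  finally show ?thesis using c u(1) v(1) denom_mult by (auto simp: mem_F)
qed

lemma F_self: "\<lbrakk>x \<in> carrier M; s \<in> S\<rbrakk> \<Longrightarrow> (x, s) \<in> F x s"
  using denom_one by (auto simp: mem_F)

lemma F_eqI: "(y, t) \<in> F x s \<Longrightarrow> F y t = F x s"
  using F_trans[of y t x s] F_trans[of x s y t] F_sym[of y t x s] by auto

lemma F_eq_iff:
  assumes "x \<in> carrier M" "y \<in> carrier M" "s \<in> S" "t \<in> S"
  shows "F x s = F y t \<longleftrightarrow> (\<exists>u \<in> S. act M u (act M t x) = act M u (act M s y))"
proof
  assume "F x s = F y t"
  then have "(y, t) \<in> F x s" using F_self[of y t] assms by simp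
  then show "\<exists>u \<in> S. act M u (act M t x) = act M u (act M s y)" by (simp add: mem_F)
next
  assume "\<exists>u \<in> S. act M u (act M t x) = act M u (act M s y)"
  then have "(y, t) \<in> F x s" using assms by (simp add: mem_F)
  then show "F x s = F y t" using F_eqI by simp
qed

lemma F_expand:
  assumes "x \<in> carrier M" "s \<in> S" "r \<in> S"
  shows "F (act M r x) (r \<otimes>\<^bsub>A\<^esub> s) = F x s" "F (act M r x) (s \<otimes>\<^bsub>A\<^esub> r) = F x s"
proof -
  show "F (act M r x) (r \<otimes>\<^bsub>A\<^esub> s) = F x s"
    using assms denom_one
    by (subst F_eq_iff) (auto simp: denom_act denom_mult denom_act_mult denom_act_commute intro!: bexI[of _ "\<one>\<^bsub>A\<^esub>"])
  then show "F (act M r x) (s \<otimes>\<^bsub>A\<^esub> r) = F x s" using assms by (simp add: denom_comm denom_carrier)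
qed

lemma F_eq_zero_iff:
  assumes "x \<in> carrier M" "s \<in> S"
  shows "F x s = F \<zero>\<^bsub>M\<^esub> \<one>\<^bsub>A\<^esub> \<longleftrightarrow> (\<exists>u \<in> S. act M u x = \<zero>\<^bsub>M\<^esub>)"
  using assms denom_one
  by (subst F_eq_iff) (auto simp: act_unit act_zero_right denom_carrier)

lemma F_zero: "s \<in> S \<Longrightarrow> F \<zero>\<^bsub>M\<^esub> s = F \<zero>\<^bsub>M\<^esub> \<one>\<^bsub>A\<^esub>"
  using denom_one by (subst F_eq_zero_iff) (auto intro!: bexI[of _ "\<one>\<^bsub>A\<^esub>"] simp: act_unit)

text \<open>Two equal fractions have a common expansion. So a construction on fractions is well defined as soon as it
  does not change when a fraction is expanded.\<close>

lemma UN_F_const: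
  assumes inv: "\<And>x s r. \<lbrakk>x \<in> carrier M; s \<in> S; r \<in> S\<rbrakk> \<Longrightarrow> G (act M r x) (r \<otimes>\<^bsub>A\<^esub> s) = G x s"
    and x: "x \<in> carrier M" "s \<in> S"
  shows "(\<Union>(y, t) \<in> F x s. G y t) = G x s"
proof (rule equalityI)
  have "G y t = G x s" if yt: "(y, t) \<in> F x s" for y t
  proof -
    obtain u where u: "u \<in> S" "act M u (act M t x) = act M u (act M s y)" and y: "y \<in> carrier M" "t \<in> S"
      using yt by (auto simp: mem_F)
    have "act M (u \<otimes>\<^bsub>A\<^esub> t) x = act M (u \<otimes>\<^bsub>A\<^esub> s) y" using u x y by (simp add: denom_act_mult)
    moreover have "(u \<otimes>\<^bsub>A\<^esub> t) \<otimes>\<^bsub>A\<^esub> s = (u \<otimes>\<^bsub>A\<^esub> s) \<otimes>\<^bsub>A\<^esub> t"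
      using u x y by (simp add: A.R.m_assoc denom_carrier denom_comm[of t s])
    ultimately show ?thesis
      using inv[OF x, of "u \<otimes>\<^bsub>A\<^esub> t"] inv[OF y, of "u \<otimes>\<^bsub>A\<^esub> s"] u x y by (simp add: denom_mult)
  qed
  then show "(\<Union>(y, t) \<in> F x s. G y t) \<subseteq> G x s" by blast
  show "G x s \<subseteq> (\<Union>(y, t) \<in> F x s. G y t)" using F_self[OF x] by blast
qed

end

lemma (in dg_ring) self_pre_dg_mod: "pre_dg_mod A (self_mod A)"
proof -
  have ab: "abelian_group (self_mod A)"
  proof (rule abelian_groupI)
    fix x assume "x \<in> carrier (self_mod A)"
    then show "\<exists>y\<in>carrier (self_mod A). y \<oplus>\<^bsub>self_mod A\<^esub> x = \<zero>\<^bsub>self_mod A\<^esub>"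
      by (intro bexI[of _ "\<ominus> x"]) (auto simp: self_mod_def l_neg)
  qed (auto simp: self_mod_def a_ac)
  interpret S: abelian_group "self_mod A" by (rule ab)
  have minus: "\<ominus>\<^bsub>self_mod A\<^esub> x = \<ominus> x" if "x \<in> carrier A" for x
    by (rule S.minus_equality) (use that in \<open>auto simp: self_mod_def l_neg\<close>)
  show ?thesis
  proof (intro pre_dg_mod.intro pre_complex.intro pre_complex_axioms.intro pre_dg_mod_axioms.intro
      dg_ring_axioms ab)
    fix n show "additive_subgroup (gr (self_mod A) n) (self_mod A)"
    proof (rule additive_subgroupI, rule S.add.subgroupI)
      have "\<zero> \<in> gr (self_mod A) n" by (simp add: self_mod_def)
      then show "gr (self_mod A) n \<noteq> {}" by blast
    qed (auto simp: self_mod_def gr_carrier gr_add minus[unfolded self_mod_def] gr_minus)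
  next
    fix a i x assume "a \<in> gr A i" "x \<in> carrier (self_mod A)"
    then show "dif (self_mod A) (act (self_mod A) a x) =
        act (self_mod A) (dif A a) x \<oplus>\<^bsub>self_mod A\<^esub> signed (self_mod A) i (act (self_mod A) a (dif (self_mod A) x))"
      using leibniz[of a i x] minus gr_carrier dif_closed by (auto simp: self_mod_def signed_def)
  qed (auto simp: self_mod_def dif_closed dif_distrib dif_degree dif_square mult_gr l_distr r_distr m_assoc)
qed

locale localization_at_prime = pre_dg_mod A M
  for A :: "('a, 'z) dg_scheme" and M :: "('a, 'm, 'y) dg_module_scheme" +
  fixes p :: "'a set set"
  assumes prime: "primeideal p (H0 A)"
begin

abbreviation S where "S \<equiv> denoms A p"

lemma denoms_iff: "s \<in> S \<longleftrightarrow> s \<in> gr A 0 \<and> coh_class A 0 s \<notin> p"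
  by (auto simp: denoms_def prime_preimage_def)

lemma denoms_gr0: "s \<in> S \<Longrightarrow> s \<in> gr A 0"
  by (simp add: denoms_iff)

lemma denoms_one: "\<one>\<^bsub>A\<^esub> \<in> S"
proof -
  interpret p: primeideal p "H0 A" by (rule prime)
  have "coh_class A 0 \<one>\<^bsub>A\<^esub> \<notin> p" using p.one_imp_carrier p.I_notcarr A.H0_one by auto
  then show ?thesis using A.one_gr by (simp add: denoms_iff)
qed

lemma denoms_mult: "\<lbrakk>s \<in> S; t \<in> S\<rbrakk> \<Longrightarrow> s \<otimes>\<^bsub>A\<^esub> t \<in> S"
  using primeideal.I_prime[OF prime, of "coh_class A 0 s" "coh_class A 0 t"]
  by (auto simp: denoms_iff A.gr0_mult A.H0_mult A.H0_carrier)

sublocale X: fractions A M S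
  by (intro fractions.intro fractions_axioms.intro pre_dg_mod_axioms)
    (simp_all add: denoms_gr0 denoms_one denoms_mult)

sublocale Y: fractions A "self_mod A" S
  by (intro fractions.intro fractions_axioms.intro A.self_pre_dg_mod)
    (simp_all add: denoms_gr0 denoms_one denoms_mult)

abbreviation L where "L \<equiv> loc_ring A p"
abbreviation N where "N \<equiv> loc_mod A p M"

lemma N_simps:
  "carrier N = {X.F x s | x s. x \<in> carrier M \<and> s \<in> S}"
  "\<zero>\<^bsub>N\<^esub> = X.F \<zero>\<^bsub>M\<^esub> \<one>\<^bsub>A\<^esub>"
  "gr N n = {X.F x s | x s. x \<in> gr M n \<and> s \<in> S}"
  by (simp_all add: loc_mod_def Let_def)

lemma L_simps:
  "carrier L = {Y.F a s | a s. a \<in> carrier A \<and> s \<in> S}"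
  "gr L n = {Y.F a s | a s. a \<in> gr A n \<and> s \<in> S}"
  "\<one>\<^bsub>L\<^esub> = Y.F \<one>\<^bsub>A\<^esub> \<one>\<^bsub>A\<^esub>"
  "\<zero>\<^bsub>L\<^esub> = Y.F \<zero>\<^bsub>A\<^esub> \<one>\<^bsub>A\<^esub>"
  by (simp_all add: loc_ring_def Let_def self_mod_def)

lemma N_dif: "\<lbrakk>x \<in> carrier M; s \<in> S\<rbrakk> \<Longrightarrow> dif N (X.F x s) = X.F (dif M x) s"
  using X.UN_F_const[of "\<lambda>x s. X.F (dif M x) s" x s]
  by (simp add: loc_mod_def Let_def dif_act0 denoms_gr0 M.dif_closed X.F_expand)

lemma N_add:
  assumes "x \<in> carrier M" "s \<in> S" "y \<in> carrier M" "t \<in> S"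
  shows "X.F x s \<oplus>\<^bsub>N\<^esub> X.F y t = X.F (act M t x \<oplus>\<^bsub>M\<^esub> act M s y) (s \<otimes>\<^bsub>A\<^esub> t)"
proof -
  let ?G = "\<lambda>x s y t. X.F (act M t x \<oplus>\<^bsub>M\<^esub> act M s y) (s \<otimes>\<^bsub>A\<^esub> t)"
  have inv: "?G (act M r x) (r \<otimes>\<^bsub>A\<^esub> s) y t = ?G x s y t" "?G y t (act M r x) (r \<otimes>\<^bsub>A\<^esub> s) = ?G y t x s"
    if h: "x \<in> carrier M" "s \<in> S" "r \<in> S" "y \<in> carrier M" "t \<in> S" for x s r y t
  proof -
    have ex: "X.F (act M r v) (r \<otimes>\<^bsub>A\<^esub> d) = X.F v d" if "v \<in> carrier M" "d \<in> S" for v d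
      using X.F_expand(1)[OF that h(3)] .
    have rc: "r \<in> carrier A" "s \<in> carrier A" "t \<in> carrier A" using h X.denom_carrier by auto
    have "act M t (act M r x) \<oplus>\<^bsub>M\<^esub> act M (r \<otimes>\<^bsub>A\<^esub> s) y = act M r (act M t x \<oplus>\<^bsub>M\<^esub> act M s y)"
      using h rc by (simp add: act_add_right X.denom_act X.denom_act_mult X.denom_act_commute[of t r])
    then show "?G (act M r x) (r \<otimes>\<^bsub>A\<^esub> s) y t = ?G x s y t"
      using ex[of "act M t x \<oplus>\<^bsub>M\<^esub> act M s y" "s \<otimes>\<^bsub>A\<^esub> t"] h rc by (simp add: X.denom_act denoms_mult A.R.m_assoc)
    have "act M (r \<otimes>\<^bsub>A\<^esub> s) y \<oplus>\<^bsub>M\<^esub> act M t (act M r x) = act M r (act M s y \<oplus>\<^bsub>M\<^esub> act M t x)"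
      using h rc by (simp add: act_add_right X.denom_act X.denom_act_mult X.denom_act_commute[of t r])
    moreover have "t \<otimes>\<^bsub>A\<^esub> (r \<otimes>\<^bsub>A\<^esub> s) = r \<otimes>\<^bsub>A\<^esub> (t \<otimes>\<^bsub>A\<^esub> s)"
      using h rc by (simp add: A.R.m_assoc[symmetric] X.denom_comm[of t r])
    ultimately show "?G y t (act M r x) (r \<otimes>\<^bsub>A\<^esub> s) = ?G y t x s"
      using ex[of "act M s y \<oplus>\<^bsub>M\<^esub> act M t x" "t \<otimes>\<^bsub>A\<^esub> s"] h rc by (simp add: X.denom_act denoms_mult)
  qed
  have inner: "(\<Union>(y', t') \<in> X.F y t. ?G x' s' y' t') = ?G x' s' y t" if "x' \<in> carrier M" "s' \<in> S" for x' s'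
    by (rule X.UN_F_const[OF inv(2) assms(3,4)]) (use that in auto)
  have "X.F x s \<oplus>\<^bsub>N\<^esub> X.F y t = (\<Union>(x', s') \<in> X.F x s. \<Union>(y', t') \<in> X.F y t. ?G x' s' y' t')"
    by (simp add: loc_mod_def Let_def)
  also have "\<dots> = (\<Union>(y', t') \<in> X.F y t. ?G x s y' t')"
    by (rule X.UN_F_const[OF _ assms(1,2)]) (simp add: inner inv(1) assms(3,4) X.denom_act denoms_mult)
  also have "\<dots> = ?G x s y t" by (rule inner[OF assms(1,2)])
  finally show ?thesis .
qed

lemma self_localization: "localization_at_prime A (self_mod A) p"
  by (intro localization_at_prime.intro localization_at_prime_axioms.intro A.self_pre_dg_mod prime)

lemma L_dif: "\<lbrakk>a \<in> carrier A; s \<in> S\<rbrakk> \<Longrightarrow> dif L (Y.F a s) = Y.F (dif A a) s"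
  using localization_at_prime.N_dif[OF self_localization, of a s]
  by (simp add: loc_ring_def loc_mod_def self_mod_def Let_def)

lemma L_add_gen:
  assumes "a \<in> carrier A" "s \<in> S" "b \<in> carrier A" "t \<in> S"
  shows "Y.F a s \<oplus>\<^bsub>L\<^esub> Y.F b t = Y.F ((t \<otimes>\<^bsub>A\<^esub> a) \<oplus>\<^bsub>A\<^esub> (s \<otimes>\<^bsub>A\<^esub> b)) (s \<otimes>\<^bsub>A\<^esub> t)"
proof -
  interpret SM: localization_at_prime A "self_mod A" p by (rule self_localization)
  have "Y.F a s \<oplus>\<^bsub>L\<^esub> Y.F b t = Y.F a s \<oplus>\<^bsub>loc_mod A p (self_mod A)\<^esub> Y.F b t"
    by (simp add: loc_ring_def loc_mod_def self_mod_def Let_def)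
  then show ?thesis using SM.N_add[of a s b t] assms by (simp add: self_mod_def)
qed

lemma N_grI: "\<lbrakk>x \<in> gr M n; s \<in> S\<rbrakk> \<Longrightarrow> X.F x s \<in> gr N n"
  by (auto simp: N_simps)

lemma N_carrierI: "\<lbrakk>x \<in> carrier M; s \<in> S\<rbrakk> \<Longrightarrow> X.F x s \<in> carrier N"
  by (auto simp: N_simps)

lemma N_act:
  assumes "a \<in> carrier A" "s \<in> S" "y \<in> carrier M" "t \<in> S"
  shows "act N (Y.F a s) (X.F y t) = X.F (act M a y) (s \<otimes>\<^bsub>A\<^esub> t)"
proof -
  let ?G = "\<lambda>a s y t. X.F (act M a y) (s \<otimes>\<^bsub>A\<^esub> t)"
  have inv: "?G (r \<otimes>\<^bsub>A\<^esub> a) (r \<otimes>\<^bsub>A\<^esub> s) y t = ?G a s y t" "?G a s (act M r y) (r \<otimes>\<^bsub>A\<^esub> t) = ?G a s y t"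
    if h: "a \<in> carrier A" "s \<in> S" "r \<in> S" "y \<in> carrier M" "t \<in> S" for a s r y t
  proof -
    have rc: "r \<in> carrier A" "s \<in> carrier A" "t \<in> carrier A" using h X.denom_carrier by auto
    have ex: "X.F (act M r (act M a y)) (r \<otimes>\<^bsub>A\<^esub> (s \<otimes>\<^bsub>A\<^esub> t)) = X.F (act M a y) (s \<otimes>\<^bsub>A\<^esub> t)"
      using h by (intro X.F_expand(1)) (auto simp: act_carrier denoms_mult)
    show "?G (r \<otimes>\<^bsub>A\<^esub> a) (r \<otimes>\<^bsub>A\<^esub> s) y t = ?G a s y t"
      using ex h rc by (simp add: act_mult A.R.m_assoc)
    have "s \<otimes>\<^bsub>A\<^esub> (r \<otimes>\<^bsub>A\<^esub> t) = r \<otimes>\<^bsub>A\<^esub> (s \<otimes>\<^bsub>A\<^esub> t)"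
      using h rc by (simp add: A.R.m_assoc[symmetric] X.denom_comm[of s r])
    then show "?G a s (act M r y) (r \<otimes>\<^bsub>A\<^esub> t) = ?G a s y t"
      using ex act0_commute[OF denoms_gr0[OF h(3)] h(1,4)] by simp
  qed
  have inner: "(\<Union>(y', t') \<in> X.F y t. ?G a' s' y' t') = ?G a' s' y t" if "a' \<in> carrier A" "s' \<in> S" for a' s'
    by (rule X.UN_F_const[OF inv(2) assms(3,4)]) (use that in auto)
  have "act N (Y.F a s) (X.F y t) = (\<Union>(a', s') \<in> Y.F a s. \<Union>(y', t') \<in> X.F y t. ?G a' s' y' t')"
    by (simp add: loc_mod_def Let_def)
  also have "\<dots> = (\<Union>(y', t') \<in> X.F y t. ?G a s y' t')"
  proof (rule Y.UN_F_const)
    fix b r' r assume h: "b \<in> carrier (self_mod A)" "r' \<in> S" "r \<in> S"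
    then have "act (self_mod A) r b = r \<otimes>\<^bsub>A\<^esub> b" "b \<in> carrier A" "r \<otimes>\<^bsub>A\<^esub> b \<in> carrier A"
      using X.denom_carrier by (simp_all add: self_mod_def)
    then show "(\<Union>(y', t') \<in> X.F y t. ?G (act (self_mod A) r b) (r \<otimes>\<^bsub>A\<^esub> r') y' t') = (\<Union>(y', t') \<in> X.F y t. ?G b r' y' t')"
      using inner inv(1)[of b r' r y t] h(2,3) assms(3,4) denoms_mult by simp
  qed (use assms in \<open>simp_all add: self_mod_def\<close>)
  also have "\<dots> = ?G a s y t" by (rule inner[OF assms(1,2)])
  finally show ?thesis .
qed

lemma L_mult:
  assumes "a \<in> carrier A" "s \<in> S" "b \<in> carrier A" "t \<in> S"
  shows "Y.F a s \<otimes>\<^bsub>L\<^esub> Y.F b t = Y.F (a \<otimes>\<^bsub>A\<^esub> b) (s \<otimes>\<^bsub>A\<^esub> t)"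
proof -
  interpret SM: localization_at_prime A "self_mod A" p by (rule self_localization)
  have "Y.F a s \<otimes>\<^bsub>L\<^esub> Y.F b t = act (loc_mod A p (self_mod A)) (Y.F a s) (Y.F b t)"
    by (simp add: loc_ring_def loc_mod_def self_mod_def Let_def)
  then show ?thesis using SM.N_act[of a s b t] assms by (simp add: self_mod_def)
qed

text \<open>Any two or three fractions have a common denominator, and over a common denominator fractions are
  added by adding numerators. This reduces the module axioms to those of \<open>M\<close>.\<close>

lemma N_add_same:
  assumes "x \<in> carrier M" "y \<in> carrier M" "s \<in> S"
  shows "X.F x s \<oplus>\<^bsub>N\<^esub> X.F y s = X.F (x \<oplus>\<^bsub>M\<^esub> y) s"
  using N_add[OF assms(1,3,2,3)] X.F_expand(1)[of "x \<oplus>\<^bsub>M\<^esub> y" s s] assms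
  by (simp add: act_add_right[symmetric] X.denom_carrier)

lemma L_add_same:
  assumes "a \<in> carrier A" "b \<in> carrier A" "s \<in> S"
  shows "Y.F a s \<oplus>\<^bsub>L\<^esub> Y.F b s = Y.F (a \<oplus>\<^bsub>A\<^esub> b) s"
  using L_add_gen[OF assms(1,3,2,3)] Y.F_expand(1)[of "a \<oplus>\<^bsub>A\<^esub> b" s s] assms
  by (simp add: A.R.r_distr[symmetric] X.denom_carrier self_mod_def)

lemma N_common_carrier:
  assumes X: "X \<in> carrier N" and Y: "Y \<in> carrier N"
  obtains x y s where "x \<in> carrier M" "y \<in> carrier M" "s \<in> S" "X = X.F x s" "Y = X.F y s"
proof -
  obtain x s y t where "x \<in> carrier M" "s \<in> S" "X = X.F x s" "y \<in> carrier M" "t \<in> S" "Y = X.F y t"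
    using X Y by (auto simp: N_simps)
  then show thesis
    by (intro that[of "act M t x" "act M s y" "s \<otimes>\<^bsub>A\<^esub> t"])
      (auto simp: X.denom_act X.denom_mult X.F_expand)
qed

lemma N_common3:
  assumes X: "X \<in> carrier N" and Y: "Y \<in> carrier N" and Z: "Z \<in> carrier N"
  obtains x y z s where "x \<in> carrier M" "y \<in> carrier M" "z \<in> carrier M" "s \<in> S"
    "X = X.F x s" "Y = X.F y s" "Z = X.F z s"
proof -
  obtain x y s where 1: "x \<in> carrier M" "y \<in> carrier M" "s \<in> S" "X = X.F x s" "Y = X.F y s"
    using X Y by (rule N_common_carrier)
  obtain z t where 2: "z \<in> carrier M" "t \<in> S" "Z = X.F z t" using Z by (auto simp: N_simps)
  show thesis
    by (rule that[of "act M t x" "act M t y" "act M s z" "s \<otimes>\<^bsub>A\<^esub> t"])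
      (use 1 2 in \<open>simp_all add: X.denom_act X.denom_mult X.F_expand\<close>)
qed

lemma L_common_carrier:
  assumes X: "X \<in> carrier L" and Y: "Y \<in> carrier L"
  obtains a b s where "a \<in> carrier A" "b \<in> carrier A" "s \<in> S" "X = Y.F a s" "Y = Y.F b s"
proof -
  interpret SM: localization_at_prime A "self_mod A" p by (rule self_localization)
  have "X \<in> carrier SM.N" "Y \<in> carrier SM.N" using X Y unfolding SM.N_simps(1) L_simps(1) by (simp_all add: self_mod_def)
  then show thesis by (rule SM.N_common_carrier) (rule that, simp_all add: self_mod_def)
qed

lemma N_abelian_group: "abelian_group N"
proof (rule abelian_groupI)
  fix X Y Z assume "X \<in> carrier N" "Y \<in> carrier N" "Z \<in> carrier N"
  then show "X \<oplus>\<^bsub>N\<^esub> Y \<oplus>\<^bsub>N\<^esub> Z = X \<oplus>\<^bsub>N\<^esub> (Y \<oplus>\<^bsub>N\<^esub> Z)"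
    by (rule N_common3) (simp add: N_add_same M.a_assoc)
next
  fix X Y assume XY: "X \<in> carrier N" "Y \<in> carrier N"
  then obtain x y s where "x \<in> carrier M" "y \<in> carrier M" "s \<in> S" "X = X.F x s" "Y = X.F y s"
    by (rule N_common_carrier)
  then show "X \<oplus>\<^bsub>N\<^esub> Y = Y \<oplus>\<^bsub>N\<^esub> X" "X \<oplus>\<^bsub>N\<^esub> Y \<in> carrier N"
    by (auto simp: N_add_same M.a_comm N_simps)
next
  show "\<zero>\<^bsub>N\<^esub> \<in> carrier N" using denoms_one by (auto simp: N_simps)
next
  fix X assume "X \<in> carrier N"
  then obtain x s where x: "x \<in> carrier M" "s \<in> S" "X = X.F x s" by (auto simp: N_simps)
  have z: "\<zero>\<^bsub>N\<^esub> = X.F \<zero>\<^bsub>M\<^esub> s" using X.F_zero[OF x(2)] by (simp add: N_simps)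
  show "\<zero>\<^bsub>N\<^esub> \<oplus>\<^bsub>N\<^esub> X = X" unfolding z using x by (simp add: N_add_same)
  show "\<exists>Y\<in>carrier N. Y \<oplus>\<^bsub>N\<^esub> X = \<zero>\<^bsub>N\<^esub>"
    unfolding z using x by (intro bexI[of _ "X.F (\<ominus>\<^bsub>M\<^esub> x) s"]) (auto simp: N_add_same M.l_neg N_simps)
qed

lemma N_minus: "\<lbrakk>x \<in> carrier M; s \<in> S\<rbrakk> \<Longrightarrow> \<ominus>\<^bsub>N\<^esub> X.F x s = X.F (\<ominus>\<^bsub>M\<^esub> x) s"
  by (rule abelian_group.minus_equality[OF N_abelian_group])
    (auto simp: N_add_same M.l_neg N_simps X.F_zero)

lemma N_signed: "\<lbrakk>x \<in> carrier M; s \<in> S\<rbrakk> \<Longrightarrow> signed N i (X.F x s) = X.F (signed M i x) s"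
  by (simp add: signed_def N_minus)

lemma N_pre_dg_mod:
  assumes L: "dg_ring L"
  shows "pre_dg_mod L N"
proof (intro pre_dg_mod.intro pre_complex.intro pre_complex_axioms.intro pre_dg_mod_axioms.intro
    L N_abelian_group)
  interpret N: abelian_group N by (rule N_abelian_group)
  fix n show "additive_subgroup (gr N n) N"
  proof (rule additive_subgroupI, rule N.add.subgroupI)
    show "gr N n \<subseteq> carrier N" using M.gr_carrier by (auto simp: N_simps)
    show "gr N n \<noteq> {}" using M.gr_zero[of n] denoms_one unfolding N_simps by blast
  next
    fix X assume "X \<in> gr N n"
    then obtain x s where "x \<in> gr M n" "s \<in> S" "X = X.F x s" by (auto simp: N_simps)
    then show "\<ominus>\<^bsub>N\<^esub> X \<in> gr N n" by (simp add: N_minus M.gr_carrier N_grI M.gr_minus)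
  next
    fix X Y assume "X \<in> gr N n" "Y \<in> gr N n"
    then obtain x s y t where x: "x \<in> gr M n" "s \<in> S" "X = X.F x s" and y: "y \<in> gr M n" "t \<in> S" "Y = X.F y t"
      by (auto simp: N_simps)
    then have "X \<oplus>\<^bsub>N\<^esub> Y = X.F (act M t x \<oplus>\<^bsub>M\<^esub> act M s y) (s \<otimes>\<^bsub>A\<^esub> t)"
      by (simp add: N_add M.gr_carrier)
    then show "X \<oplus>\<^bsub>N\<^esub> Y \<in> gr N n"
      using x y by (simp add: N_grI M.gr_add act_gr0_degree denoms_gr0 denoms_mult)
  qed
next
  fix X assume "X \<in> carrier N"
  then obtain x s where x: "x \<in> carrier M" "s \<in> S" "X = X.F x s" by (auto simp: N_simps)
  then show "dif N X \<in> carrier N" by (simp add: N_dif N_carrierI M.dif_closed)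
  show "dif N (dif N X) = \<zero>\<^bsub>N\<^esub>" using x by (simp add: N_dif M.dif_closed M.dif_square X.F_zero N_simps)
  have "act N \<one>\<^bsub>L\<^esub> X = X"
    using x denoms_one N_act[of "\<one>\<^bsub>A\<^esub>" "\<one>\<^bsub>A\<^esub>" x s] X.denom_carrier by (simp add: L_simps act_unit)
  then show "act N \<one>\<^bsub>L\<^esub> X = X" .
next
  fix X Y assume "X \<in> carrier N" "Y \<in> carrier N"
  then obtain x y s where "x \<in> carrier M" "y \<in> carrier M" "s \<in> S" "X = X.F x s" "Y = X.F y s"
    by (rule N_common_carrier)
  then show "dif N (X \<oplus>\<^bsub>N\<^esub> Y) = dif N X \<oplus>\<^bsub>N\<^esub> dif N Y"
    by (simp add: N_add_same N_dif M.dif_closed M.dif_distrib)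
next
  fix X n assume "X \<in> gr N n"
  then obtain x s where "x \<in> gr M n" "s \<in> S" "X = X.F x s" by (auto simp: N_simps)
  then show "dif N X \<in> gr N (n + 1)" by (simp add: N_dif M.gr_carrier N_grI M.dif_degree)
next
  fix X i Y j assume "X \<in> gr L i" "Y \<in> gr N j"
  then obtain a s y t where "a \<in> gr A i" "s \<in> S" "X = Y.F a s" "y \<in> gr M j" "t \<in> S" "Y = X.F y t"
    by (auto simp: N_simps L_simps)
  then show "act N X Y \<in> gr N (i + j)"
    by (simp add: N_act A.C.gr_carrier M.gr_carrier N_grI act_degree denoms_mult)
next
  fix X Y assume "X \<in> carrier L" "Y \<in> carrier N"
  then obtain a s y t where "a \<in> carrier A" "s \<in> S" "X = Y.F a s" "y \<in> carrier M" "t \<in> S" "Y = X.F y t"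
    by (auto simp: N_simps L_simps)
  then show "act N X Y \<in> carrier N" by (simp add: N_act N_carrierI act_carrier denoms_mult)
next
  fix X X' Y assume X: "X \<in> carrier L" "X' \<in> carrier L" and "Y \<in> carrier N"
  then obtain y t where y: "y \<in> carrier M" "t \<in> S" "Y = X.F y t" by (auto simp: N_simps)
  obtain a b s where "a \<in> carrier A" "b \<in> carrier A" "s \<in> S" "X = Y.F a s" "X' = Y.F b s"
    using X by (rule L_common_carrier)
  then show "act N (X \<oplus>\<^bsub>L\<^esub> X') Y = act N X Y \<oplus>\<^bsub>N\<^esub> act N X' Y"
    using y by (simp add: L_add_same N_act act_carrier act_add_left N_add_same denoms_mult)
next
  fix X Y Y' assume "X \<in> carrier L" and Y: "Y \<in> carrier N" "Y' \<in> carrier N"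
  then obtain a s where a: "a \<in> carrier A" "s \<in> S" "X = Y.F a s" by (auto simp: L_simps)
  obtain y y' t where "y \<in> carrier M" "y' \<in> carrier M" "t \<in> S" "Y = X.F y t" "Y' = X.F y' t"
    using Y by (rule N_common_carrier)
  then show "act N X (Y \<oplus>\<^bsub>N\<^esub> Y') = act N X Y \<oplus>\<^bsub>N\<^esub> act N X Y'"
    using a by (simp add: N_act act_carrier act_add_right N_add_same denoms_mult)
next
  fix X X' Y assume "X \<in> carrier L" "X' \<in> carrier L" "Y \<in> carrier N"
  then obtain a s b r y t where *: "a \<in> carrier A" "s \<in> S" "X = Y.F a s" "b \<in> carrier A" "r \<in> S" "X' = Y.F b r"
    "y \<in> carrier M" "t \<in> S" "Y = X.F y t" by (auto simp: N_simps L_simps)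
  then show "act N (X \<otimes>\<^bsub>L\<^esub> X') Y = act N X (act N X' Y)"
    using X.denom_carrier by (simp add: L_mult N_act act_carrier act_mult denoms_mult A.R.m_assoc)
next
  fix X i Y assume "X \<in> gr L i" "Y \<in> carrier N"
  then obtain a s y t where *: "a \<in> gr A i" "s \<in> S" "X = Y.F a s" "y \<in> carrier M" "t \<in> S" "Y = X.F y t"
    by (auto simp: N_simps L_simps)
  have ac: "a \<in> carrier A" "dif A a \<in> carrier A" using * A.C.gr_carrier A.C.dif_closed by auto
  show "dif N (act N X Y) = act N (dif L X) Y \<oplus>\<^bsub>N\<^esub> signed N i (act N X (dif N Y))"
    using * ac by (simp add: N_act N_dif L_dif act_carrier denoms_mult M.dif_closed N_signed N_add_same dif_act)
qed

text \<open>A fraction that is a cocycle has a cocycle as numerator once it is expanded by a denominator that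
  kills the differential of the given numerator.\<close>

lemma N_cocycleE:
  assumes "Z \<in> cocycles N n"
  obtains z s where "z \<in> cocycles M n" "s \<in> S" "Z = X.F z s"
proof -
  obtain x s where x: "x \<in> gr M n" "s \<in> S" "Z = X.F x s" using assms by (auto simp: cocycles_def N_simps)
  have xc: "x \<in> carrier M" using x(1) by (rule M.gr_carrier)
  have "X.F (dif M x) s = X.F \<zero>\<^bsub>M\<^esub> \<one>\<^bsub>A\<^esub>"
    using assms x xc by (simp add: cocycles_def N_dif N_simps)
  then obtain u where u: "u \<in> S" "act M u (dif M x) = \<zero>\<^bsub>M\<^esub>"
    using X.F_eq_zero_iff[OF M.dif_closed[OF xc] x(2)] by blast
  show thesis
  proof (rule that)
    show "act M u x \<in> cocycles M n"
      using x u xc by (simp add: cocycles_def act_gr0_degree X.denom_gr0 dif_act0)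
    show "u \<otimes>\<^bsub>A\<^esub> s \<in> S" by (rule denoms_mult[OF u(1) x(2)])
    show "Z = X.F (act M u x) (u \<otimes>\<^bsub>A\<^esub> s)" using x xc u(1) X.F_expand by simp
  qed
qed

lemma N_cocycleI: "\<lbrakk>z \<in> cocycles M n; s \<in> S\<rbrakk> \<Longrightarrow> X.F z s \<in> cocycles N n"
  by (auto simp: cocycles_def N_simps N_dif[unfolded N_simps] M.gr_carrier X.F_zero)

lemma N_cobound_iff:
  assumes z: "z \<in> gr M n" and s: "s \<in> S"
  shows "X.F z s \<in> cobounds N n \<longleftrightarrow> (\<exists>u \<in> S. act M u z \<in> cobounds M n)"
proof
  have zc: "z \<in> carrier M" using z by (rule M.gr_carrier)
  assume "X.F z s \<in> cobounds N n"
  then obtain Y where "Y \<in> gr N (n - 1)" "X.F z s = dif N Y" by (auto simp: cobounds_def)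
  then obtain y t where y: "y \<in> gr M (n - 1)" "t \<in> S" "X.F z s = dif N (X.F y t)" by (auto simp: N_simps)
  have yc: "y \<in> carrier M" using y(1) by (rule M.gr_carrier)
  have "X.F z s = X.F (dif M y) t" using y yc by (simp add: N_dif)
  then obtain u where u: "u \<in> S" "act M u (act M t z) = act M u (act M s (dif M y))"
    using X.F_eq_iff[OF zc M.dif_closed[OF yc] s y(2)] by blast
  have "act M (u \<otimes>\<^bsub>A\<^esub> t) z = dif M (act M u (act M s y))"
    using u y zc yc s by (simp add: X.denom_act_mult dif_act0 X.denom_gr0 X.denom_act)
  moreover have "act M u (act M s y) \<in> gr M (n - 1)"
    using u(1) s y(1) by (intro act_gr0_degree X.denom_gr0)
  ultimately have "act M (u \<otimes>\<^bsub>A\<^esub> t) z \<in> cobounds M n" by (simp add: cobounds_def)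
  then show "\<exists>u \<in> S. act M u z \<in> cobounds M n" using denoms_mult[OF u(1) y(2)] by blast
next
  have zc: "z \<in> carrier M" using z by (rule M.gr_carrier)
  assume "\<exists>u \<in> S. act M u z \<in> cobounds M n"
  then obtain u y where u: "u \<in> S" "y \<in> gr M (n - 1)" "act M u z = dif M y" by (auto simp: cobounds_def)
  have us: "u \<otimes>\<^bsub>A\<^esub> s \<in> S" by (rule denoms_mult[OF u(1) s])
  have "X.F z s = X.F (dif M y) (u \<otimes>\<^bsub>A\<^esub> s)" using X.F_expand(1)[OF zc s u(1)] u(3) by simp
  also have "\<dots> = dif N (X.F y (u \<otimes>\<^bsub>A\<^esub> s))" using N_dif[OF M.gr_carrier[OF u(2)] us] by simp
  finally show "X.F z s \<in> cobounds N n"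
    unfolding cobounds_def using u(2) us by (auto simp: N_simps)
qed

lemma loc_max_ideal:
  assumes L: "dg_ring L"
  shows "ideal (loc_max A p) (H0 L)"
proof -
  interpret L: dg_ring L by (rule L)
  interpret H: cring "H0 L" by (rule L.H0_cring)
  interpret p: primeideal p "H0 A" by (rule prime)
  have mx: "loc_max A p = {coh_class L 0 (Y.F a s) | a s. a \<in> prime_preimage A p \<and> s \<in> S}"
    by (simp add: loc_max_def self_mod_def)
  have Lg: "Y.F a s \<in> gr L 0" if "a \<in> gr A 0" "s \<in> S" for a s using that by (auto simp: L_simps)
  have pp_gr: "a \<in> gr A 0" "a \<in> carrier A" if "a \<in> prime_preimage A p" for a
    using that A.C.gr_carrier by (auto simp: prime_preimage_def)
  have pp_mult: "c \<otimes>\<^bsub>A\<^esub> a \<in> prime_preimage A p" if "c \<in> gr A 0" "a \<in> prime_preimage A p" for c a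
    using that p.I_l_closed[of "coh_class A 0 a" "coh_class A 0 c"]
    by (simp add: prime_preimage_def A.gr0_mult A.H0_mult A.H0_carrier)
  have pp_add: "c \<oplus>\<^bsub>A\<^esub> a \<in> prime_preimage A p" if "c \<in> prime_preimage A p" "a \<in> prime_preimage A p" for c a
    using that additive_subgroup.a_closed[OF ideal.axioms(1)[OF p.is_ideal], of "coh_class A 0 c" "coh_class A 0 a"]
    by (simp add: prime_preimage_def A.C.gr_add A.H0_add)
  have pp_zero: "\<zero>\<^bsub>A\<^esub> \<in> prime_preimage A p"
    using additive_subgroup.zero_closed[OF ideal.axioms(1)[OF p.is_ideal]] by (simp add: prime_preimage_def A.H0_zero A.C.coh_class_zero)
  have mult: "x \<otimes>\<^bsub>H0 L\<^esub> y \<in> loc_max A p" if xy: "x \<in> carrier (H0 L)" "y \<in> loc_max A p" for x y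
  proof -
    obtain c t where x: "c \<in> gr A 0" "t \<in> S" "x = coh_class L 0 (Y.F c t)"
      using xy(1) by (auto simp: L.H0_carrier L_simps)
    obtain a s where y: "a \<in> prime_preimage A p" "s \<in> S" "y = coh_class L 0 (Y.F a s)"
      using xy(2) by (auto simp: mx)
    have "x \<otimes>\<^bsub>H0 L\<^esub> y = coh_class L 0 (Y.F (c \<otimes>\<^bsub>A\<^esub> a) (t \<otimes>\<^bsub>A\<^esub> s))"
      using x y pp_gr[OF y(1)] by (simp add: L.H0_mult Lg L_mult A.C.gr_carrier)
    then show ?thesis using pp_mult[OF x(1) y(1)] denoms_mult[OF x(2) y(2)] by (auto simp: mx)
  qed
  show ?thesis
  proof (rule H.ideal_if_closed[OF _ _ _ mult])
    show "loc_max A p \<subseteq> carrier (H0 L)" using Lg pp_gr by (auto simp: mx L.H0_carrier)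
    show "loc_max A p \<noteq> {}" using pp_zero denoms_one by (auto simp: mx)
  next
    fix x y assume "x \<in> loc_max A p" "y \<in> loc_max A p"
    then obtain a s b t where x: "a \<in> prime_preimage A p" "s \<in> S" "x = coh_class L 0 (Y.F a s)"
      and y: "b \<in> prime_preimage A p" "t \<in> S" "y = coh_class L 0 (Y.F b t)" by (auto simp: mx)
    have "x \<oplus>\<^bsub>H0 L\<^esub> y = coh_class L 0 (Y.F ((t \<otimes>\<^bsub>A\<^esub> a) \<oplus>\<^bsub>A\<^esub> (s \<otimes>\<^bsub>A\<^esub> b)) (s \<otimes>\<^bsub>A\<^esub> t))"
      using x y pp_gr[OF x(1)] pp_gr[OF y(1)] by (simp add: L.H0_add Lg L_add_gen)
    then show "x \<oplus>\<^bsub>H0 L\<^esub> y \<in> loc_max A p"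
      using pp_add[OF pp_mult[OF X.denom_gr0[OF y(2)] x(1)] pp_mult[OF X.denom_gr0[OF x(2)] y(1)]]
        denoms_mult[OF x(2) y(2)] by (auto simp: mx)
  qed
qed

end


section \<open>Associated primes of a DG-module and of its bottom cohomology\<close>

lemma (in module) frac_zero_if_killed:
  assumes p: "primeideal p R" and u: "u \<in> carrier R - p" "u \<odot>\<^bsub>M\<^esub> x = \<zero>\<^bsub>M\<^esub>"
    and x: "x \<in> carrier M" "s \<in> carrier R - p"
  shows "frac (carrier R - p) (carrier M) (smult M) x s = frac (carrier R - p) (carrier M) (smult M) \<zero>\<^bsub>M\<^esub> \<one>"
proof -
  interpret p: primeideal p R by (rule p)
  have S_mult: "a \<otimes> b \<in> carrier R - p" if "a \<in> carrier R - p" "b \<in> carrier R - p" for a b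
    using that p.I_prime by auto
  have one: "\<one> \<in> carrier R - p" using p.one_imp_carrier p.I_notcarr by auto
  have same: "(\<exists>v \<in> carrier R - p. v \<odot>\<^bsub>M\<^esub> (t \<odot>\<^bsub>M\<^esub> x) = v \<odot>\<^bsub>M\<^esub> (s \<odot>\<^bsub>M\<^esub> y)) \<longleftrightarrow>
      (\<exists>v \<in> carrier R - p. v \<odot>\<^bsub>M\<^esub> (t \<odot>\<^bsub>M\<^esub> \<zero>\<^bsub>M\<^esub>) = v \<odot>\<^bsub>M\<^esub> (\<one> \<odot>\<^bsub>M\<^esub> y))"
    if y: "y \<in> carrier M" and t: "t \<in> carrier R - p" for y t
  proof
    assume "\<exists>v \<in> carrier R - p. v \<odot>\<^bsub>M\<^esub> (t \<odot>\<^bsub>M\<^esub> x) = v \<odot>\<^bsub>M\<^esub> (s \<odot>\<^bsub>M\<^esub> y)"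
    then obtain v where v: "v \<in> carrier R - p" "v \<odot>\<^bsub>M\<^esub> (t \<odot>\<^bsub>M\<^esub> x) = v \<odot>\<^bsub>M\<^esub> (s \<odot>\<^bsub>M\<^esub> y)" by blast
    have "(u \<otimes> (v \<otimes> s)) \<odot>\<^bsub>M\<^esub> y = u \<odot>\<^bsub>M\<^esub> (v \<odot>\<^bsub>M\<^esub> (s \<odot>\<^bsub>M\<^esub> y))"
      using u(1) v(1) x y by (simp add: smult_assoc1)
    also have "\<dots> = u \<odot>\<^bsub>M\<^esub> (v \<odot>\<^bsub>M\<^esub> (t \<odot>\<^bsub>M\<^esub> x))" by (simp only: v(2))
    also have "\<dots> = v \<odot>\<^bsub>M\<^esub> (t \<odot>\<^bsub>M\<^esub> (u \<odot>\<^bsub>M\<^esub> x))"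
      using u(1) v(1) x t by (simp add: smult_left_commute[of u])
    also have "\<dots> = \<zero>\<^bsub>M\<^esub>" using u(2) v(1) t by simp
    finally show "\<exists>v \<in> carrier R - p. v \<odot>\<^bsub>M\<^esub> (t \<odot>\<^bsub>M\<^esub> \<zero>\<^bsub>M\<^esub>) = v \<odot>\<^bsub>M\<^esub> (\<one> \<odot>\<^bsub>M\<^esub> y)"
      using S_mult[OF u(1) S_mult[OF v(1) x(2)]] y t by (intro bexI[of _ "u \<otimes> (v \<otimes> s)"]) auto
  next
    assume "\<exists>v \<in> carrier R - p. v \<odot>\<^bsub>M\<^esub> (t \<odot>\<^bsub>M\<^esub> \<zero>\<^bsub>M\<^esub>) = v \<odot>\<^bsub>M\<^esub> (\<one> \<odot>\<^bsub>M\<^esub> y)"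
    then obtain v where v: "v \<in> carrier R - p" "v \<odot>\<^bsub>M\<^esub> y = \<zero>\<^bsub>M\<^esub>" using t y by auto
    have "(u \<otimes> v) \<odot>\<^bsub>M\<^esub> (t \<odot>\<^bsub>M\<^esub> x) = v \<odot>\<^bsub>M\<^esub> (t \<odot>\<^bsub>M\<^esub> (u \<odot>\<^bsub>M\<^esub> x))"
      using u v x t by (simp add: smult_assoc1 smult_left_commute[of u])
    also have "\<dots> = \<zero>\<^bsub>M\<^esub>" using u(2) v(1) t by simp
    also have "\<zero>\<^bsub>M\<^esub> = u \<odot>\<^bsub>M\<^esub> (s \<odot>\<^bsub>M\<^esub> (v \<odot>\<^bsub>M\<^esub> y))" using v u x by simp
    also have "\<dots> = (u \<otimes> v) \<odot>\<^bsub>M\<^esub> (s \<odot>\<^bsub>M\<^esub> y)"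
      using u v x y by (simp add: smult_assoc1 smult_left_commute[of v])
    finally show "\<exists>v \<in> carrier R - p. v \<odot>\<^bsub>M\<^esub> (t \<odot>\<^bsub>M\<^esub> x) = v \<odot>\<^bsub>M\<^esub> (s \<odot>\<^bsub>M\<^esub> y)"
      using S_mult[OF u(1) v(1)] by blast
  qed
  let ?rel = "frac_rel (carrier R - p) (carrier M) (smult M)"
  have "((x, s), (y, t)) \<in> ?rel \<longleftrightarrow> ((\<zero>\<^bsub>M\<^esub>, \<one>), (y, t)) \<in> ?rel" for y t
    unfolding frac_rel_def mem_Collect_eq case_prod_conv
    using same[of y t] x one M.zero_closed by blast
  then show ?thesis unfolding frac_def by auto
qed

text \<open>Each \<open>a\<close> in \<open>p\<close> has its own denominator \<open>u\<close>. Among the multiples of \<open>z\<close> by denominators, one with a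
  maximal annihilator has all of \<open>p\<close> in that annihilator.\<close>

lemma (in module) assoc_prime_if_locally:
  assumes R: "noetherian_ring R" and p: "primeideal p R" and z: "z \<in> carrier M"
    and nz: "\<And>u. u \<in> carrier R - p \<Longrightarrow> u \<odot>\<^bsub>M\<^esub> z \<noteq> \<zero>\<^bsub>M\<^esub>"
    and killed: "\<And>a. a \<in> p \<Longrightarrow> \<exists>u \<in> carrier R - p. u \<odot>\<^bsub>M\<^esub> (a \<odot>\<^bsub>M\<^esub> z) = \<zero>\<^bsub>M\<^esub>"
  shows "p \<in> assoc_primes R M"
proof -
  interpret p: primeideal p R by (rule p)
  have S_mult: "a \<otimes> b \<in> carrier R - p" if "a \<in> carrier R - p" "b \<in> carrier R - p" for a b
    using that p.I_prime by auto
  have one: "\<one> \<in> carrier R - p" using p.one_imp_carrier p.I_notcarr by auto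
  let ?F = "(\<lambda>u. ann R M (u \<odot>\<^bsub>M\<^esub> z)) ` (carrier R - p)"
  have "?F \<noteq> {}" using one by blast
  moreover have "ideal I R" if "I \<in> ?F" for I using that ann_ideal z by auto
  ultimately obtain I where I: "I \<in> ?F" and max: "\<And>J. \<lbrakk>J \<in> ?F; I \<subseteq> J\<rbrakk> \<Longrightarrow> J = I"
    by (rule noetherian_ring.maximal_ideal_in_family[OF R]) (assumption, blast)
  obtain u where u: "u \<in> carrier R - p" "I = ann R M (u \<odot>\<^bsub>M\<^esub> z)" using I by blast
  have uz: "u \<odot>\<^bsub>M\<^esub> z \<in> carrier M" using u z by simp
  have "p \<subseteq> ann R M (u \<odot>\<^bsub>M\<^esub> z)"
  proof
    fix a assume a: "a \<in> p"
    then have ac: "a \<in> carrier R" using p.a_subset by blast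
    obtain v where v: "v \<in> carrier R - p" "v \<odot>\<^bsub>M\<^esub> (a \<odot>\<^bsub>M\<^esub> z) = \<zero>\<^bsub>M\<^esub>" using killed[OF a] by blast
    have "ann R M ((v \<otimes> u) \<odot>\<^bsub>M\<^esub> z) = I"
    proof (rule max)
      show "ann R M ((v \<otimes> u) \<odot>\<^bsub>M\<^esub> z) \<in> ?F" using S_mult[OF v(1) u(1)] by blast
      show "I \<subseteq> ann R M ((v \<otimes> u) \<odot>\<^bsub>M\<^esub> z)"
        using ann_subset_ann_smult[OF uz, of v] v(1) u z by (simp add: smult_assoc1)
    qed
    moreover have "a \<odot>\<^bsub>M\<^esub> ((v \<otimes> u) \<odot>\<^bsub>M\<^esub> z) = u \<odot>\<^bsub>M\<^esub> (v \<odot>\<^bsub>M\<^esub> (a \<odot>\<^bsub>M\<^esub> z))"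
      using u v(1) ac z by (simp add: smult_assoc1 smult_left_commute[of a] smult_left_commute[of v u])
    ultimately show "a \<in> ann R M (u \<odot>\<^bsub>M\<^esub> z)" using u v ac by (auto simp: ann_def)
  qed
  moreover have "ann R M (u \<odot>\<^bsub>M\<^esub> z) \<subseteq> p"
  proof
    fix r assume r: "r \<in> ann R M (u \<odot>\<^bsub>M\<^esub> z)"
    show "r \<in> p"
    proof (rule ccontr)
      assume "r \<notin> p"
      then have "r \<otimes> u \<in> carrier R - p" using r u(1) by (intro S_mult) (auto simp: ann_def)
      from nz[OF this] show False using r u(1) z by (simp add: ann_def smult_assoc1)
    qed
  qed
  ultimately show ?thesis using p uz by (auto simp: assoc_primes_def)
qed

text \<open>By the hypothesis on the support the localization has infimum \<open>i\<close> as well, so membership in \<open>Ass\<close> says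
  that its depth is \<open>i\<close>. This gives a nonzero class of degree \<open>i\<close> in the localization that the
  maximal ideal kills. A numerator of it, multiplied by a suitable denominator, has annihilator \<open>p\<close>.\<close>

lemma Ass_imp_assoc_prime_bottom:
  assumes A: "noetherian_ring (H0 A)" and M: "pre_dg_mod A M"
    and p: "p \<in> Ass A M" and i: "dg_inf M = ereal (of_int i)"
    and supp: "p \<in> Supp (H0 A) (coh M i)"
  shows "p \<in> assoc_primes (H0 A) (coh M i)"
proof -
  interpret M: pre_dg_mod A M by (rule M)
  have pp: "primeideal p (H0 A)" and na: "\<not> acyclic_dg (loc_mod A p M)"
    and dep: "depth (loc_ring A p) (loc_max A p) (loc_mod A p M) = dg_inf (loc_mod A p M)"
    using p by (auto simp: Ass_def)
  interpret lp: localization_at_prime A M p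
    by (intro localization_at_prime.intro localization_at_prime_axioms.intro M pp)
  interpret C: Module.module "H0 A" "coh M i" by (rule M.coh_module)
  let ?L = "loc_ring A p" and ?N = "loc_mod A p M" and ?S = "denoms A p"
  let ?R = "\<lambda>n. RHom_nonzero ?L (residue_mod ?L (loc_max A p)) ?N n"
  obtain n0 where "coh_nonzero ?N n0" using na by (auto simp: acyclic_dg_def)
  then have "dg_inf ?N \<le> ereal (of_int n0)" unfolding dg_inf_def by (intro INF_lower) simp
  then have fin: "dg_inf ?N \<noteq> \<infinity>" by auto
  \<comment> \<open>As the depth is finite, there is a semi-free module over \<open>?L\<close>, which includes that \<open>?L\<close> is a DG-ring.\<close>
  have "\<exists>n. ?R n"
  proof (rule ccontr)
    assume "\<not> ?thesis"
    then have "depth ?L (loc_max A p) ?N = \<infinity>" by (simp add: depth_def top_ereal_def)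
    then show False using dep fin by simp
  qed
  then have L: "dg_ring ?L"
    unfolding RHom_nonzero_def semifree_def dg_mod_def by blast
  interpret L: dg_ring ?L by (rule L)
  have N: "pre_dg_mod ?L ?N" by (rule lp.N_pre_dg_mod[OF L])
  interpret N: pre_dg_mod ?L ?N by (rule N)
  have low: "\<not> coh_nonzero M n" if "n < i" for n using i that by (simp add: dg_inf_eq_iff)
  have Nlow: "\<not> coh_nonzero ?N n" if n: "n < i" for n
  proof
    assume "coh_nonzero ?N n"
    then obtain Z where Z: "Z \<in> cocycles ?N n" "Z \<notin> cobounds ?N n" by (auto simp: N.coh_nonzero_iff)
    obtain z s where z: "z \<in> cocycles M n" "s \<in> ?S" "Z = lp.X.F z s" using Z(1) by (rule lp.N_cocycleE)
    have zb: "z \<in> cobounds M n" using low[OF n] z(1) M.coh_nonzero_iff by blast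
    have "act M \<one>\<^bsub>A\<^esub> z \<in> cobounds M n" using zb M.M.cobounds_carrier by (simp add: M.act_unit)
    then have "Z \<in> cobounds ?N n"
      using lp.N_cobound_iff[of z n s] z lp.denoms_one by (auto simp: cocycles_def)
    then show False using Z(2) by simp
  qed
  have H0S: "coh_class A 0 u \<in> carrier (H0 A) - p \<longleftrightarrow> u \<in> ?S" if "u \<in> gr A 0" for u
    using that by (auto simp: lp.denoms_iff M.A.H0_carrier)
  have kill: "coh_class A 0 u \<odot>\<^bsub>coh M i\<^esub> coh_class M i z = \<zero>\<^bsub>coh M i\<^esub> \<longleftrightarrow> act M u z \<in> cobounds M i"
    if "u \<in> gr A 0" "z \<in> cocycles M i" for u z
    using that M.M.coh_class_eq_zero_iff[OF M.M.cocycles_carrier[OF M.act0_cocycles[OF that]]]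
    by (simp add: M.coh_smult M.coh_zero)
  have "coh_nonzero ?N i"
  proof -
    obtain x s where x: "x \<in> carrier (coh M i)" "s \<in> carrier (H0 A) - p"
      "frac (carrier (H0 A) - p) (carrier (coh M i)) (smult (coh M i)) x s
        \<noteq> frac (carrier (H0 A) - p) (carrier (coh M i)) (smult (coh M i)) \<zero>\<^bsub>coh M i\<^esub> \<one>\<^bsub>H0 A\<^esub>"
      using supp by (auto simp: Supp_def)
    obtain z where z: "z \<in> cocycles M i" "x = coh_class M i z" using x(1) by (auto simp: M.coh_carrier)
    have "act M u z \<notin> cobounds M i" if u: "u \<in> ?S" for u
    proof
      assume "act M u z \<in> cobounds M i"
      then have "coh_class A 0 u \<odot>\<^bsub>coh M i\<^esub> x = \<zero>\<^bsub>coh M i\<^esub>"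
        using kill[OF lp.denoms_gr0[OF u] z(1)] z(2) by simp
      moreover have "coh_class A 0 u \<in> carrier (H0 A) - p" using H0S[OF lp.denoms_gr0[OF u]] u by simp
      ultimately show False using C.frac_zero_if_killed[OF pp _ _ x(1,2)] x(3) by blast
    qed
    then have "lp.X.F z \<one>\<^bsub>A\<^esub> \<notin> cobounds ?N i"
      using lp.N_cobound_iff[of z i "\<one>\<^bsub>A\<^esub>"] z(1) lp.denoms_one by (auto simp: cocycles_def)
    then show ?thesis using lp.N_cocycleI[OF z(1) lp.denoms_one] N.coh_nonzero_iff by blast
  qed
  then have "dg_inf ?N = ereal (of_int i)" using Nlow by (simp add: dg_inf_eq_iff)
  then have "?R i" using dep unfolding depth_def by (simp add: INF_int_eq_iff)
  then obtain Z where Z: "Z \<in> cocycles ?N i" "Z \<notin> cobounds ?N i"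
    and Zk: "\<And>a. \<lbrakk>a \<in> gr ?L 0; coh_class ?L 0 a \<in> loc_max A p\<rbrakk> \<Longrightarrow> act ?N a Z \<in> cobounds ?N i"
    using RHom_residue_bottom[OF N lp.loc_max_ideal[OF L] Nlow] by blast
  obtain z s where z: "z \<in> cocycles M i" "s \<in> ?S" "Z = lp.X.F z s" using Z(1) by (rule lp.N_cocycleE)
  have zg: "z \<in> gr M i" "z \<in> carrier M" using z(1) M.M.gr_carrier by (auto simp: cocycles_def)
  have zn: "act M u z \<notin> cobounds M i" if "u \<in> ?S" for u
    using Z(2) lp.N_cobound_iff[OF zg(1) z(2)] z(3) that by blast
  have zk: "\<exists>u \<in> ?S. act M u (act M a z) \<in> cobounds M i" if a: "a \<in> gr A 0" "coh_class A 0 a \<in> p" for a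
  proof -
    let ?a = "lp.Y.F a \<one>\<^bsub>A\<^esub>"
    have "coh_class ?L 0 ?a \<in> loc_max A p"
      using a lp.denoms_one by (auto simp: loc_max_def prime_preimage_def self_mod_def)
    moreover have "?a \<in> gr ?L 0" using a(1) lp.denoms_one by (auto simp: lp.L_simps)
    ultimately have "act ?N ?a Z \<in> cobounds ?N i" by (intro Zk)
    moreover have "act ?N ?a Z = lp.X.F (act M a z) s"
      using a(1) z zg lp.denoms_one M.A.C.gr_carrier lp.X.denom_carrier by (simp add: lp.N_act)
    ultimately show ?thesis using lp.N_cobound_iff[OF M.act_gr0_degree[OF a(1) zg(1)] z(2)] by simp
  qed
  show ?thesis
  proof (rule C.assoc_prime_if_locally[OF A pp])
    show "coh_class M i z \<in> carrier (coh M i)" using z(1) M.coh_carrier by blast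
  next
    fix U assume U: "U \<in> carrier (H0 A) - p"
    then obtain u where u: "u \<in> gr A 0" "U = coh_class A 0 u" by (auto simp: M.A.H0_carrier)
    then show "U \<odot>\<^bsub>coh M i\<^esub> coh_class M i z \<noteq> \<zero>\<^bsub>coh M i\<^esub>"
      using kill[OF u(1) z(1)] zn H0S[OF u(1)] U by simp
  next
    fix P assume P: "P \<in> p"
    then have "P \<in> carrier (H0 A)" using primeideal.axioms(1)[OF pp] ideal.Icarr by metis
    then obtain a where a: "a \<in> gr A 0" "P = coh_class A 0 a" by (auto simp: M.A.H0_carrier)
    then obtain u where u: "u \<in> ?S" "act M u (act M a z) \<in> cobounds M i" using zk P by blast
    have "coh_class A 0 u \<odot>\<^bsub>coh M i\<^esub> (P \<odot>\<^bsub>coh M i\<^esub> coh_class M i z) = \<zero>\<^bsub>coh M i\<^esub>"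
      using kill[OF lp.denoms_gr0[OF u(1)] M.act0_cocycles[OF a(1) z(1)]] u(2) a z(1)
      by (simp add: M.coh_smult)
    moreover have "coh_class A 0 u \<in> carrier (H0 A) - p"
      using H0S[OF lp.denoms_gr0[OF u(1)]] u(1) by simp
    ultimately show "\<exists>U \<in> carrier (H0 A) - p. U \<odot>\<^bsub>coh M i\<^esub> (P \<odot>\<^bsub>coh M i\<^esub> coh_class M i z) = \<zero>\<^bsub>coh M i\<^esub>"
      by blast
  qed
qed

theorem theorem3p8:
  fixes A :: "'a dg" and m p :: "'a set set"
    and M :: "('a, 'm) dg_module" and i :: int
  assumes "noetherian_local_dg_ring A m"
    and "D_plus_f A M"
    and "p \<in> Ass A M"
    and "dg_inf M = ereal (of_int i)"
    and "p \<in> Supp (H0 A) (coh M i)"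
  shows "seq_depth A m M \<le> krull_dim (H0 A Quot p)"
proof -
  interpret M: dg_mod A M using assms(2) by (simp add: D_plus_f_def)
  have "noetherian_ring (H0 A)" using assms(1) by (simp add: noetherian_local_dg_ring_def)
  then have "p \<in> assoc_primes (H0 A) (coh M i)"
    using M.pre_dg_mod_axioms assms(3-5) by (rule Ass_imp_assoc_prime_bottom)
  moreover have "\<not> coh_nonzero M k" if "k < i" for k using assms(4) that by (simp add: dg_inf_eq_iff)
  ultimately show ?thesis using seq_depth_le_krull_dim_assoc[OF assms(1,2)] by blast
qed

end
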